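(* Let $(\Omega,\Sigma,\mu)$ be a $\sigma$-finite measure space and $\gamma=\mu(\Omega)\in(0,\infty]$. Let $\psi:[0,\gamma)\to[0,\infty)$ be a non-zero increasing concave function, continuous on $(0,\gamma)$, with $\psi(0)=0$, satisfying either condition (A) or condition (B). Then the Marcinkiewicz space $M_\psi(\mu)$ over $(\Omega,\Sigma,\mu)$ is a Grothendieck space.
   Context: For $f\in L_0(\mu)$, $f^*(t)=\inf\{s\ge0:\mu(\{|f|>s\})\le t\}$. $M_\psi(\mu)=\{f\in L_0(\mu):\|f\|_{M_\psi(\mu)}<\infty\}$, where $\|f\|_{M_\psi(\mu)}=\sup_{0<t<\gamma}\frac{1}{\psi(t)}\int_0^t f^*(s)\,ds$. Condition (A): $\gamma=\infty$ and $\liminf_{t\downarrow0}\psi(2t)/\psi(t)>1$ and $\liminf_{t\to\infty}\psi(2t)/\psi(t)>1$. Condition (B): $\gamma<\infty$ and $\liminf_{t\downarrow0}\psi(2t)/\psi(t)>1$. A Banach space $X$ is a Grothendieck space if every weak-$*$ convergent sequence in $X^*$ converges weakly. *)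

theory Defs
  imports "HOL-Probability.Probability"
begin

definition drearr :: "'a measure \<Rightarrow> ('a \<Rightarrow> real) \<Rightarrow> real \<Rightarrow> ennreal" where
  "drearr M f t = Inf {s::ennreal. emeasure M {x \<in> space M. s < ennreal \<bar>f x\<bar>} \<le> ennreal t}"

definition gam :: "'a measure \<Rightarrow> ennreal" where
  "gam M = emeasure M (space M)"

definition marc_norm_e :: "'a measure \<Rightarrow> (real \<Rightarrow> real) \<Rightarrow> ('a \<Rightarrow> real) \<Rightarrow> ennreal" where
  "marc_norm_e M \<psi> f =
     (SUP t \<in> {t::real. 0 < t \<and> ennreal t < gam M}.
        (\<integral>\<^sup>+ s. indicator {0..t} s * drearr M f s \<partial>lborel) / ennreal (\<psi> t))"

definition marc_norm :: "'a measure \<Rightarrow> (real \<Rightarrow> real) \<Rightarrow> ('a \<Rightarrow> real) \<Rightarrow> real" where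
  "marc_norm M \<psi> f = enn2real (marc_norm_e M \<psi> f)"

text \<open>M_psi(mu): measurable functions (elements of L_0) with finite Marcinkiewicz norm.
  Functions equal a.e. have the same (semi)norm; working with the seminormed space of
  functions rather than the quotient does not change duals or the Grothendieck property.\<close>
definition marc_space :: "'a measure \<Rightarrow> (real \<Rightarrow> real) \<Rightarrow> ('a \<Rightarrow> real) set" where
  "marc_space M \<psi> = {f \<in> borel_measurable M. marc_norm_e M \<psi> f < \<infinity>}"

definition dual_space :: "('b \<Rightarrow> real) set \<Rightarrow> (('b \<Rightarrow> real) \<Rightarrow> real) \<Rightarrow> (('b \<Rightarrow> real) \<Rightarrow> real) set" where
  "dual_space X N = {\<phi>.
     (\<forall>f\<in>X. \<forall>g\<in>X. \<phi> (\<lambda>x. f x + g x) = \<phi> f + \<phi> g) \<and>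
     (\<forall>f\<in>X. \<forall>c::real. \<phi> (\<lambda>x. c * f x) = c * \<phi> f) \<and>
     (\<exists>C. \<forall>f\<in>X. \<bar>\<phi> f\<bar> \<le> C * N f) \<and>
     (\<forall>f. f \<notin> X \<longrightarrow> \<phi> f = 0)}"

definition dual_norm :: "('b \<Rightarrow> real) set \<Rightarrow> (('b \<Rightarrow> real) \<Rightarrow> real) \<Rightarrow> (('b \<Rightarrow> real) \<Rightarrow> real) \<Rightarrow> real" where
  "dual_norm X N \<phi> = (SUP f \<in> {f \<in> X. N f \<le> 1}. \<bar>\<phi> f\<bar>)"

definition bidual_space :: "('b \<Rightarrow> real) set \<Rightarrow> (('b \<Rightarrow> real) \<Rightarrow> real)
     \<Rightarrow> ((('b \<Rightarrow> real) \<Rightarrow> real) \<Rightarrow> real) set" where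
  "bidual_space X N = {\<Phi>.
     (\<forall>\<phi>\<in>dual_space X N. \<forall>\<eta>\<in>dual_space X N. \<Phi> (\<lambda>f. \<phi> f + \<eta> f) = \<Phi> \<phi> + \<Phi> \<eta>) \<and>
     (\<forall>\<phi>\<in>dual_space X N. \<forall>c::real. \<Phi> (\<lambda>f. c * \<phi> f) = c * \<Phi> \<phi>) \<and>
     (\<exists>C. \<forall>\<phi>\<in>dual_space X N. \<bar>\<Phi> \<phi>\<bar> \<le> C * dual_norm X N \<phi>)}"

definition banach_fun_space :: "('b \<Rightarrow> real) set \<Rightarrow> (('b \<Rightarrow> real) \<Rightarrow> real) \<Rightarrow> bool" where
  "banach_fun_space X N \<longleftrightarrow>
     (\<lambda>x. 0) \<in> X \<and>
     (\<forall>f\<in>X. \<forall>g\<in>X. (\<lambda>x. f x + g x) \<in> X) \<and>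
     (\<forall>f\<in>X. \<forall>c::real. (\<lambda>x. c * f x) \<in> X) \<and>
     (\<forall>f\<in>X. 0 \<le> N f) \<and>
     (\<forall>f\<in>X. \<forall>g\<in>X. N (\<lambda>x. f x + g x) \<le> N f + N g) \<and>
     (\<forall>f\<in>X. \<forall>c::real. N (\<lambda>x. c * f x) = \<bar>c\<bar> * N f) \<and>
     (\<forall>u::nat \<Rightarrow> ('b \<Rightarrow> real). (\<forall>n. u n \<in> X) \<and>
        (\<forall>e>0. \<exists>K. \<forall>m\<ge>K. \<forall>n\<ge>K. N (\<lambda>x. u m x - u n x) < e)
        \<longrightarrow> (\<exists>f\<in>X. (\<lambda>n. N (\<lambda>x. u n x - f x)) \<longlonglongrightarrow> 0))"

definition grothendieck_space :: "('b \<Rightarrow> real) set \<Rightarrow> (('b \<Rightarrow> real) \<Rightarrow> real) \<Rightarrow> bool" where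
  "grothendieck_space X N \<longleftrightarrow> banach_fun_space X N \<and>
     (\<forall>\<phi>s \<phi>. (\<forall>n. \<phi>s n \<in> dual_space X N) \<and> \<phi> \<in> dual_space X N \<and>
        (\<forall>f\<in>X. (\<lambda>n. \<phi>s n f) \<longlonglongrightarrow> \<phi> f)
        \<longrightarrow> (\<forall>\<Phi>\<in>bidual_space X N. (\<lambda>n. \<Phi> (\<phi>s n)) \<longlonglongrightarrow> \<Phi> \<phi>))"

definition condA :: "'a measure \<Rightarrow> (real \<Rightarrow> real) \<Rightarrow> bool" where
  "condA M \<psi> \<longleftrightarrow> gam M = \<infinity> \<and>
     Liminf (at_right 0) (\<lambda>t. ereal (\<psi> (2*t) / \<psi> t)) > 1 \<and>
     Liminf at_top (\<lambda>t. ereal (\<psi> (2*t) / \<psi> t)) > 1"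

definition condB :: "'a measure \<Rightarrow> (real \<Rightarrow> real) \<Rightarrow> bool" where
  "condB M \<psi> \<longleftrightarrow> gam M < \<infinity> \<and>
     Liminf (at_right 0) (\<lambda>t. ereal (\<psi> (2*t) / \<psi> t)) > 1"

end

theory Submission
  imports Defs
begin

text \<open>Weak* null functionals \<open>\<phi>\<^sub>i\<close> are weakly null as soon as, for every such sequence, some convex
  combinations are small in norm; this uses only linearity of an element of the bidual.  Under (A) or (B) the
  unit ball of \<open>M\<^sub>\<psi>\<close> is, up to constants, described by the measures of the dyadic level sets
  \<open>2\<^sup>k < |f| \<le> 2\<^sup>k\<^sup>+\<^sup>1\<close>, so suprema of sequences with summable level bounds stay in the space, and a
  supremum of \<open>J\<close> elements of the ball has norm \<open>o(J)\<close>.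

  A gliding hump (Phillips) shows that the moduli \<open>|\<phi>\<^sub>i|\<close> tend to zero on sequences
  \<open>h\<^sub>j \<ge> 0\<close> with \<open>\<Sum> h\<^sub>j\<close> bounded in the space.  Consequently one fixed \<open>G\<close> dominates, up to
  \<open>\<epsilon>\<close> and for all \<open>\<phi>\<^sub>i\<close> simultaneously, every element with small levels, and each single functional
  is almost carried by an order interval.  On an order interval, convex combinations of the \<open>\<phi>\<^sub>i\<close>
  become small as for \<open>L\<^sub>\<infinity>\<close>.  Alternating the last two facts yields
  convex combinations \<open>\<psi>\<^sub>b\<close> carried by disjoint bands \<open>2 G\<^sub>b < |f| \<le> 2 G\<^sub>b\<^sub>+\<^sub>1\<close>.  For \<open>f\<close> in the ball, only
  boundedly many bands can contain a heavy portion of the levels that matters to \<open>\<psi>\<^sub>b\<close>, and the light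
  portions are dominated by \<open>G\<close>; hence the averages of the \<open>\<psi>\<^sub>b\<close> tend to zero in norm.\<close>

subsection \<open>Uniform continuity of exhaustive families and dyadic levels\<close>

text \<open>The norm of the space is in general not order continuous, so functionals need not be
  integrals, and weak compactness has to be treated through finitely additive set functions such as
  the modulus of a functional at \<open>indicator B x * G x\<close>. Nor is the unit ball order
  bounded in general: smallness on order intervals, which settles the case of bounded functions,
  does not yet give smallness in norm. Conditions (A) and (B) help through the geometric decay of
  \<open>\<psi> (t / 2^i)\<close>. Cutting a function sufficiently many levels above the critical
  one gives the norm bound \<open>C + e * J\<close> with \<open>e\<close> arbitrarily small, and
  this beats any functional that is at least a fixed amount on each of \<open>J\<close> pieces whose
  sum is controlled by a supremum. Averaging over bands succeeds because the number of bands that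
  are bad for one function has a bound independent of how many bands are averaged.\<close>

lemma sum_half_powers_le: "finite I \<Longrightarrow> (\<Sum>a\<in>I. (1/2)^a) \<le> (2::real)"
  using sum_le_suminf[of "\<lambda>a. (1/2::real)^a" I] suminf_geometric[of "1/2::real"] by simp

lemma suminf_half_powers: "(\<Sum>i. ennreal ((1/2)^i)) = ennreal 2"
  using geometric_sums[of "1/2::real"] by (intro suminf_ennreal_eq) auto

text \<open>This is the Vitali--Hahn--Saks theorem for finitely additive set functions (Ando).\<close>

lemma uniformly_exhaustive_imp_uniformly_continuous:
  fixes \<nu> :: "'i \<Rightarrow> 'b set \<Rightarrow> real"
  assumes ring: "ring_of_sets \<Omega> \<A>"
    and mono: "\<And>i A B. i \<in> F \<Longrightarrow> A \<in> \<A> \<Longrightarrow> B \<in> \<A> \<Longrightarrow> A \<subseteq> B \<Longrightarrow> \<nu> i A \<le> \<nu> i B"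
    and sub: "\<And>i A B. i \<in> F \<Longrightarrow> A \<in> \<A> \<Longrightarrow> B \<in> \<A> \<Longrightarrow> \<nu> i (A \<union> B) \<le> \<nu> i A + \<nu> i B"
    and empty: "\<And>i. i \<in> F \<Longrightarrow> \<nu> i {} = 0"
    and exh: "\<And>i E. (\<And>n::nat. i n \<in> F) \<Longrightarrow> range E \<subseteq> \<A> \<Longrightarrow> disjoint_family E
                \<Longrightarrow> (\<lambda>n. \<nu> (i n) (E n)) \<longlonglongrightarrow> 0"
    and eps: "0 < (\<epsilon>::real)"
  shows "\<exists>I \<kappa>. finite I \<and> I \<subseteq> F \<and> 0 < (\<kappa>::real) \<and>
    (\<forall>B\<in>\<A>. (\<Sum>l\<in>I. \<nu> l B) \<le> \<kappa> \<longrightarrow> (\<forall>i\<in>F. \<nu> i B \<le> \<epsilon>))"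
proof (rule ccontr)
  assume "\<not> ?thesis"
  then have no: "\<exists>B\<in>\<A>. \<exists>i\<in>F. (\<Sum>l\<in>I. \<nu> l B) \<le> \<kappa> \<and> \<epsilon> < \<nu> i B"
    if "finite I" "I \<subseteq> F" "0 < \<kappa>" for I \<kappa>
    using that by (meson not_le)
  interpret ring_of_sets \<Omega> \<A> by (rule ring)
  have nn: "0 \<le> \<nu> i A" if "i \<in> F" "A \<in> \<A>" for i A
    using mono[of i "{}" A] empty[of i] that by auto
  have sub_UN: "\<nu> i (\<Union>l\<in>L. A l) \<le> (\<Sum>l\<in>L. \<nu> i (A l))"
    if "finite L" "i \<in> F" "\<And>l. A l \<in> \<A>" for i L and A :: "nat \<Rightarrow> 'b set"
    using that(1)
  proof induction
    case (insert x L)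
    have "\<nu> i (A x \<union> (\<Union>l\<in>L. A l)) \<le> \<nu> i (A x) + \<nu> i (\<Union>l\<in>L. A l)"
      by (rule sub) (use insert that in auto)
    then show ?case using insert by simp
  qed (simp add: empty that)
  \<comment> \<open>The recursion ranges over arbitrary histories \<open>f\<close>, so the
    intersection with \<open>F\<close> is what makes the index set admissible for \<open>no\<close>
    before the chosen indices are known to lie in \<open>F\<close>.\<close>
  define P where "P f n r \<longleftrightarrow> fst r \<in> F \<and> snd r \<in> \<A> \<and> \<epsilon> < \<nu> (fst r) (snd r) \<and>
      (\<Sum>l\<in>fst ` f ` {..<n} \<inter> F. \<nu> l (snd r)) \<le> \<epsilon> / 8 / 2^n" for f :: "nat \<Rightarrow> 'i \<times> 'b set" and n::nat and r :: "'i \<times> 'b set"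
  have "\<exists>f. \<forall>n. P f n (f n)"
  proof (rule dependent_wellorder_choice)
    fix r :: "'i \<times> 'b set" and f g :: "nat \<Rightarrow> 'i \<times> 'b set" and n :: nat
    assume "\<And>y. y < n \<Longrightarrow> f y = g y"
    then have "f ` {..<n} = g ` {..<n}" by auto
    then show "P f n r = P g n r" by (simp add: P_def)
  next
    fix n :: nat and f :: "nat \<Rightarrow> 'i \<times> 'b set"
    obtain B i where "B \<in> \<A>" "i \<in> F" "(\<Sum>l\<in>fst ` f ` {..<n} \<inter> F. \<nu> l B) \<le> \<epsilon> / 8 / 2^n" "\<epsilon> < \<nu> i B"
      using no[of "fst ` f ` {..<n} \<inter> F" "\<epsilon> / 8 / 2^n"] eps by auto
    then have "P f n (i, B)" by (auto simp: P_def)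
    then show "\<exists>r. P f n r" by blast
  qed
  then obtain f where f: "\<And>n. P f n (f n)" by blast
  define i where "i n = fst (f n)" for n
  define B where "B n = snd (f n)" for n
  have iF: "i n \<in> F" and BA: "B n \<in> \<A>" and big: "\<epsilon> < \<nu> (i n) (B n)" for n
    using f[of n] by (auto simp: P_def i_def B_def)
  have small: "\<nu> (i l) (B n) \<le> \<epsilon> / 8 / 2^n" if "l < n" for l n
  proof -
    have "\<nu> (i l) (B n) \<le> (\<Sum>l\<in>fst ` f ` {..<n} \<inter> F. \<nu> l (B n))"
      by (rule member_le_sum) (use that iF[of l] nn[OF _ BA] in \<open>auto simp: i_def\<close>)
    also have "\<dots> \<le> \<epsilon> / 8 / 2^n" using f[of n] by (simp add: P_def B_def)
    finally show ?thesis .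
  qed
  \<comment> \<open>If no \<open>p\<close> worked, the parts of later sets outside the union so far
    would give a disjoint sequence on which members of the family exceed \<open>\<delta>\<close>,
    against exhaustivity. So a finite block almost covers all later sets, uniformly over
    \<open>F\<close>.\<close>
  have ex_p: "\<exists>p\<ge>q. \<forall>n>p. \<forall>j\<in>F. \<nu> j (B n - (\<Union>l\<in>{q..p}. B l)) \<le> \<delta>" if "0 < \<delta>" for q \<delta>
  proof (rule ccontr)
    assume "\<not> ?thesis"
    then have "\<forall>p. \<exists>n. p \<ge> q \<longrightarrow> n > p \<and> (\<exists>j\<in>F. \<delta> < \<nu> j (B n - (\<Union>l\<in>{q..p}. B l)))"
      by (meson not_le)
    then obtain nx where nx: "\<And>p. p \<ge> q \<Longrightarrow> nx p > p \<and> (\<exists>j\<in>F. \<delta> < \<nu> j (B (nx p) - (\<Union>l\<in>{q..p}. B l)))"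
      by metis
    define p where "p k = (nx ^^ k) q" for k
    have pq: "p k \<ge> q" for k
      by (induction k) (auto simp: p_def dest: nx less_imp_le intro: order.trans)
    have pS: "p (Suc k) = nx (p k)" for k by (simp add: p_def)
    have "strict_mono p" using nx[OF pq] pS by (auto simp: strict_mono_Suc_iff)
    define E where "E k = B (p (Suc k)) - (\<Union>l\<in>{q..p k}. B l)" for k
    have "\<forall>k. \<exists>j\<in>F. \<delta> < \<nu> j (E k)" using nx[OF pq] pS by (simp add: E_def)
    then obtain j where j: "\<And>k. j k \<in> F" "\<And>k. \<delta> < \<nu> (j k) (E k)" by metis
    have disj: "E a \<inter> E b = {}" if "a < b" for a b
    proof -
      have "p (Suc a) \<in> {q..p b}" using that \<open>strict_mono p\<close> pq by (auto simp: strict_mono_less_eq)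
      then show ?thesis by (auto simp: E_def)
    qed
    have "disjoint_family E" unfolding disjoint_family_on_def
      by (metis disj Int_commute linorder_neqE_nat)
    moreover have "range E \<subseteq> \<A>" using BA by (auto simp: E_def)
    ultimately have "(\<lambda>k. \<nu> (j k) (E k)) \<longlonglongrightarrow> 0" using j(1) by (intro exh)
    then have "\<forall>\<^sub>F k in sequentially. \<nu> (j k) (E k) < \<delta>" using that by (rule order_tendstoD)
    then show False using j(2) by (meson eventually_sequentially less_asym order_refl)
  qed
  define p where "p q \<delta> = (SOME p. p \<ge> q \<and> (\<forall>n>p. \<forall>j\<in>F. \<nu> j (B n - (\<Union>l\<in>{q..p}. B l)) \<le> \<delta>))"
    for q and \<delta> :: real
  have p: "p q \<delta> \<ge> q" "\<And>n j. n > p q \<delta> \<Longrightarrow> j \<in> F \<Longrightarrow> \<nu> j (B n - (\<Union>l\<in>{q..p q \<delta>}. B l)) \<le> \<delta>"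
    if "0 < \<delta>" for q \<delta>
    using someI_ex[OF ex_p[OF that, of q, simplified Bex_def]] by (auto simp: p_def)
  define q where "q = rec_nat 0 (\<lambda>r x. Suc (p x (\<epsilon> / 4 / 2^r)))"
  have q0: "q 0 = 0" and qS: "q (Suc r) = Suc (p (q r) (\<epsilon> / 4 / 2^r))" for r by (simp_all add: q_def)
  have "q r < q (Suc r)" for r using p(1)[of "\<epsilon> / 4 / 2^r" "q r"] eps by (simp add: qS)
  then have qm: "strict_mono q" by (simp add: strict_mono_Suc_iff)
  \<comment> \<open>\<open>U r\<close> is the union of block \<open>r\<close>. Every set chosen
    after the blocks up to \<open>r\<close> is almost contained in each of them, hence in
    \<open>D r\<close>; the losses \<open>\<epsilon> / 4 / 2^a\<close> add up to at most
    \<open>\<epsilon> / 2\<close>.\<close>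
  define U where "U r = (\<Union>l\<in>{q r..<q (Suc r)}. B l)" for r
  define D where "D r = (\<Inter>a\<in>{..r}. U a)" for r
  have UA: "U r \<in> \<A>" for r using BA by (auto simp: U_def)
  have DA: "D r \<in> \<A>" for r using UA by (auto simp: D_def intro: finite_INT)
  have outU: "\<nu> j (B n - U r) \<le> \<epsilon> / 4 / 2^r" if "n \<ge> q (Suc r)" "j \<in> F" for r n j
  proof -
    have "{q r..<q (Suc r)} = {q r..p (q r) (\<epsilon> / 4 / 2^r)}" by (auto simp: qS)
    then show ?thesis using p(2)[of "\<epsilon> / 4 / 2^r" "q r" n j] eps that by (simp add: U_def qS)
  qed
  have geo: "(\<Sum>a\<in>{..r}. \<epsilon> / 4 / 2^a) \<le> \<epsilon> / 2" for r :: nat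
  proof -
    have "(\<Sum>a\<in>{..r}. \<epsilon> / 4 / 2^a) = \<epsilon>/4 * (\<Sum>a\<in>{..r}. (1/2)^a)"
      by (simp add: sum_distrib_left power_divide)
    also have "(\<Sum>a\<in>{..r}. (1/2)^a) \<le> (2::real)" by (rule sum_half_powers_le) simp
    finally show ?thesis using eps by simp
  qed
  have inD: "\<epsilon> / 2 < \<nu> (i (q (Suc r))) (D r)" for r
  proof -
    let ?n = "q (Suc r)"
    have "\<nu> (i ?n) (B ?n) \<le> \<nu> (i ?n) (D r \<union> (\<Union>a\<in>{..r}. B ?n - U a))"
      by (rule mono) (use iF BA DA[of r, unfolded D_def] UA in \<open>auto simp: D_def\<close>)
    also have "\<dots> \<le> \<nu> (i ?n) (D r) + \<nu> (i ?n) (\<Union>a\<in>{..r}. B ?n - U a)"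
      by (rule sub) (use iF BA DA DA[of r, unfolded D_def] UA in auto)
    also have "\<nu> (i ?n) (\<Union>a\<in>{..r}. B ?n - U a) \<le> (\<Sum>a\<in>{..r}. \<nu> (i ?n) (B ?n - U a))"
      by (rule sub_UN) (use iF BA UA in auto)
    also have "\<dots> \<le> (\<Sum>a\<in>{..r}. \<epsilon> / 4 / 2^a)"
    proof (rule sum_mono, rule outU)
      fix a assume "a \<in> {..r}"
      then show "q (Suc a) \<le> q (Suc r)" using qm by (simp add: strict_mono_less_eq)
    qed (rule iF)
    also note geo
    finally show ?thesis using big[of ?n] by simp
  qed
  have inU: "\<nu> (i (q (Suc r))) (U (Suc (Suc r))) \<le> \<epsilon> / 4" for r
  proof -
    let ?L = "{q (Suc (Suc r))..<q (Suc (Suc (Suc r)))}"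
    have "\<nu> (i (q (Suc r))) (U (Suc (Suc r))) \<le> (\<Sum>l\<in>?L. \<nu> (i (q (Suc r))) (B l))"
      unfolding U_def by (rule sub_UN) (use iF BA in auto)
    also have "\<dots> \<le> (\<Sum>l\<in>?L. \<epsilon> / 8 / 2^l)"
    proof (rule sum_mono, rule small)
      fix l assume "l \<in> ?L"
      then show "q (Suc r) < l" using qm[THEN strict_monoD, of "Suc r" "Suc (Suc r)"] by auto
    qed
    also have "\<dots> \<le> (\<Sum>l\<in>{..q (Suc (Suc (Suc r)))}. \<epsilon> / 8 / 2^l)"
      by (rule sum_mono2) (use eps in auto)
    also have "\<dots> \<le> (\<Sum>l\<in>{..q (Suc (Suc (Suc r)))}. \<epsilon> / 4 / 2^l) / 2"
      by (simp add: sum_divide_distrib)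
    also have "\<dots> \<le> \<epsilon> / 4" using geo[of "q (Suc (Suc (Suc r)))"] by simp
    finally show ?thesis .
  qed
  \<comment> \<open>The step is 2 because block \<open>2*r+1\<close> contains the very set on which
    the function with index \<open>q (Suc (2*r))\<close> is large. Block \<open>2*r+2\<close>
    consists of later sets, on which that function is at most \<open>\<epsilon> / 4\<close> in
    total.\<close>
  define E where "E r = D (2*r) - U (2*r+2)" for r
  have EA: "range E \<subseteq> \<A>" using DA UA by (auto simp: E_def)
  have disj: "E a \<inter> E b = {}" if "a < b" for a b
  proof -
    have "E b \<subseteq> U (2*a+2)" using that by (auto simp: E_def D_def)
    then show ?thesis by (auto simp: E_def)
  qed
  have "disjoint_family E" unfolding disjoint_family_on_def
    by (metis disj Int_commute linorder_neqE_nat)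
  then have "(\<lambda>r. \<nu> (i (q (Suc (2*r)))) (E r)) \<longlonglongrightarrow> 0" using iF EA by (intro exh)
  moreover have "\<epsilon> / 4 < \<nu> (i (q (Suc (2*r)))) (E r)" for r
  proof -
    have "\<nu> (i (q (Suc (2*r)))) (D (2*r)) \<le> \<nu> (i (q (Suc (2*r)))) (E r \<union> U (2*r+2))"
      by (rule mono) (use iF EA UA DA in \<open>auto simp: E_def\<close>)
    also have "\<dots> \<le> \<nu> (i (q (Suc (2*r)))) (E r) + \<nu> (i (q (Suc (2*r)))) (U (2*r+2))"
      by (rule sub) (use iF EA UA DA in auto)
    finally show ?thesis using inD[of "2*r"] inU[of "2*r"] by simp
  qed
  ultimately show False
    using order_tendstoD(2)[of _ 0 sequentially "\<epsilon>/4"] eps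
    by (metis (no_types, lifting) divide_pos_pos eventually_sequentially less_asym order_refl zero_less_numeral)
qed

section \<open>Dyadic levels of real numbers\<close>

lemma powi_step: "(2::real) powi (k + 1) = 2 * 2 powi k"
  by (simp add: power_int_add_1')

text \<open>The dyadic level \<open>k\<close> of a nonzero number: \<open>2\<^sup>k < |y| \<le> 2\<^sup>k\<^sup>+\<^sup>1\<close>.  The value at \<open>0\<close> is junk.\<close>

definition lvl :: "real \<Rightarrow> int" where
  "lvl y = \<lceil>log 2 \<bar>y\<bar>\<rceil> - 1"

lemma lvl_eq_iff:
  assumes "y \<noteq> 0"
  shows "lvl y = k \<longleftrightarrow> 2 powi k < \<bar>y\<bar> \<and> \<bar>y\<bar> \<le> 2 powi (k + 1)"
proof -
  have *: "(2::real) powi j = 2 powr j" for j by (simp add: powr_real_of_int' power_int_def)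
  have "lvl y = k \<longleftrightarrow> real_of_int k < log 2 \<bar>y\<bar> \<and> log 2 \<bar>y\<bar> \<le> real_of_int (k + 1)"
    unfolding lvl_def by linarith
  also have "\<dots> \<longleftrightarrow> 2 powi k < \<bar>y\<bar> \<and> \<bar>y\<bar> \<le> 2 powi (k + 1)"
    using assms by (simp add: * less_log_iff log_le_iff)
  finally show ?thesis .
qed

lemma lvl_bounds:
  assumes "y \<noteq> 0"
  shows "2 powi lvl y < \<bar>y\<bar>" "\<bar>y\<bar> \<le> 2 * 2 powi lvl y"
  using lvl_eq_iff[OF assms, of "lvl y"] by (auto simp: powi_step)

lemma lvl_abs [simp]: "lvl \<bar>y\<bar> = lvl y"
  by (simp add: lvl_def)

lemma sum_powi_le:
  assumes "finite L" "\<And>k. k \<in> L \<Longrightarrow> k \<le> m"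
  shows "(\<Sum>k\<in>L. 2 powi k) \<le> 2 * (2::real) powi m"
proof -
  have inj: "inj_on (\<lambda>k. nat (m - k)) L"
    by (rule inj_onI) (use assms(2) in \<open>smt (verit) nat_eq_iff2\<close>)
  have "(\<Sum>k\<in>L. 2 powi k) = (\<Sum>k\<in>L. 2 powi m * (1/2::real) ^ nat (m - k))"
  proof (rule sum.cong[OF refl])
    fix k assume "k \<in> L"
    then have "k \<le> m" by (rule assms)
    then have "(2::real) powi m = 2 powi k * 2 powi (m - k)" by (simp add: power_int_diff)
    also have "(2::real) powi (m - k) = 2 ^ nat (m - k)"
      using \<open>k \<le> m\<close> by (simp add: power_int_def)
    finally have e: "(2::real) powi m = 2 powi k * 2 ^ nat (m - k)" .
    have "2 powi m * (1/2::real) ^ nat (m - k) = 2 powi k"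
      unfolding e by (simp add: power_one_over)
    then show "(2::real) powi k = 2 powi m * (1/2) ^ nat (m - k)" by simp
  qed
  also have "\<dots> = 2 powi m * (\<Sum>n\<in>(\<lambda>k. nat (m - k)) ` L. (1/2::real) ^ n)"
    by (simp add: sum.reindex[OF inj] sum_distrib_left)
  also have "(\<Sum>n\<in>(\<lambda>k. nat (m - k)) ` L. (1/2::real) ^ n) \<le> 2"
    by (rule sum_half_powers_le) (simp add: assms(1))
  finally show ?thesis by (simp add: mult.commute)
qed

text \<open>The terms of level \<open>k\<close> contribute at most \<open>q * 2 * 2 powi k\<close>,
  and the geometric sum over the levels up to that of the largest term costs another factor 2.
  Applied pointwise, this lets a supremum dominate a sum in which each level occurs boundedly
  often.\<close>

lemma sum_le_by_levels:
  fixes a :: "'b \<Rightarrow> real"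
  assumes fin: "finite J" and nn: "\<And>j. j \<in> J \<Longrightarrow> 0 \<le> a j" and le: "\<And>j. j \<in> J \<Longrightarrow> a j \<le> m"
    and q: "\<And>k. card {j \<in> J. a j \<noteq> 0 \<and> lvl (a j) = k} \<le> q" and m: "0 \<le> m"
  shows "(\<Sum>j\<in>J. a j) \<le> 4 * real q * m"
proof -
  define J' where "J' = {j \<in> J. a j \<noteq> 0}"
  have fin': "finite J'" using fin by (simp add: J'_def)
  have "(\<Sum>j\<in>J. a j) = (\<Sum>j\<in>J'. a j)"
    by (rule sum.mono_neutral_right) (use fin in \<open>auto simp: J'_def\<close>)
  show ?thesis
  proof (cases "J' = {}")
    case True
    then show ?thesis using \<open>_ = sum a J'\<close> m by simp
  next
    case False
    let ?L = "(\<lambda>j. lvl (a j)) ` J'"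
    have fL: "finite ?L" using fin' by simp
    obtain j0 where j0: "j0 \<in> J'" "Max ?L = lvl (a j0)"
      using Max_in[OF fL] False by auto
    have "(\<Sum>j\<in>J'. a j) = (\<Sum>k\<in>?L. \<Sum>j\<in>{j \<in> J'. lvl (a j) = k}. a j)"
      by (rule sum.image_gen[OF fin'])
    also have "\<dots> \<le> (\<Sum>k\<in>?L. real q * (2 * 2 powi k))"
    proof (rule sum_mono)
      fix k
      have "(\<Sum>j\<in>{j \<in> J'. lvl (a j) = k}. a j) \<le> of_nat (card {j \<in> J'. lvl (a j) = k}) * (2 * 2 powi k)"
      proof (rule sum_bounded_above)
        fix j assume "j \<in> {j \<in> J'. lvl (a j) = k}"
        then show "a j \<le> 2 * 2 powi k" using lvl_bounds(2)[of "a j"] by (auto simp: J'_def)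
      qed
      also have "\<dots> \<le> real q * (2 * 2 powi k)"
      proof (rule mult_right_mono)
        have "{j \<in> J'. lvl (a j) = k} = {j \<in> J. a j \<noteq> 0 \<and> lvl (a j) = k}" by (auto simp: J'_def)
        then show "real (card {j \<in> J'. lvl (a j) = k}) \<le> real q" using q[of k] by simp
      qed simp
      finally show "(\<Sum>j\<in>{j \<in> J'. lvl (a j) = k}. a j) \<le> real q * (2 * 2 powi k)" .
    qed
    also have "\<dots> = real q * 2 * (\<Sum>k\<in>?L. 2 powi k)" by (simp add: sum_distrib_left mult.assoc)
    also have "\<dots> \<le> real q * 2 * (2 * 2 powi (lvl (a j0)))"
      by (intro mult_left_mono sum_powi_le fL) (use j0 fL in \<open>auto simp flip: j0(2)\<close>)
    also have "\<dots> \<le> real q * 2 * (2 * m)"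
    proof -
      have "2 powi (lvl (a j0)) < \<bar>a j0\<bar>" using j0 by (intro lvl_bounds) (auto simp: J'_def)
      also have "\<dots> \<le> m" using j0 nn le by (auto simp: J'_def)
      finally show ?thesis by (intro mult_left_mono) auto
    qed
    finally show ?thesis using \<open>_ = sum a J'\<close> by simp
  qed
qed

lemma infinite_split:
  fixes A :: "nat set"
  assumes "infinite A"
  obtains B C where "infinite B" "infinite C" "B \<inter> C = {}" "B \<union> C = A"
proof
  let ?e = "enumerate A"
  have inj: "inj ?e" using assms by (simp add: inj_enumerate)
  have rng: "range ?e = A" using assms by (simp add: range_enumerate)
  have "infinite {n::nat. even n}" "infinite {n::nat. odd n}"
    by (metis (no_types, lifting) infinite_nat_iff_unbounded_le mem_Collect_eq even_Suc le_SucI order_refl)+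
  then show "infinite (?e ` {n. even n})" "infinite (?e ` {n. odd n})"
    using inj by (metis finite_imageD inj_on_subset subset_UNIV)+
  show "?e ` {n. even n} \<inter> ?e ` {n. odd n} = {}" using inj by (auto dest: injD)
  show "?e ` {n. even n} \<union> ?e ` {n. odd n} = A" using rng by blast
qed

subsection \<open>Lattice spaces controlled by level sets\<close>

lemma lvl_measurable [measurable]: "lvl \<in> borel \<rightarrow>\<^sub>M count_space UNIV"
  unfolding lvl_def by measurable

text \<open>The test \<open>f x \<noteq> 0\<close> keeps out the points at which \<open>lvl\<close>
  has its junk value.\<close>

definition lev :: "'a measure \<Rightarrow> ('a \<Rightarrow> real) \<Rightarrow> int \<Rightarrow> 'a set" where
  "lev M f k = {x \<in> space M. f x \<noteq> 0 \<and> lvl (f x) = k}"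

text \<open>\<open>J\<close> enlarges the permitted measures and not the values of \<open>f\<close>:
  a supremum of \<open>J\<close> functions from the ball with constant 1 lands in the ball with
  constant \<open>J\<close>.\<close>

definition level_ball :: "'a measure \<Rightarrow> (int \<Rightarrow> ennreal) \<Rightarrow> real \<Rightarrow> ('a \<Rightarrow> real) set" where
  "level_ball M D J = {f \<in> borel_measurable M. \<forall>k. emeasure M (lev M f k) \<le> ennreal J * D k}"

lemma lev_sets [measurable]: "f \<in> borel_measurable M \<Longrightarrow> lev M f k \<in> sets M"
proof -
  assume [measurable]: "f \<in> borel_measurable M"
  have "{x \<in> space M. f x \<noteq> 0} \<inter> ((\<lambda>x. lvl (f x)) -` {k} \<inter> space M) \<in> sets M"
    by measurable
  also have "{x \<in> space M. f x \<noteq> 0} \<inter> ((\<lambda>x. lvl (f x)) -` {k} \<inter> space M) = lev M f k"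
    by (auto simp: lev_def)
  finally show ?thesis .
qed

text \<open>The convex hull of the tail from \<open>n\<close> on. Generating it by binary mixing
  lets every bound that is stable under mixing pass to the whole hull by induction.\<close>

inductive_set chull :: "(nat \<Rightarrow> 'f \<Rightarrow> real) \<Rightarrow> nat \<Rightarrow> ('f \<Rightarrow> real) set" for \<phi> n where
  base: "n \<le> i \<Longrightarrow> \<phi> i \<in> chull \<phi> n"
| mix: "u \<in> chull \<phi> n \<Longrightarrow> v \<in> chull \<phi> n \<Longrightarrow> 0 \<le> a \<Longrightarrow> a \<le> 1 \<Longrightarrow>
    (\<lambda>f. a * u f + (1 - a) * v f) \<in> chull \<phi> n"

lemma chull_mono:
  assumes "u \<in> chull \<phi> m" "n \<le> m" shows "u \<in> chull \<phi> n"
  using assms(1)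
proof induction
  case (base i)
  then show ?case using assms(2) by (intro chull.base) simp
next
  case (mix u v a)
  then show ?case by (intro chull.mix)
qed

lemma chull_average:
  assumes "\<And>b. \<psi> b \<in> chull \<phi> n" "0 < R"
  shows "(\<lambda>f. (\<Sum>b<R. \<psi> b f) / real R) \<in> chull \<phi> n"
  using assms(2)
proof (induction R)
  case (Suc R)
  show ?case
  proof (cases "R = 0")
    case True
    then show ?thesis using assms(1)[of 0] by simp
  next
    case False
    then have "(\<lambda>f. (\<Sum>b<R. \<psi> b f) / real R) \<in> chull \<phi> n" using Suc by simp
    from chull.mix[OF this assms(1)[of R], of "real R / real (Suc R)"]
    have "(\<lambda>f. real R / real (Suc R) * ((\<Sum>b<R. \<psi> b f) / real R) + (1 - real R / real (Suc R)) * \<psi> R f)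
        \<in> chull \<phi> n" by simp
    also have "(\<lambda>f. real R / real (Suc R) * ((\<Sum>b<R. \<psi> b f) / real R) + (1 - real R / real (Suc R)) * \<psi> R f)
       = (\<lambda>f. (\<Sum>b<Suc R. \<psi> b f) / real (Suc R))"
    proof
      fix f
      have "1 - real R / real (Suc R) = 1 / real (Suc R)" by (simp add: field_simps)
      then show "real R / real (Suc R) * ((\<Sum>b<R. \<psi> b f) / real R) + (1 - real R / real (Suc R)) * \<psi> R f
          = (\<Sum>b<Suc R. \<psi> b f) / real (Suc R)"
        using False by (simp add: add_divide_distrib)
    qed
    finally show ?thesis .
  qed
qed simp

lemma chull_abs_le:
  assumes "u \<in> chull \<phi> n" "\<And>i. n \<le> i \<Longrightarrow> \<bar>\<phi> i f\<bar> \<le> c"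
  shows "\<bar>u f\<bar> \<le> c"
  using assms(1)
proof induction
  case (mix u v a)
  have "\<bar>a * u f + (1 - a) * v f\<bar> \<le> a * \<bar>u f\<bar> + (1 - a) * \<bar>v f\<bar>"
    using mix by (auto simp: abs_mult intro!: order.trans[OF abs_triangle_ineq])
  also have "\<dots> \<le> a * c + (1 - a) * c"
    using mix by (intro add_mono mult_left_mono) auto
  finally show ?case by (simp add: algebra_simps)
qed (use assms(2) in auto)

text \<open>The unit ball is caught between level conditions by \<open>ball_level\<close> and
  \<open>level_norm\<close>; the free \<open>e\<close> in the latter expresses growth o(J).
  \<open>D_half\<close> makes higher levels geometrically small, and \<open>D_fin\<close> provides a
  finite value from which this decay starts. Solidity refers to inequalities almost everywhere
  because functions are not identified when they differ on a null set.\<close>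

locale level_space =
  fixes M :: "'a measure" and X :: "('a \<Rightarrow> real) set" and N :: "('a \<Rightarrow> real) \<Rightarrow> real"
    and D :: "int \<Rightarrow> ennreal"
  assumes X_meas: "f \<in> X \<Longrightarrow> f \<in> borel_measurable M"
    and X_zero: "(\<lambda>x. 0) \<in> X"
    and X_add: "f \<in> X \<Longrightarrow> g \<in> X \<Longrightarrow> (\<lambda>x. f x + g x) \<in> X"
    and X_scale: "f \<in> X \<Longrightarrow> (\<lambda>x. c * f x) \<in> X"
    and N_add: "f \<in> X \<Longrightarrow> g \<in> X \<Longrightarrow> N (\<lambda>x. f x + g x) \<le> N f + N g"
    and N_scale: "f \<in> X \<Longrightarrow> N (\<lambda>x. c * f x) = \<bar>c\<bar> * N f"
    and X_solid: "f \<in> X \<Longrightarrow> g \<in> borel_measurable M \<Longrightarrow> (AE x in M. \<bar>g x\<bar> \<le> \<bar>f x\<bar>) \<Longrightarrow> g \<in> X"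
    and N_solid: "f \<in> X \<Longrightarrow> g \<in> borel_measurable M \<Longrightarrow> (AE x in M. \<bar>g x\<bar> \<le> \<bar>f x\<bar>) \<Longrightarrow> N g \<le> N f"
    and D_half: "2 * D (k + 1) \<le> D k"
    and D_fin: "\<exists>k. D k < \<infinity>"
    and ball_level: "f \<in> X \<Longrightarrow> N f \<le> 1 \<Longrightarrow> f \<in> level_ball M D 1"
    and level_norm: "0 < e \<Longrightarrow> \<exists>C. \<forall>J\<ge>0. \<forall>f\<in>level_ball M D J. f \<in> X \<and> N f \<le> C + e * J"
begin

abbreviation S where "S \<equiv> level_ball M D"

abbreviation Dual where "Dual \<equiv> dual_space X N"

lemma N_zero: "N (\<lambda>x. 0) = 0"
  using N_scale[OF X_zero, of 0] by simp

lemma N_nonneg: "f \<in> X \<Longrightarrow> 0 \<le> N f"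
  using N_solid[of f "\<lambda>x. 0"] N_zero by simp

lemma level_X: "0 \<le> J \<Longrightarrow> f \<in> S J \<Longrightarrow> f \<in> X"
  using level_norm[of 1] by auto

lemma level_bound: "\<exists>C. \<forall>J\<ge>0. \<forall>f\<in>S J. N f \<le> C + J"
  using level_norm[of 1] by (simp, blast)

lemma X_diff: "f \<in> X \<Longrightarrow> g \<in> X \<Longrightarrow> (\<lambda>x. f x - g x) \<in> X"
  using X_add[of f "\<lambda>x. -1 * g x"] X_scale[of g "-1"] by simp

lemma X_abs: "f \<in> X \<Longrightarrow> (\<lambda>x. \<bar>f x\<bar>) \<in> X"
  by (rule X_solid[of f]) (auto dest: X_meas)

lemma X_sum: "(\<And>j. j \<in> I \<Longrightarrow> f j \<in> X) \<Longrightarrow> (\<lambda>x. \<Sum>j\<in>I. f j x) \<in> X"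
  by (induction I rule: infinite_finite_induct) (auto intro: X_add X_zero)

lemma dual_add: "\<psi> \<in> Dual \<Longrightarrow> f \<in> X \<Longrightarrow> g \<in> X \<Longrightarrow> \<psi> (\<lambda>x. f x + g x) = \<psi> f + \<psi> g"
  by (simp add: dual_space_def)

lemma dual_scale: "\<psi> \<in> Dual \<Longrightarrow> f \<in> X \<Longrightarrow> \<psi> (\<lambda>x. c * f x) = c * \<psi> f"
  by (simp add: dual_space_def)

lemma dual_diff: "\<psi> \<in> Dual \<Longrightarrow> f \<in> X \<Longrightarrow> g \<in> X \<Longrightarrow> \<psi> (\<lambda>x. f x - g x) = \<psi> f - \<psi> g"
  using dual_add[of \<psi> f "\<lambda>x. -1 * g x"] dual_scale[of \<psi> g "-1"] X_scale[of g "-1"] by simp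

lemma dual_zero: "\<psi> \<in> Dual \<Longrightarrow> \<psi> (\<lambda>x. 0) = 0"
  using dual_scale[of \<psi> "\<lambda>x. 0" 0] X_zero by simp

lemma dual_sum:
  "\<psi> \<in> Dual \<Longrightarrow> (\<And>j. j \<in> I \<Longrightarrow> f j \<in> X) \<Longrightarrow> \<psi> (\<lambda>x. \<Sum>j\<in>I. f j x) = (\<Sum>j\<in>I. \<psi> (f j))"
proof (induction I rule: infinite_finite_induct)
  case (insert i I)
  have "\<psi> (\<lambda>x. f i x + (\<Sum>j\<in>I. f j x)) = \<psi> (f i) + \<psi> (\<lambda>x. \<Sum>j\<in>I. f j x)"
    by (rule dual_add) (use insert in \<open>auto intro: X_sum\<close>)
  then show ?case using insert by simp
qed (auto simp: dual_zero)

lemma dual_bound: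
  assumes "\<psi> \<in> Dual"
  shows "\<exists>C\<ge>0. \<forall>f\<in>X. \<bar>\<psi> f\<bar> \<le> C * N f"
proof -
  obtain C where C: "\<And>f. f \<in> X \<Longrightarrow> \<bar>\<psi> f\<bar> \<le> C * N f"
    using assms unfolding dual_space_def by blast
  have "\<bar>\<psi> f\<bar> \<le> max C 0 * N f" if "f \<in> X" for f
    using C[OF that] mult_right_mono[of C "max C 0", OF _ N_nonneg[OF that]] by simp
  then show ?thesis by (intro exI[of _ "max C 0"]) auto
qed

text \<open>The difference has seminorm 0, so every bounded functional annihilates it. This replaces
  passing to the quotient by null functions.\<close>

lemma dual_AE_cong:
  assumes "\<psi> \<in> Dual" "f \<in> X" "g \<in> borel_measurable M" "AE x in M. f x = g x"
  shows "\<psi> f = \<psi> g"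
proof -
  have g: "g \<in> X" by (rule X_solid[OF assms(2,3)]) (use assms(4) in auto)
  have d: "(\<lambda>x. f x - g x) \<in> X" using X_diff assms g by auto
  have "N (\<lambda>x. f x - g x) \<le> N (\<lambda>x. 0)"
    by (rule N_solid[OF X_zero X_meas[OF d]]) (use assms(4) in auto)
  then have "N (\<lambda>x. f x - g x) = 0" using N_nonneg[OF d] N_zero by simp
  moreover obtain C where "\<And>f. f \<in> X \<Longrightarrow> \<bar>\<psi> f\<bar> \<le> C * N f" using dual_bound[OF assms(1)] by auto
  ultimately have "\<psi> (\<lambda>x. f x - g x) = 0" using d by fastforce
  then show ?thesis using dual_diff[OF assms(1,2) g] by simp
qed

lemma dual_mix:
  assumes "u \<in> Dual" "v \<in> Dual"
  shows "(\<lambda>f. a * u f + b * v f) \<in> Dual"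
proof -
  obtain C1 C2 where C: "\<And>f. f \<in> X \<Longrightarrow> \<bar>u f\<bar> \<le> C1 * N f" "\<And>f. f \<in> X \<Longrightarrow> \<bar>v f\<bar> \<le> C2 * N f"
    using dual_bound[OF assms(1)] dual_bound[OF assms(2)] by auto
  have "\<bar>a * u f + b * v f\<bar> \<le> (\<bar>a\<bar> * C1 + \<bar>b\<bar> * C2) * N f" if "f \<in> X" for f
  proof -
    have "\<bar>a * u f + b * v f\<bar> \<le> \<bar>a\<bar> * \<bar>u f\<bar> + \<bar>b\<bar> * \<bar>v f\<bar>"
      by (metis abs_mult abs_triangle_ineq)
    also have "\<dots> \<le> \<bar>a\<bar> * (C1 * N f) + \<bar>b\<bar> * (C2 * N f)"
      using C[OF that] by (intro add_mono mult_left_mono) auto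
    finally show ?thesis by (simp add: algebra_simps)
  qed
  then have "\<exists>C. \<forall>f\<in>X. \<bar>a * u f + b * v f\<bar> \<le> C * N f" by blast
  then show ?thesis using assms unfolding dual_space_def by (auto simp: algebra_simps)
qed

lemma chull_Dual:
  assumes "u \<in> chull \<phi> n" "\<And>i. \<phi> i \<in> Dual"
  shows "u \<in> Dual"
  using assms(1) by induction (auto simp: assms(2) intro: dual_mix)

section \<open>The modulus of a functional on the positive cone\<close>

definition sub :: "('a \<Rightarrow> real) \<Rightarrow> ('a \<Rightarrow> real) set" where
  "sub h = {g \<in> borel_measurable M. AE x in M. \<bar>g x\<bar> \<le> h x}"

text \<open>The modulus \<open>|\<psi>|\<close> given by the Riesz--Kantorovich formula; only its values on the positive cone are used.\<close>

definition amod :: "(('a \<Rightarrow> real) \<Rightarrow> real) \<Rightarrow> ('a \<Rightarrow> real) \<Rightarrow> real" where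
  "amod \<psi> h = (SUP g\<in>sub h. \<psi> g)"

definition Xp :: "('a \<Rightarrow> real) set" where
  "Xp = {h \<in> X. \<forall>x. 0 \<le> h x}"

lemma XpD: "h \<in> Xp \<Longrightarrow> h \<in> X" "h \<in> Xp \<Longrightarrow> 0 \<le> h x" "h \<in> Xp \<Longrightarrow> h \<in> borel_measurable M"
  by (auto simp: Xp_def X_meas)

lemma Xp_solid:
  "H \<in> X \<Longrightarrow> h \<in> borel_measurable M \<Longrightarrow> (\<And>x. 0 \<le> h x) \<Longrightarrow> (AE x in M. h x \<le> H x) \<Longrightarrow> h \<in> Xp"
  unfolding Xp_def by (auto intro!: X_solid[of H h] elim: eventually_mono)

lemma Xp_add: "h \<in> Xp \<Longrightarrow> k \<in> Xp \<Longrightarrow> (\<lambda>x. h x + k x) \<in> Xp"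
  by (auto simp: Xp_def X_add)

lemma Xp_scale: "h \<in> Xp \<Longrightarrow> 0 \<le> c \<Longrightarrow> (\<lambda>x. c * h x) \<in> Xp"
  by (auto simp: Xp_def X_scale)

lemma Xp_sum: "(\<And>j. j \<in> I \<Longrightarrow> h j \<in> Xp) \<Longrightarrow> (\<lambda>x. \<Sum>j\<in>I. h j x) \<in> Xp"
  by (auto simp: Xp_def X_sum sum_nonneg)

lemma Xp_abs: "f \<in> X \<Longrightarrow> (\<lambda>x. \<bar>f x\<bar>) \<in> Xp"
  by (simp add: Xp_def X_abs)

lemma Xp_zero: "(\<lambda>x. 0) \<in> Xp"
  by (simp add: Xp_def X_zero)

lemma sub_X: "g \<in> sub h \<Longrightarrow> h \<in> Xp \<Longrightarrow> g \<in> X"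
  by (rule X_solid[of h]) (auto simp: sub_def Xp_def)

lemma zero_sub: "h \<in> Xp \<Longrightarrow> (\<lambda>x. 0) \<in> sub h"
  by (auto simp: sub_def Xp_def)

lemma sub_uminus: "g \<in> sub h \<Longrightarrow> (\<lambda>x. -1 * g x) \<in> sub h"
  by (auto simp: sub_def)

lemma sub_bound:
  assumes "\<psi> \<in> Dual" "h \<in> Xp" "g \<in> sub h" "0 \<le> C" "\<And>f. f \<in> X \<Longrightarrow> \<bar>\<psi> f\<bar> \<le> C * N f"
  shows "\<psi> g \<le> C * N h"
proof -
  have "\<psi> g \<le> C * N g" using assms(5)[OF sub_X[OF assms(3,2)]] by simp
  also have "N g \<le> N h"
    by (rule N_solid) (use assms(2,3) in \<open>auto simp: Xp_def sub_def\<close>)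
  finally show ?thesis using assms(4) by (simp add: mult_left_mono)
qed

lemma amod_bdd:
  assumes "\<psi> \<in> Dual" "h \<in> Xp" shows "bdd_above (\<psi> ` sub h)"
  using dual_bound[OF assms(1)] sub_bound[OF assms] by (meson bdd_aboveI2)

lemma amod_upper: "\<psi> \<in> Dual \<Longrightarrow> h \<in> Xp \<Longrightarrow> g \<in> sub h \<Longrightarrow> \<psi> g \<le> amod \<psi> h"
  unfolding amod_def by (rule cSUP_upper[OF _ amod_bdd])

lemma abs_le_amod: "\<psi> \<in> Dual \<Longrightarrow> h \<in> Xp \<Longrightarrow> g \<in> sub h \<Longrightarrow> \<bar>\<psi> g\<bar> \<le> amod \<psi> h"
  using amod_upper[of \<psi> h g] amod_upper[of \<psi> h "\<lambda>x. -1 * g x"] sub_uminus[of g h]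
    dual_scale[of \<psi> g "-1"] sub_X by fastforce

lemma abs_le_amod_abs: "\<psi> \<in> Dual \<Longrightarrow> f \<in> X \<Longrightarrow> \<bar>\<psi> f\<bar> \<le> amod \<psi> (\<lambda>x. \<bar>f x\<bar>)"
  by (rule abs_le_amod) (auto simp: Xp_abs sub_def X_meas)

lemma amod_least: "h \<in> Xp \<Longrightarrow> (\<And>g. g \<in> sub h \<Longrightarrow> \<psi> g \<le> c) \<Longrightarrow> amod \<psi> h \<le> c"
  unfolding amod_def by (rule cSUP_least) (use zero_sub in auto)

lemma amod_less:
  "\<psi> \<in> Dual \<Longrightarrow> h \<in> Xp \<Longrightarrow> c < amod \<psi> h \<Longrightarrow> \<exists>g\<in>sub h. c < \<psi> g"
  by (meson amod_least not_le)

lemma amod_nonneg: "\<psi> \<in> Dual \<Longrightarrow> h \<in> Xp \<Longrightarrow> 0 \<le> amod \<psi> h"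
  using amod_upper[OF _ _ zero_sub] dual_zero by fastforce

lemma amod_mono:
  assumes "\<psi> \<in> Dual" "h \<in> Xp" "k \<in> Xp" "AE x in M. h x \<le> k x"
  shows "amod \<psi> h \<le> amod \<psi> k"
proof (rule amod_least[OF assms(2)])
  fix g assume "g \<in> sub h"
  then have "g \<in> sub k" using assms(4) unfolding sub_def by auto
  then show "\<psi> g \<le> amod \<psi> k" by (rule amod_upper[OF assms(1,3)])
qed

lemma amod_bound:
  assumes "\<psi> \<in> Dual"
  shows "\<exists>C\<ge>0. \<forall>h\<in>Xp. amod \<psi> h \<le> C * N h"
  using dual_bound[OF assms] sub_bound[OF assms] amod_least by metis

lemma amod_add:
  assumes "\<psi> \<in> Dual" "h \<in> Xp" "k \<in> Xp"
  shows "amod \<psi> (\<lambda>x. h x + k x) = amod \<psi> h + amod \<psi> k"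
proof (rule antisym)
  note [measurable] = XpD(3)[OF assms(2)] XpD(3)[OF assms(3)]
  show "amod \<psi> (\<lambda>x. h x + k x) \<le> amod \<psi> h + amod \<psi> k"
  proof (rule amod_least[OF Xp_add[OF assms(2,3)]])
    fix g assume g: "g \<in> sub (\<lambda>x. h x + k x)"
    then have [measurable]: "g \<in> borel_measurable M" by (simp add: sub_def)
    \<comment> \<open>Riesz decomposition: clipping \<open>g\<close> to the interval from
      \<open>-h\<close> to \<open>h\<close> leaves a remainder bounded by \<open>k\<close> wherever
      \<open>g\<close> is bounded by \<open>h + k\<close>.\<close>
    define g1 where "g1 x = max (- h x) (min (h x) (g x))" for x
    have [measurable]: "g1 \<in> borel_measurable M" unfolding g1_def by measurable
    have g1: "g1 \<in> sub h"
      using XpD(2)[OF assms(2)] by (auto simp: sub_def g1_def abs_le_iff min_def max_def)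
    have "AE x in M. \<bar>g x - g1 x\<bar> \<le> k x"
      using g unfolding sub_def
      by (auto elim!: eventually_mono simp: g1_def) (use XpD(2)[OF assms(2)] XpD(2)[OF assms(3)] in \<open>smt (verit)\<close>)
    then have g2: "(\<lambda>x. g x - g1 x) \<in> sub k" by (auto simp: sub_def)
    have "\<psi> g = \<psi> (\<lambda>x. g1 x + (g x - g1 x))" by simp
    also have "\<dots> = \<psi> g1 + \<psi> (\<lambda>x. g x - g1 x)"
      using dual_add[OF assms(1) sub_X[OF g1 assms(2)] sub_X[OF g2 assms(3)]] .
    finally show "\<psi> g \<le> amod \<psi> h + amod \<psi> k"
      using amod_upper[OF assms(1,2) g1] amod_upper[OF assms(1,3) g2] by simp
  qed
  have "amod \<psi> h \<le> amod \<psi> (\<lambda>x. h x + k x) - \<psi> g2" if g2: "g2 \<in> sub k" for g2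
  proof (rule amod_least[OF assms(2)])
    fix g1 assume g1: "g1 \<in> sub h"
    have "(\<lambda>x. g1 x + g2 x) \<in> sub (\<lambda>x. h x + k x)"
      using g1 g2 by (auto simp: sub_def intro: order.trans[OF abs_triangle_ineq] add_mono)
    then have "\<psi> (\<lambda>x. g1 x + g2 x) \<le> amod \<psi> (\<lambda>x. h x + k x)"
      by (rule amod_upper[OF assms(1) Xp_add[OF assms(2,3)]])
    then show "\<psi> g1 \<le> amod \<psi> (\<lambda>x. h x + k x) - \<psi> g2"
      using dual_add[OF assms(1) sub_X[OF g1 assms(2)] sub_X[OF g2 assms(3)]] by simp
  qed
  then have "amod \<psi> k \<le> amod \<psi> (\<lambda>x. h x + k x) - amod \<psi> h"
    by (intro amod_least[OF assms(3)]) force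
  then show "amod \<psi> h + amod \<psi> k \<le> amod \<psi> (\<lambda>x. h x + k x)" by simp
qed

lemma amod_zero: "\<psi> \<in> Dual \<Longrightarrow> amod \<psi> (\<lambda>x. 0) = 0"
  using amod_add[OF _ Xp_zero Xp_zero] by simp

lemma amod_sum:
  assumes "\<psi> \<in> Dual" "\<And>j. j \<in> I \<Longrightarrow> h j \<in> Xp"
  shows "amod \<psi> (\<lambda>x. \<Sum>j\<in>I. h j x) = (\<Sum>j\<in>I. amod \<psi> (h j))"
  using assms(2)
  by (induction I rule: infinite_finite_induct) (auto simp: assms(1) amod_zero amod_add Xp_sum)

lemma amod_scale_le:
  assumes "\<psi> \<in> Dual" "h \<in> Xp" "0 < c"
  shows "amod \<psi> (\<lambda>x. c * h x) \<le> c * amod \<psi> h"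
proof (rule amod_least)
  show "(\<lambda>x. c * h x) \<in> Xp" using assms by (simp add: Xp_scale)
  fix g assume g: "g \<in> sub (\<lambda>x. c * h x)"
  have g': "(\<lambda>x. 1 / c * g x) \<in> sub h"
    using g assms(3) by (auto simp: sub_def field_simps abs_mult)
  have "\<psi> g = c * \<psi> (\<lambda>x. 1 / c * g x)"
    using dual_scale[OF assms(1) sub_X[OF g' assms(2)], of c] assms(3) by simp
  then show "\<psi> g \<le> c * amod \<psi> h"
    using amod_upper[OF assms(1,2) g'] assms(3) by simp
qed

lemma amod_scale:
  assumes "\<psi> \<in> Dual" "h \<in> Xp" "0 \<le> c"
  shows "amod \<psi> (\<lambda>x. c * h x) = c * amod \<psi> h"
proof (cases "c = 0")
  case False
  then have c: "0 < c" using assms by simp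
  have "amod \<psi> (\<lambda>x. 1 / c * (c * h x)) \<le> 1 / c * amod \<psi> (\<lambda>x. c * h x)"
    by (rule amod_scale_le) (use assms c in \<open>auto simp: Xp_scale\<close>)
  then have "c * amod \<psi> h \<le> amod \<psi> (\<lambda>x. c * h x)" using c by (simp add: field_simps)
  then show ?thesis using amod_scale_le[OF assms(1,2) c] by simp
qed (simp add: amod_zero assms)

lemma amod_mix:
  assumes "u \<in> Dual" "v \<in> Dual" "h \<in> Xp" "0 \<le> a" "0 \<le> b"
  shows "amod (\<lambda>f. a * u f + b * v f) h \<le> a * amod u h + b * amod v h"
  using assms amod_upper by (intro amod_least[OF assms(3)] add_mono mult_left_mono) auto

lemma chull_amod_le:
  assumes "u \<in> chull \<phi> n" "\<And>i. \<phi> i \<in> Dual" "h \<in> Xp" "\<And>i. n \<le> i \<Longrightarrow> amod (\<phi> i) h \<le> c"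
  shows "amod u h \<le> c"
  using assms(1)
proof induction
  case (mix u v a)
  have "amod (\<lambda>f. a * u f + (1 - a) * v f) h \<le> a * amod u h + (1 - a) * amod v h"
    by (rule amod_mix) (use mix assms chull_Dual in auto)
  also have "\<dots> \<le> a * c + (1 - a) * c"
    using mix by (intro add_mono mult_left_mono) auto
  finally show ?case by (simp add: algebra_simps)
qed (use assms(4) in auto)

end

subsection \<open>Disjoint sums and the Phillips lemma\<close>

context level_space begin

lemma D_pow: "D (k + int i) \<le> ennreal ((1/2)^i) * D k"
proof (induction i)
  case (Suc i)
  have "D (k + int (Suc i)) = ennreal (1/2) * (2 * D (k + int i + 1))"
  proof -
    have "ennreal (1/2) * (2 * D (k + int i + 1)) = ennreal (1/2 * 2) * D (k + int i + 1)"
      by (simp only: mult.assoc[symmetric] ennreal_mult'' ennreal_numeral zero_le_numeral)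
    also have "\<dots> = D (k + int i + 1)" by simp
    finally show ?thesis by (simp add: add_ac)
  qed
  also have "\<dots> \<le> ennreal (1/2) * D (k + int i)"
    by (intro mult_left_mono D_half) simp
  also have "\<dots> \<le> ennreal (1/2) * (ennreal ((1/2)^i) * D k)"
    by (intro mult_left_mono Suc) simp
  also have "\<dots> = ennreal (1/2 * (1/2)^i) * D k"
    by (simp only: mult.assoc[symmetric] ennreal_mult'' zero_le_power zero_le_divide_1_iff zero_le_numeral)
  also have "\<dots> = ennreal ((1/2)^Suc i) * D k" by simp
  finally show ?case .
qed simp

lemma level_meas: "f \<in> S J \<Longrightarrow> f \<in> borel_measurable M"
  by (simp add: level_ball_def)

lemma level_subset:
  assumes "f \<in> S J" "g \<in> borel_measurable M" "\<And>k. lev M g k \<subseteq> lev M f k"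
  shows "g \<in> S J"
  using assms(1,2) emeasure_mono[OF assms(3) lev_sets[OF level_meas[OF assms(1)]]]
  unfolding level_ball_def by (blast intro: order.trans)

text \<open>If a finite supremum has level \<open>k\<close>, some \<open>g j\<close> exceeds
  \<open>2 powi k\<close> and none exceeds \<open>2 powi (k + 1)\<close>, so the level is covered by
  the same levels of the \<open>g j\<close>. For every \<open>k\<close>, a point with infinite
  supremum lies in a level of some \<open>g j\<close> from \<open>k\<close> on; these have total
  measure at most \<open>2 * J * D k\<close>, which tends to 0.\<close>

lemma sup_level:
  assumes g [measurable]: "\<And>j::nat. g j \<in> borel_measurable M" and J: "0 \<le> J"
    and sum: "\<And>k. (\<Sum>j. emeasure M (lev M (g j) k)) \<le> ennreal J * D k"
  shows "\<exists>H\<in>S J. (\<forall>x. 0 \<le> H x) \<and> (AE x in M. \<forall>j. \<bar>g j x\<bar> \<le> H x)"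
proof -
  define T where "T x = (SUP j. ennreal \<bar>g j x\<bar>)" for x
  \<comment> \<open>\<open>enn2real\<close> sends an infinite supremum to 0; the set
    \<open>U\<close> of these points turns out to be null.\<close>
  define H where "H x = enn2real (T x)" for x
  have [measurable]: "T \<in> borel_measurable M" unfolding T_def by measurable
  have Hm [measurable]: "H \<in> borel_measurable M" unfolding H_def by measurable
  have Hn: "0 \<le> H x" for x by (simp add: H_def)
  have levH: "lev M H k \<subseteq> (\<Union>j. lev M (g j) k)" for k
  proof
    fix x assume x: "x \<in> lev M H k"
    then have H0: "H x \<noteq> 0" and sp: "x \<in> space M" and lv: "lvl (H x) = k" by (auto simp: lev_def)
    have T: "T x = ennreal (H x)" "0 < H x" using H0 unfolding H_def
      by (cases "T x"; simp add: less_le)+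
    have b: "2 powi k < H x" "H x \<le> 2 powi (k+1)" using lv lvl_eq_iff[OF H0, of k] T(2) by auto
    then have "ennreal (2 powi k) < T x" using T by (simp add: ennreal_less_iff)
    then obtain j where j: "ennreal (2 powi k) < ennreal \<bar>g j x\<bar>" unfolding T_def less_SUP_iff by blast
    have "ennreal \<bar>g j x\<bar> \<le> T x" unfolding T_def by (rule SUP_upper) simp
    then have "\<bar>g j x\<bar> \<le> H x" using T by (simp add: ennreal_le_iff)
    moreover have "2 powi k < \<bar>g j x\<bar>" using j by (simp add: ennreal_less_iff)
    moreover have "g j x \<noteq> 0" using \<open>2 powi k < \<bar>g j x\<bar>\<close> by (smt (verit) zero_less_power_int)
    ultimately have "x \<in> lev M (g j) k" using sp b lvl_eq_iff[of "g j x" k] by (auto simp: lev_def)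
    then show "x \<in> (\<Union>j. lev M (g j) k)" by blast
  qed
  have "emeasure M (lev M H k) \<le> ennreal J * D k" for k
  proof -
    have "emeasure M (lev M H k) \<le> emeasure M (\<Union>j. lev M (g j) k)"
      by (rule emeasure_mono[OF levH]) measurable
    also have "\<dots> \<le> (\<Sum>j. emeasure M (lev M (g j) k))"
      by (rule emeasure_subadditive_countably) auto
    also note sum
    finally show ?thesis .
  qed
  then have HS: "H \<in> S J" by (simp add: level_ball_def)
  define U where "U = {x \<in> space M. T x = \<infinity>}"
  have [measurable]: "U \<in> sets M" unfolding U_def by measurable
  obtain k0 d where k0: "D k0 = ennreal d" "0 \<le> d" using D_fin by (metis ennreal_cases less_irrefl infinity_ennreal_def)
  have Ule: "emeasure M U \<le> ennreal (2 * J * d * (1/2)^n)" for n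
  proof -
    let ?k = "k0 + int n"
    have "U \<subseteq> (\<Union>i. \<Union>j. lev M (g j) (?k + int i))"
    proof
      fix x assume x: "x \<in> U"
      then have "ennreal (2 powi ?k) < T x" by (simp add: U_def)
      then obtain j where "ennreal (2 powi ?k) < ennreal \<bar>g j x\<bar>" unfolding T_def less_SUP_iff by blast
      then have j: "2 powi ?k < \<bar>g j x\<bar>" by (simp add: ennreal_less_iff)
      then have nz: "g j x \<noteq> 0" by (smt (verit) zero_less_power_int)
      have "2 powi ?k < (2::real) powi (lvl (g j x) + 1)"
        using j lvl_bounds(2)[OF nz] by (simp add: powi_step)
      then have "?k < lvl (g j x) + 1"
        using power_int_increasing[of "lvl (g j x) + 1" ?k "2::real"] by (metis not_le one_le_numeral)
      then have "lvl (g j x) = ?k + int (nat (lvl (g j x) - ?k))" by simp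
      then have "x \<in> lev M (g j) (?k + int (nat (lvl (g j x) - ?k)))"
        using x nz by (simp add: lev_def U_def)
      then show "x \<in> (\<Union>i. \<Union>j. lev M (g j) (?k + int i))" by blast
    qed
    then have "emeasure M U \<le> emeasure M (\<Union>i. \<Union>j. lev M (g j) (?k + int i))"
      by (rule emeasure_mono) measurable
    also have "\<dots> \<le> (\<Sum>i. emeasure M (\<Union>j. lev M (g j) (?k + int i)))"
      by (rule emeasure_subadditive_countably) auto
    also have "\<dots> \<le> (\<Sum>i. ennreal J * (ennreal ((1/2)^i) * D ?k))"
    proof (rule suminf_le[OF _ summableI summableI])
      fix i
      have "emeasure M (\<Union>j. lev M (g j) (?k + int i)) \<le> (\<Sum>j. emeasure M (lev M (g j) (?k + int i)))"
        by (rule emeasure_subadditive_countably) auto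
      also note sum
      also have "ennreal J * D (?k + int i) \<le> ennreal J * (ennreal ((1/2)^i) * D ?k)"
        by (intro mult_left_mono D_pow) simp
      finally show "emeasure M (\<Union>j. lev M (g j) (?k + int i)) \<le> ennreal J * (ennreal ((1/2)^i) * D ?k)" .
    qed
    also have "\<dots> = (\<Sum>i. ennreal ((1/2)^i)) * (ennreal J * D ?k)"
      by (subst ennreal_suminf_multc[symmetric]) (simp add: mult_ac)
    also note suminf_half_powers
    also have "ennreal 2 * (ennreal J * D ?k) \<le> ennreal 2 * (ennreal J * (ennreal ((1/2)^n) * D k0))"
      by (intro mult_left_mono D_pow) simp_all
    also have "\<dots> = ennreal (2 * J * d * (1/2)^n)"
      unfolding k0 using J k0(2) by (simp add: ennreal_mult''[symmetric] mult_ac del: ennreal_numeral)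
    finally show ?thesis .
  qed
  have "(\<lambda>n. 2 * J * d * (1/2)^n) \<longlonglongrightarrow> 2 * J * d * 0"
    by (intro tendsto_mult tendsto_const LIMSEQ_power_zero) simp
  then have "(\<lambda>n. ennreal (2 * J * d * (1/2)^n)) \<longlonglongrightarrow> ennreal 0"
    by (intro tendsto_ennrealI) simp
  then have "emeasure M U \<le> ennreal 0" by (rule LIMSEQ_le_const) (use Ule in blast)
  then have "AE x in M. x \<notin> U" by (intro AE_not_in) (simp add: null_sets_def)
  then have "AE x in M. \<forall>j. \<bar>g j x\<bar> \<le> H x"
    using AE_space
  proof eventually_elim
    case (elim x)
    then have T: "T x = ennreal (H x)" unfolding H_def U_def by (cases "T x") auto
    show ?case
    proof
      fix j
      have "ennreal \<bar>g j x\<bar> \<le> T x" unfolding T_def by (rule SUP_upper) simp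
      then show "\<bar>g j x\<bar> \<le> H x" using T Hn[of x] by simp
    qed
  qed
  then show ?thesis using HS by (intro bexI[of _ H]) (auto simp: H_def)
qed

text \<open>Uniform exhaustivity of the moduli. The functional may vary with \<open>n\<close> and
  may repeat, as the exhaustivity hypothesis of the Vitali-Hahn-Saks argument demands; asking for a
  bound \<open>H\<close> of the partial sums admits \<open>h n\<close> that overlap.\<close>

definition null_fam :: "((('a \<Rightarrow> real) \<Rightarrow> real)) set \<Rightarrow> bool" where
  "null_fam F \<longleftrightarrow> F \<subseteq> Dual \<and> (\<forall>(\<psi> :: nat \<Rightarrow> _) h H. (\<forall>n. \<psi> n \<in> F) \<longrightarrow> (\<forall>n. h n \<in> borel_measurable M) \<longrightarrow>
     (\<forall>n x. 0 \<le> h n x) \<longrightarrow> H \<in> X \<longrightarrow> (\<forall>n. AE x in M. (\<Sum>j<n. h j x) \<le> H x) \<longrightarrow>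
     (\<lambda>n. amod (\<psi> n) (h n)) \<longlonglongrightarrow> 0)"

lemma summand_Xp:
  assumes hm: "\<And>n::nat. h n \<in> borel_measurable M" and hn: "\<And>n x. 0 \<le> h n x"
    and H: "H \<in> X" and hH: "\<And>n. AE x in M. (\<Sum>j<n. h j x) \<le> H x"
  shows "h j \<in> Xp"
proof (rule Xp_solid[OF H hm])
  show "AE x in M. h j x \<le> H x"
    using hH[of "Suc j"]
  proof eventually_elim
    case (elim x)
    then show ?case using sum_nonneg[of "{..<j}" "\<lambda>j. h j x"] hn by simp
  qed
qed (rule hn)

text \<open>A gliding hump: each of the functionals kept so far almost ignores the sum over the indices still
  available, because one can pass to ever sparser halves of an infinite index set.\<close>

lemma phillips_core:
  assumes \<phi>: "\<And>i. \<phi> i \<in> Dual" "\<And>f. f \<in> X \<Longrightarrow> (\<lambda>i::nat. \<phi> i f) \<longlonglongrightarrow> 0"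
    and hm [measurable]: "\<And>n::nat. h n \<in> borel_measurable M" and hn: "\<And>n x. 0 \<le> h n x"
    and H: "H \<in> X" and hH: "\<And>n. AE x in M. (\<Sum>j<n. h j x) \<le> H x"
    and c: "0 < c" and big: "\<And>j. c < amod (\<phi> (i j)) (h j)"
  shows False
proof -
  note [measurable] = X_meas[OF H]
  have good: "AE x in M. summable (\<lambda>j. h j x) \<and> (\<Sum>j. h j x) \<le> H x"
  proof -
    have "AE x in M. \<forall>n. (\<Sum>j<n. h j x) \<le> H x" using hH by (simp add: AE_all_countable)
    then show ?thesis
    proof eventually_elim
      case (elim x)
      have "summable (\<lambda>j. h j x)" by (rule summableI_nonneg_bounded[of _ "H x"]) (use hn elim in auto)
      then show ?case using elim by (auto intro!: suminf_le_const)
    qed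
  qed
  have hX: "h j \<in> Xp" for j by (rule summand_Xp[OF hm hn H hH])
  define xs where "xs u A x = (\<Sum>j::nat. if j \<in> A then u j x else (0::real))" for u A and x :: 'a
  have xm: "xs u A \<in> borel_measurable M" if [measurable]: "\<And>j. u j \<in> borel_measurable M" for u A
    unfolding xs_def by measurable
  have xsum: "summable (\<lambda>j. if j \<in> A then u j x else (0::real))"
    if "summable (\<lambda>j. h j x)" "\<And>j. \<bar>u j x\<bar> \<le> h j x" for A x and u :: "nat \<Rightarrow> 'a \<Rightarrow> real"
    by (rule summable_comparison_test'[OF that(1), of 0]) (use that(2) hn in auto)
  \<comment> \<open>\<open>suminf\<close> has no controlled value where the series diverges. The
    maximum keeps \<open>s A\<close> nonnegative at those points too, as membership in
    \<open>Xp\<close> requires.\<close>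
  define s where "s A x = max 0 (xs h A x)" for A x
  have [measurable]: "s A \<in> borel_measurable M" for A
    unfolding s_def using xm[of h A] by measurable
  have sgood: "AE x in M. \<forall>A. summable (\<lambda>j. if j \<in> A then h j x else 0) \<and> s A x = xs h A x \<and> s A x \<le> H x"
    using good
  proof eventually_elim
    case (elim x)
    show ?case
    proof
      fix A
      have sA: "summable (\<lambda>j. if j \<in> A then h j x else 0)"
        by (rule xsum) (use elim hn in auto)
      have "0 \<le> xs h A x" unfolding xs_def by (rule suminf_nonneg[OF sA]) (use hn in auto)
      moreover have "xs h A x \<le> (\<Sum>j. h j x)" unfolding xs_def
        by (rule suminf_le[OF _ sA]) (use elim hn in auto)
      ultimately show "summable (\<lambda>j. if j \<in> A then h j x else 0) \<and> s A x = xs h A x \<and> s A x \<le> H x"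
        using elim sA by (simp add: s_def)
    qed
  qed
  have sX: "s A \<in> Xp" for A
  proof (rule Xp_solid[OF H])
    show "AE x in M. s A x \<le> H x" using sgood by eventually_elim blast
    show "0 \<le> s A x" for x by (simp add: s_def)
  qed measurable
  have s_mono: "amod \<psi> (s A) \<le> amod \<psi> (s B)" if "A \<subseteq> B" "\<psi> \<in> Dual" for A B \<psi>
  proof (rule amod_mono[OF that(2) sX sX])
    show "AE x in M. s A x \<le> s B x" using sgood
    proof eventually_elim
      case (elim x)
      have "xs h A x \<le> xs h B x" unfolding xs_def
      proof (rule suminf_le)
        show "(if j \<in> A then h j x else 0) \<le> (if j \<in> B then h j x else 0)" for j
          using that(1) hn[of j x] by auto
      qed (use elim in blast)+
      then show ?case using elim by simp
    qed
  qed
  have s_add: "amod \<psi> (s A) + amod \<psi> (s B) \<le> amod \<psi> (s C)"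
    if "A \<inter> B = {}" "A \<union> B = C" "\<psi> \<in> Dual" for A B C \<psi>
  proof -
    have "AE x in M. s A x + s B x \<le> s C x" using sgood
    proof eventually_elim
      case (elim x)
      have "xs h A x + xs h B x = (\<Sum>j. (if j \<in> A then h j x else 0) + (if j \<in> B then h j x else 0))"
        unfolding xs_def by (rule suminf_add) (use elim in blast)+
      also have "\<dots> = xs h C x" unfolding xs_def
        by (rule suminf_cong) (use that(1,2) in auto)
      finally show ?case using elim by simp
    qed
    then have "amod \<psi> (\<lambda>x. s A x + s B x) \<le> amod \<psi> (s C)"
      by (rule amod_mono[OF that(3) Xp_add[OF sX sX] sX])
    then show ?thesis by (simp add: amod_add[OF that(3) sX sX])
  qed
  have half_or: "u \<le> w / 2 \<or> v \<le> w / 2" if "u + v \<le> w" for u v w :: real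
    using that by linarith
  have halve: "\<exists>A'\<subseteq>A. infinite A' \<and> amod \<psi> (s A') \<le> amod \<psi> (s A) / 2^n"
    if "infinite A" "\<psi> \<in> Dual" for A \<psi> and n :: nat
  proof (induction n)
    case 0
    show ?case by (rule exI[of _ A]) (simp add: that(1))
  next
    case (Suc n)
    then obtain A' where A': "A' \<subseteq> A" "infinite A'" "amod \<psi> (s A') \<le> amod \<psi> (s A) / 2^n" by blast
    obtain B C where BC: "infinite B" "infinite C" "B \<inter> C = {}" "B \<union> C = A'"
      by (rule infinite_split[OF A'(2)])
    have "amod \<psi> (s B) + amod \<psi> (s C) \<le> amod \<psi> (s A) / 2^n"
      using s_add[OF BC(3,4) that(2)] A'(3) by simp
    moreover have "amod \<psi> (s A) / 2^Suc n = amod \<psi> (s A) / 2^n / 2" by simp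
    ultimately have "amod \<psi> (s B) \<le> amod \<psi> (s A) / 2^Suc n \<or> amod \<psi> (s C) \<le> amod \<psi> (s A) / 2^Suc n"
      using half_or[of "amod \<psi> (s B)" "amod \<psi> (s C)" "amod \<psi> (s A) / 2^n"] by metis
    moreover have "B \<subseteq> A" "C \<subseteq> A" using BC(4) A'(1) by auto
    ultimately show ?case using BC(1,2) by metis
  qed
  have thin: "\<exists>A'\<subseteq>A. infinite A' \<and> amod \<psi> (s A') < e"
    if *: "infinite A" "\<psi> \<in> Dual" and "0 < e" for A \<psi> e
  proof -
    obtain n where n: "amod \<psi> (s A) / e < 2^n" using real_arch_pow[of 2 "amod \<psi> (s A) / e"] by auto
    then have "amod \<psi> (s A) / 2^n < e" using \<open>0 < e\<close> by (simp add: field_simps)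
    moreover obtain A' where "A' \<subseteq> A" "infinite A'" "amod \<psi> (s A') \<le> amod \<psi> (s A) / 2^n"
      using halve[OF *, of n] by blast
    ultimately show ?thesis by (meson le_less_trans)
  qed
  have "\<forall>j. \<exists>g\<in>sub (h j). c < \<phi> (i j) g"
    using amod_less[OF \<phi>(1) hX big] by blast
  then obtain g where g: "\<And>j. g j \<in> sub (h j)" "\<And>j. c < \<phi> (i j) (g j)" by metis
  have [measurable]: "g j \<in> borel_measurable M" for j using g(1)[of j] by (simp add: sub_def)
  have gX: "g j \<in> X" for j by (rule sub_X[OF g(1) hX])
  have gh: "AE x in M. \<forall>j. \<bar>g j x\<bar> \<le> h j x" using g(1) by (simp add: sub_def AE_all_countable)
  \<comment> \<open>One functional exceeds \<open>c\<close> on only finitely many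
    \<open>h j\<close>, since its modulus is additive and finite sums of the \<open>h j\<close> stay
    below \<open>\<bar>H x\<bar>\<close>. Hence \<open>i\<close> tends to infinity and the pointwise
    convergence survives the reindexing by \<open>i\<close>.\<close>
  have finfib: "finite {j. i j = m}" for m
  proof (rule ccontr)
    assume inf: "infinite {j. i j = m}"
    obtain r where r: "amod (\<phi> m) (\<lambda>x. \<bar>H x\<bar>) < real r * c" using reals_Archimedean3[OF c] by blast
    obtain I where I: "I \<subseteq> {j. i j = m}" "finite I" "card I = r"
      using infinite_arbitrarily_large[OF inf] by blast
    have "real r * c \<le> (\<Sum>j\<in>I. amod (\<phi> m) (h j))"
      using I big by (subst I(3)[symmetric], intro sum_bounded_below) (auto intro: less_imp_le)
    also have "\<dots> = amod (\<phi> m) (\<lambda>x. \<Sum>j\<in>I. h j x)"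
      by (rule amod_sum[symmetric]) (auto simp: \<phi> hX)
    also have "\<dots> \<le> amod (\<phi> m) (\<lambda>x. \<bar>H x\<bar>)"
    proof (rule amod_mono[OF \<phi>(1) Xp_sum Xp_abs[OF H]])
      show "AE x in M. (\<Sum>j\<in>I. h j x) \<le> \<bar>H x\<bar>" using good
      proof eventually_elim
        case (elim x)
        then show ?case using sum_le_suminf[OF _ I(2), of "\<lambda>j. h j x"] hn by fastforce
      qed
    qed (rule hX)
    finally show False using r by simp
  qed
  have i_lim: "filterlim i at_top sequentially"
    unfolding filterlim_at_top
  proof
    fix Z
    have "{j. \<not> Z \<le> i j} \<subseteq> (\<Union>m<Z. {j. i j = m})" by auto
    then have "finite {j. \<not> Z \<le> i j}" using finfib by (meson finite_UN finite_lessThan finite_subset)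
    then show "\<forall>\<^sub>F j in sequentially. Z \<le> i j"
      by (simp add: eventually_cofinite flip: cofinite_eq_sequentially)
  qed
  have lim: "(\<lambda>j. \<phi> (i j) f) \<longlonglongrightarrow> 0" if "f \<in> X" for f
    by (rule filterlim_compose[OF \<phi>(2)[OF that] i_lim])
  \<comment> \<open>A state consists of the index just chosen and the infinite set of indices still
    available. \<open>P\<close> makes its functional small on everything available; \<open>Q\<close>
    makes the next functional small on all test functions \<open>g l\<close> up to the current
    index.\<close>
  define P where "P n r \<longleftrightarrow> infinite (snd r) \<and> amod (\<phi> (i (fst r))) (s (snd r)) < c / 4 \<and> snd r \<subseteq> {fst r<..}"
    for n :: nat and r :: "nat \<times> nat set"
  define Q where "Q n r r' \<longleftrightarrow> fst r' \<in> snd r \<and> snd r' \<subseteq> snd r \<and> (\<Sum>l\<le>fst r. \<bar>\<phi> (i (fst r')) (g l)\<bar>) < c / 4"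
    for n :: nat and r r' :: "nat \<times> nat set"
  have "\<exists>f. \<forall>n. P n (f n) \<and> Q n (f n) (f (Suc n))"
  proof (rule dependent_nat_choice)
    obtain A where "A \<subseteq> {0<..}" "infinite A" "amod (\<phi> (i 0)) (s A) < c / 4"
      using thin[of "{0<..}" "\<phi> (i 0)" "c/4"] c \<phi>(1) by (auto simp: infinite_Ioi)
    then show "\<exists>r. P 0 r" by (intro exI[of _ "(0, A)"]) (simp add: P_def)
  next
    fix r n assume "P n r"
    then have r: "infinite (snd r)" by (simp add: P_def)
    have "(\<lambda>j. \<Sum>l\<le>fst r. \<bar>\<phi> (i j) (g l)\<bar>) \<longlonglongrightarrow> (\<Sum>l\<le>fst r. \<bar>0\<bar>)"
      by (intro tendsto_sum tendsto_rabs lim gX)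
    then have "\<forall>\<^sub>F j in sequentially. (\<Sum>l\<le>fst r. \<bar>\<phi> (i j) (g l)\<bar>) < c / 4"
      by (rule order_tendstoD) (use c in simp)
    then have "finite {j. \<not> (\<Sum>l\<le>fst r. \<bar>\<phi> (i j) (g l)\<bar>) < c / 4}"
      unfolding cofinite_eq_sequentially[symmetric] eventually_cofinite .
    then have "infinite (snd r - {j. \<not> (\<Sum>l\<le>fst r. \<bar>\<phi> (i j) (g l)\<bar>) < c / 4})"
      using r by simp
    then obtain j where j: "j \<in> snd r" "(\<Sum>l\<le>fst r. \<bar>\<phi> (i j) (g l)\<bar>) < c / 4"
      by (metis (mono_tags, lifting) Diff_iff infinite_imp_nonempty ex_in_conv mem_Collect_eq)
    have "infinite (snd r - {..j})" using r by simp
    then obtain A' where A': "A' \<subseteq> snd r - {..j}" "infinite A'" "amod (\<phi> (i j)) (s A') < c / 4"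
      using thin[of "snd r - {..j}" "\<phi> (i j)" "c/4"] c \<phi>(1) by auto
    show "\<exists>r'. P (Suc n) r' \<and> Q n r r'"
      by (rule exI[of _ "(j, A')"]) (use A' j in \<open>auto simp: P_def Q_def\<close>)
  qed
  then obtain f where f: "\<And>n. P n (f n)" "\<And>n. Q n (f n) (f (Suc n))" by blast
  define j where "j n = fst (f n)" for n
  define A where "A n = snd (f n)" for n
  have A1: "amod (\<phi> (i (j n))) (s (A n)) < c / 4" "A n \<subseteq> {j n<..}"
    and A2: "j (Suc n) \<in> A n" "A (Suc n) \<subseteq> A n" "(\<Sum>l\<le>j n. \<bar>\<phi> (i (j (Suc n))) (g l)\<bar>) < c / 4" for n
    using f[of n] by (auto simp: P_def Q_def j_def A_def)
  have jm: "strict_mono j" unfolding strict_mono_Suc_iff using A1(2) A2(1) by blast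
  have Adec: "A m \<subseteq> A n" if "n \<le> m" for n m
    using that by (rule lift_Suc_antimono_le[of A, OF A2(2)])
  define B where "B = range j"
  have tail: "B \<inter> {j n<..} \<subseteq> A n" for n
  proof
    fix l assume "l \<in> B \<inter> {j n<..}"
    then obtain m where m: "l = j m" "j n < j m" by (auto simp: B_def)
    then have "n < m" using jm by (simp add: strict_mono_less)
    then obtain m' where "m = Suc m'" "n \<le> m'" by (cases m) auto
    then show "l \<in> A n" using A2(1)[of m'] Adec[of n m'] m by auto
  qed
  have head: "B \<inter> {..<j (Suc n)} \<subseteq> {..j n}" for n
  proof
    fix l assume "l \<in> B \<inter> {..<j (Suc n)}"
    then obtain m where m: "l = j m" "j m < j (Suc n)" by (auto simp: B_def)
    then have "m \<le> n" using jm by (simp add: strict_mono_less)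
    then show "l \<in> {..j n}" using m jm by (simp add: strict_mono_less_eq)
  qed
  have xgs: "xs g C \<in> sub (s C)" for C
  proof -
    have "AE x in M. \<bar>xs g C x\<bar> \<le> s C x" using sgood gh
    proof eventually_elim
      case (elim x)
      have a: "summable (\<lambda>j. \<bar>if j \<in> C then g j x else 0\<bar>)"
        by (rule summable_comparison_test'[of "\<lambda>j. if j \<in> C then h j x else 0" 0]) (use elim in auto)
      have "\<bar>xs g C x\<bar> \<le> (\<Sum>j. \<bar>if j \<in> C then g j x else 0\<bar>)"
        unfolding xs_def by (rule summable_rabs[OF a])
      also have "\<dots> \<le> xs h C x" unfolding xs_def by (rule suminf_le[OF _ a]) (use elim in auto)
      finally show ?case using elim by simp
    qed
    then show ?thesis using xm[of g C] by (simp add: sub_def)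
  qed
  have xgX: "xs g C \<in> X" for C by (rule sub_X[OF xgs sX])
  \<comment> \<open>The functional sees three pieces of the fixed element \<open>xs g B\<close>: the
    earlier terms and the later terms contribute less than \<open>c / 4\<close> each, its own term
    more than \<open>c\<close>. Since \<open>xs g B\<close> lies in \<open>X\<close>, this
    contradicts convergence to 0 there.\<close>
  have large: "c / 2 < \<phi> (i (j (Suc n))) (xs g B)" for n
  proof -
    let ?j = "j (Suc n)" and ?B1 = "B \<inter> {..<j (Suc n)}" and ?B2 = "B \<inter> {j (Suc n)<..}"
    let ?\<psi> = "\<phi> (i ?j)"
    have fB1: "finite ?B1" by simp
    have B1X: "(\<lambda>x. \<Sum>l\<in>?B1. g l x) \<in> X" by (rule X_sum) (rule gX)
    have "AE x in M. xs g B x = (\<Sum>l\<in>?B1. g l x) + (g ?j x + xs g ?B2 x)" using sgood gh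
    proof eventually_elim
      case (elim x)
      have sm: "summable (\<lambda>j. if j \<in> C then g j x else 0)" for C
        by (rule summable_comparison_test'[of "\<lambda>j. if j \<in> C then h j x else 0" 0]) (use elim in auto)
      have "xs g ?B1 x = (\<Sum>l\<in>?B1. g l x)"
        unfolding xs_def by (subst suminf_finite[OF fB1]) auto
      moreover have "xs g {?j} x = g ?j x"
        unfolding xs_def by (subst suminf_finite[of "{?j}"]) auto
      moreover have "xs g ?B1 x + (xs g {?j} x + xs g ?B2 x) = xs g B x"
      proof -
        have e1: "xs g {?j} x + xs g ?B2 x = (\<Sum>l. (if l \<in> {?j} then g l x else 0) + (if l \<in> ?B2 then g l x else 0))"
          unfolding xs_def by (rule suminf_add[OF sm sm])
        have e2: "xs g ?B1 x + (\<Sum>l. (if l \<in> {?j} then g l x else 0) + (if l \<in> ?B2 then g l x else 0))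
            = (\<Sum>l. (if l \<in> ?B1 then g l x else 0) +
            ((if l \<in> {?j} then g l x else 0) + (if l \<in> ?B2 then g l x else 0)))"
          unfolding xs_def by (rule suminf_add[OF sm summable_add[OF sm sm]])
        have e3: "(\<Sum>l. (if l \<in> ?B1 then g l x else 0) +
            ((if l \<in> {?j} then g l x else 0) + (if l \<in> ?B2 then g l x else 0))) = xs g B x"
          unfolding xs_def by (rule suminf_cong) (auto simp: B_def)
        show ?thesis by (simp only: e1 e2 e3)
      qed
      ultimately show ?case by simp
    qed
    then have "?\<psi> (xs g B) = ?\<psi> (\<lambda>x. (\<Sum>l\<in>?B1. g l x) + (g ?j x + xs g ?B2 x))"
      by (intro dual_AE_cong[OF \<phi>(1) xgX]) (use xm[of g ?B2] in measurable)
    also have "\<dots> = ?\<psi> (\<lambda>x. \<Sum>l\<in>?B1. g l x) + (?\<psi> (g ?j) + ?\<psi> (xs g ?B2))"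
      by (simp add: dual_add[OF \<phi>(1)] B1X X_add gX xgX)
    also have "?\<psi> (\<lambda>x. \<Sum>l\<in>?B1. g l x) = (\<Sum>l\<in>?B1. ?\<psi> (g l))"
      by (rule dual_sum[OF \<phi>(1)]) (rule gX)
    finally have e: "?\<psi> (xs g B) = (\<Sum>l\<in>?B1. ?\<psi> (g l)) + (?\<psi> (g ?j) + ?\<psi> (xs g ?B2))" .
    have "\<bar>\<Sum>l\<in>?B1. ?\<psi> (g l)\<bar> \<le> (\<Sum>l\<in>?B1. \<bar>?\<psi> (g l)\<bar>)" by (rule sum_abs)
    also have "\<dots> \<le> (\<Sum>l\<le>j n. \<bar>?\<psi> (g l)\<bar>)" by (rule sum_mono2) (use head in auto)
    also have "\<dots> < c / 4" by (rule A2)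
    finally have 1: "\<bar>\<Sum>l\<in>?B1. ?\<psi> (g l)\<bar> < c / 4" .
    have "\<bar>?\<psi> (xs g ?B2)\<bar> \<le> amod ?\<psi> (s ?B2)" by (rule abs_le_amod[OF \<phi>(1) sX xgs])
    also have "\<dots> \<le> amod ?\<psi> (s (A (Suc n)))" by (rule s_mono[OF tail \<phi>(1)])
    also have "\<dots> < c / 4" by (rule A1)
    finally show ?thesis using 1 e g(2)[of ?j] by linarith
  qed
  have "filterlim (\<lambda>n. j (Suc n)) at_top sequentially"
    using filterlim_subseq[OF jm] filterlim_sequentially_Suc[of j] by simp
  then have "(\<lambda>n. \<phi> (i (j (Suc n))) (xs g B)) \<longlonglongrightarrow> 0"
    by (rule filterlim_compose[OF lim[OF xgX]])
  then have "\<forall>\<^sub>F n in sequentially. \<phi> (i (j (Suc n))) (xs g B) < c / 2"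
    by (rule order_tendstoD) (use c in simp)
  then show False using large by (meson eventually_sequentially less_asym order_refl)
qed

text \<open>The modulus is convex in the functional, so a combination that is at least
  \<open>c\<close> on \<open>h n\<close> forces some \<open>\<phi> i\<close> above
  \<open>c / 2\<close> on the same \<open>h n\<close>. The choice of \<open>i\<close> in
  \<open>phillips_core\<close> is arbitrary, which makes it applicable to the offending
  indices.\<close>

lemma null_fam_chull:
  assumes \<phi>: "\<And>i. \<phi> i \<in> Dual" "\<And>f. f \<in> X \<Longrightarrow> (\<lambda>i::nat. \<phi> i f) \<longlonglongrightarrow> 0"
  shows "null_fam (chull \<phi> 0)"
  unfolding null_fam_def
proof (intro conjI allI impI)
  show sub: "chull \<phi> 0 \<subseteq> Dual" using chull_Dual \<phi>(1) by blast
  fix \<psi> :: "nat \<Rightarrow> ('a \<Rightarrow> real) \<Rightarrow> real" and h :: "nat \<Rightarrow> 'a \<Rightarrow> real" and H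
  assume \<psi>: "\<forall>n. \<psi> n \<in> chull \<phi> 0" and hm: "\<forall>n. h n \<in> borel_measurable M" and hn: "\<forall>n x. 0 \<le> h n x"
    and H: "H \<in> X" and hH: "\<forall>n. AE x in M. (\<Sum>j<n. h j x) \<le> H x"
  have hX: "h j \<in> Xp" for j by (rule summand_Xp[OF _ _ H]) (use hm hn hH in auto)
  have nn: "0 \<le> amod (\<psi> n) (h n)" for n by (rule amod_nonneg[OF _ hX]) (use \<psi> sub in auto)
  show "(\<lambda>n. amod (\<psi> n) (h n)) \<longlonglongrightarrow> 0"
  proof (rule ccontr)
    assume "\<not> ?thesis"
    then obtain c where c: "0 < c" "\<exists>\<^sub>F n in sequentially. \<not> amod (\<psi> n) (h n) < c"
      unfolding tendsto_iff frequently_def using nn by (auto simp: dist_real_def)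
    then have "infinite {n. \<not> amod (\<psi> n) (h n) < c}"
      by (simp add: frequently_cofinite flip: cofinite_eq_sequentially)
    then obtain r :: "nat \<Rightarrow> nat" where r: "strict_mono r" "\<And>n. \<not> amod (\<psi> (r n)) (h (r n)) < c"
      using infinite_enumerate by blast
    have "\<exists>i. c / 2 < amod (\<phi> i) (h (r n))" for n
    proof (rule ccontr)
      assume no: "\<nexists>i. c / 2 < amod (\<phi> i) (h (r n))"
      have "amod (\<psi> (r n)) (h (r n)) \<le> c / 2"
      proof (rule chull_amod_le[of _ \<phi> 0])
        show "\<psi> (r n) \<in> chull \<phi> 0" using \<psi> by blast
        show "amod (\<phi> i) (h (r n)) \<le> c / 2" for i
          using no not_less by blast
      qed (rule \<phi> hX)+
      then show False using r(2)[of n] c(1) by simp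
    qed
    then obtain i where i: "\<And>n. c / 2 < amod (\<phi> (i n)) (h (r n))" by metis
    have "AE x in M. (\<Sum>j<n. h (r j) x) \<le> H x" for n
      using hH[rule_format, of "r n"]
    proof eventually_elim
      case (elim x)
      have "(\<Sum>j<n. h (r j) x) = (\<Sum>j\<in>r ` {..<n}. h j x)"
        using r(1) by (subst sum.reindex) (auto intro: strict_mono_imp_inj_on inj_on_subset)
      also have "\<dots> \<le> (\<Sum>j<r n. h j x)"
        by (rule sum_mono2) (use r(1) hn in \<open>auto simp: strict_mono_less\<close>)
      finally show ?case using elim by simp
    qed
    then show False
      using phillips_core[OF \<phi>, of "\<lambda>n. h (r n)" H "c/2" i] hm hn H c i by auto
  qed
qed

end

subsection \<open>Domination of small elements\<close>

lemma lvl_scale: "y \<noteq> 0 \<Longrightarrow> lvl ((1/2)^j * y) = lvl y - int j"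
proof -
  assume "y \<noteq> 0"
  then have "log 2 \<bar>(1/2)^j * y\<bar> = log 2 \<bar>y\<bar> - real j"
    by (simp add: abs_mult log_mult log_nat_power log_divide power_divide)
  then show ?thesis unfolding lvl_def by linarith
qed

context level_space begin

text \<open>If the modulus of a functional is small on \<open>cut f G\<close> for all
  \<open>f\<close> in a set, the functional is almost carried there by the order interval of
  \<open>2 * G\<close>. With factor 1 in place of 2, the cuts along a running maximum could have an
  unbounded sum.\<close>

definition cut :: "('a \<Rightarrow> real) \<Rightarrow> ('a \<Rightarrow> real) \<Rightarrow> 'a \<Rightarrow> real" where
  "cut f G x = (if 2 * G x < \<bar>f x\<bar> then \<bar>f x\<bar> else 0)"

lemma cut_meas [measurable (raw)]:
  "f \<in> borel_measurable M \<Longrightarrow> G \<in> borel_measurable M \<Longrightarrow> cut f G \<in> borel_measurable M"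
proof -
  assume [measurable]: "f \<in> borel_measurable M" "G \<in> borel_measurable M"
  show ?thesis unfolding cut_def[abs_def] by measurable
qed

lemma cut_nonneg: "0 \<le> cut f G x" and cut_le: "cut f G x \<le> \<bar>f x\<bar>"
  by (auto simp: cut_def)

lemma cut_Xp: "f \<in> X \<Longrightarrow> G \<in> Xp \<Longrightarrow> cut f G \<in> Xp"
  by (rule Xp_solid[OF X_abs]) (auto intro: cut_meas X_meas XpD simp: cut_nonneg cut_le)

lemma Xp_max: "h \<in> Xp \<Longrightarrow> f \<in> X \<Longrightarrow> (\<lambda>x. max (h x) \<bar>f x\<bar>) \<in> Xp"
proof -
  assume a: "h \<in> Xp" "f \<in> X"
  note [measurable] = XpD(3)[OF a(1)] X_meas[OF a(2)]
  have "(\<lambda>x. h x + \<bar>f x\<bar>) \<in> X" using Xp_add[OF a(1) Xp_abs[OF a(2)]] by (simp add: Xp_def)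
  then show ?thesis by (rule Xp_solid) (auto simp: XpD(2)[OF a(1)] le_max_iff_disj)
qed

text \<open>A running maximum in which each new function may depend on the maximum reached so far:
  counterexamples to domination by \<open>G\<close> are picked after \<open>G\<close>.\<close>

fun run :: "(nat \<Rightarrow> ('a \<Rightarrow> real) \<Rightarrow> 'a \<Rightarrow> real) \<Rightarrow> nat \<Rightarrow> 'a \<Rightarrow> real" where
  "run f 0 = (\<lambda>x. 0)"
| "run f (Suc n) = (\<lambda>x. max (run f n x) \<bar>f n (run f n) x\<bar>)"

lemma run_Xp: "(\<And>n G. G \<in> Xp \<Longrightarrow> f n G \<in> X) \<Longrightarrow> run f n \<in> Xp"
  by (induction n) (auto intro: Xp_max Xp_zero)

text \<open>At a given point every nonzero summand more than doubles the running maximum.\<close>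
lemma sum_cut_le: "(\<Sum>j<n. cut (f j (run f j)) (run f j) x) \<le> 2 * run f n x"
  by (induction n) (auto simp: cut_def)

lemma run_le:
  assumes "\<And>j. \<bar>f j (run f j) x\<bar> \<le> H" "0 \<le> H" shows "run f n x \<le> H"
  by (induction n) (auto simp: assms)

lemma suminf_level_le:
  assumes "\<And>j. f j \<in> borel_measurable M" "\<And>j. emeasure M (lev M (f j) k) \<le> ennreal ((1/2)^j) * D k"
  shows "(\<Sum>j. emeasure M (lev M (f j) k)) \<le> ennreal 2 * D k"
proof -
  have "(\<Sum>j. emeasure M (lev M (f j) k)) \<le> (\<Sum>j. ennreal ((1/2)^j) * D k)"
    by (rule suminf_le[OF assms(2) summableI summableI])
  also have "\<dots> = (\<Sum>j. ennreal ((1/2)^j)) * D k" by (rule ennreal_suminf_multc)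
  also note suminf_half_powers
  finally show ?thesis .
qed

lemma null_famD:
  assumes "null_fam F" "\<And>n::nat. \<psi> n \<in> F" "\<And>n. h n \<in> borel_measurable M" "\<And>n x. 0 \<le> h n x" "H \<in> X"
    "\<And>n. AE x in M. (\<Sum>j<n. h j x) \<le> H x"
  shows "(\<lambda>n. amod (\<psi> n) (h n)) \<longlonglongrightarrow> 0"
  using assms unfolding null_fam_def by blast

lemma null_fam_Dual: "null_fam F \<Longrightarrow> \<psi> \<in> F \<Longrightarrow> \<psi> \<in> Dual"
  unfolding null_fam_def by blast

lemma not_tendsto_zero_ge: "(\<And>n::nat. e < f n) \<Longrightarrow> 0 < (e::real) \<Longrightarrow> \<not> f \<longlonglongrightarrow> 0"
proof
  assume a: "\<And>n. e < f n" "0 < e" "f \<longlonglongrightarrow> 0"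
  then have "\<forall>\<^sub>F n in sequentially. f n < e" by (auto dest: order_tendstoD)
  then obtain n where "f n < e" by (auto simp: eventually_sequentially)
  then show False using a(1)[of n] by simp
qed

text \<open>Multiplication by \<open>(1/2)^j\<close> shifts level \<open>k + j\<close> to level
  \<open>k\<close>, and \<open>D (k + j)\<close> is at most \<open>(1/2)^j * D k\<close>; so the
  \<open>g j\<close> have a supremum \<open>H\<close> in the space. A second factor
  \<open>(1/2)^j\<close> brings the sum of the \<open>h j\<close> below \<open>2 * H\<close>, and
  the growth \<open>4^n\<close> makes up for both factors.\<close>

lemma null_fam_bounded:
  assumes F: "null_fam F"
  shows "\<exists>C\<ge>0. \<forall>\<psi>\<in>F. \<forall>f\<in>S 1. amod \<psi> (\<lambda>x. \<bar>f x\<bar>) \<le> C"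
proof (rule ccontr)
  assume no: "\<not> ?thesis"
  have "\<exists>\<psi>\<in>F. \<exists>f\<in>S 1. 4^n < amod \<psi> (\<lambda>x. \<bar>f x\<bar>)" for n :: nat
  proof -
    have "(0::real) \<le> 4^n" by simp
    then show ?thesis using no not_le by metis
  qed
  then obtain \<psi> f where \<psi>: "\<And>n. \<psi> n \<in> F" and f: "\<And>n. f n \<in> S 1"
    and big: "\<And>n::nat. 4^n < amod (\<psi> n) (\<lambda>x. \<bar>f n x\<bar>)" by metis
  note [measurable] = level_meas[OF f]
  define g where "g j x = (1/2)^j * f j x" for j x
  have gm: "g j \<in> borel_measurable M" for j unfolding g_def by measurable
  have "lev M (g j) k = lev M (f j) (k + int j)" for j k
    by (auto simp: lev_def g_def lvl_scale)
  then have "emeasure M (lev M (g j) k) \<le> ennreal ((1/2)^j) * D k" for j k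
    using f[of j] D_pow[of k j] by (auto simp: level_ball_def intro: order.trans)
  then have "\<And>k. (\<Sum>j. emeasure M (lev M (g j) k)) \<le> ennreal 2 * D k"
    by (intro suminf_level_le gm)
  then obtain H where H: "H \<in> S 2" "\<And>x. 0 \<le> H x" "AE x in M. \<forall>j. \<bar>g j x\<bar> \<le> H x"
    using sup_level[of g, OF gm, of 2] by auto
  have HX: "H \<in> X" using level_X[OF _ H(1)] by simp
  define h where "h j x = (1/4)^j * \<bar>f j x\<bar>" for j x
  have hm: "h j \<in> borel_measurable M" for j unfolding h_def by measurable
  have "AE x in M. (\<Sum>j<n. h j x) \<le> 2 * H x" for n
    using H(3)
  proof eventually_elim
    case (elim x)
    have "(\<Sum>j<n. h j x) = (\<Sum>j<n. (1/2)^j * \<bar>g j x\<bar>)"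
      by (rule sum.cong) (auto simp: h_def g_def abs_mult mult.assoc[symmetric] power_mult_distrib[symmetric])
    also have "\<dots> \<le> (\<Sum>j<n. (1/2)^j * H x)"
      by (intro sum_mono mult_left_mono) (use elim in auto)
    also have "\<dots> = (\<Sum>j<n. (1/2)^j) * H x" by (simp add: sum_distrib_right)
    also have "\<dots> \<le> 2 * H x"
      using H(2) by (intro mult_right_mono sum_half_powers_le) auto
    finally show ?case .
  qed
  then have "(\<lambda>n. amod (\<psi> n) (h n)) \<longlonglongrightarrow> 0"
    by (intro null_famD[OF F \<psi>, of h "\<lambda>x. 2 * H x"] X_scale HX hm) (auto simp: h_def)
  moreover have "1 < amod (\<psi> n) (h n)" for n
  proof -
    have "amod (\<psi> n) (h n) = (1/4)^n * amod (\<psi> n) (\<lambda>x. \<bar>f n x\<bar>)"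
      unfolding h_def using null_fam_Dual[OF F \<psi>] level_X[OF _ f] by (intro amod_scale Xp_abs) auto
    also have "\<dots> > (1/4)^n * 4^n" using big[of n] by (intro mult_strict_left_mono) auto
    finally show ?thesis by (simp add: power_mult_distrib[symmetric])
  qed
  ultimately show False using not_tendsto_zero_ge[of 1] by auto
qed

lemma null_fam_bounded_at:
  assumes F: "null_fam F" and G: "G \<in> Xp"
  shows "\<exists>C\<ge>0. \<forall>\<psi>\<in>F. amod \<psi> G \<le> C"
proof -
  obtain C where C: "0 \<le> C" "\<And>\<psi> f. \<psi> \<in> F \<Longrightarrow> f \<in> S 1 \<Longrightarrow> amod \<psi> (\<lambda>x. \<bar>f x\<bar>) \<le> C"
    using null_fam_bounded[OF F] by blast
  \<comment> \<open>The summand 1 keeps \<open>c\<close> positive when \<open>G\<close> has seminorm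
    0.\<close>
  define c where "c = N G + 1"
  have c: "0 < c" "N G \<le> c" using N_nonneg[of G] G by (auto simp: c_def Xp_def)
  have GX: "G \<in> X" using G by (simp add: Xp_def)
  have "N (\<lambda>x. 1 / c * G x) \<le> 1" unfolding N_scale[OF GX] using c by simp
  then have "(\<lambda>x. 1 / c * G x) \<in> S 1" by (intro ball_level X_scale GX)
  moreover have "(\<lambda>x. \<bar>1 / c * G x\<bar>) = (\<lambda>x. 1 / c * G x)" using c XpD(2)[OF G] by (auto simp: fun_eq_iff)
  ultimately have "amod \<psi> (\<lambda>x. 1 / c * G x) \<le> C" if "\<psi> \<in> F" for \<psi>
    using C(2)[OF that] by metis
  moreover have "amod \<psi> (\<lambda>x. 1 / c * G x) = 1 / c * amod \<psi> G" if "\<psi> \<in> F" for \<psi>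
    using amod_scale[OF null_fam_Dual[OF F that] G, of "1/c"] c by simp
  ultimately have "1 / c * amod \<psi> G \<le> C" if "\<psi> \<in> F" for \<psi>
    using that by metis
  then have "amod \<psi> G \<le> C * c" if "\<psi> \<in> F" for \<psi>
    using that c by (metis mult.left_neutral pos_divide_le_eq times_divide_eq_left)
  then show ?thesis using C c by (intro exI[of _ "C * c"]) auto
qed

text \<open>Counterexamples taken successively against their running maximum have level measures
  with sum at most \<open>2 * D k\<close>. Hence they have a supremum in the space, twice of which
  bounds the sum of the cuts, and \<open>null_fam\<close> forbids the moduli to stay above
  \<open>e\<close>.\<close>

lemma small_level_dominated:
  assumes F: "null_fam F" and e: "0 < e"
  shows "\<exists>n. \<exists>G\<in>Xp. \<forall>\<psi>\<in>F. \<forall>f\<in>S ((1/2)^n). amod \<psi> (cut f G) \<le> e"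
proof (rule ccontr)
  assume "\<not> ?thesis"
  then have "\<forall>n G. \<exists>\<psi> f. G \<in> Xp \<longrightarrow> \<psi> \<in> F \<and> f \<in> S ((1/2)^n) \<and> e < amod \<psi> (cut f G)"
    by (meson not_le)
  then obtain \<Psi> where "\<forall>n G. \<exists>f. G \<in> Xp \<longrightarrow> \<Psi> n G \<in> F \<and> f \<in> S ((1/2)^n) \<and> e < amod (\<Psi> n G) (cut f G)"
    by metis
  then obtain f where \<Psi>: "\<And>n G. G \<in> Xp \<Longrightarrow> \<Psi> n G \<in> F" and f: "\<And>n G. G \<in> Xp \<Longrightarrow> f n G \<in> S ((1/2)^n)"
    and big: "\<And>n G. G \<in> Xp \<Longrightarrow> e < amod (\<Psi> n G) (cut (f n G) G)" by metis
  have fX: "f n G \<in> X" if "G \<in> Xp" for n G by (rule level_X[OF _ f[OF that]]) simp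
  have R: "run f n \<in> Xp" for n by (rule run_Xp) (rule fX)
  define g where "g n = f n (run f n)" for n
  have gS: "g n \<in> S ((1/2)^n)" for n unfolding g_def by (rule f[OF R])
  note gm [measurable] = level_meas[OF gS]
  have [measurable]: "run f n \<in> borel_measurable M" for n by (rule XpD(3)[OF R])
  have "\<And>k. (\<Sum>j. emeasure M (lev M (g j) k)) \<le> ennreal 2 * D k"
    by (rule suminf_level_le[OF gm]) (use gS in \<open>auto simp: level_ball_def\<close>)
  then obtain H where H: "H \<in> S 2" "\<And>x. 0 \<le> H x" "AE x in M. \<forall>j. \<bar>g j x\<bar> \<le> H x"
    using sup_level[of g, OF gm, of 2] by auto
  have HX: "H \<in> X" using level_X[OF _ H(1)] by simp
  have "AE x in M. (\<Sum>j<n. cut (g j) (run f j) x) \<le> 2 * H x" for n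
    using H(3)
  proof eventually_elim
    case (elim x)
    have "run f n x \<le> H x" by (rule run_le) (use elim H(2) in \<open>auto simp: g_def\<close>)
    then show ?case using sum_cut_le[of f x n] by (simp add: g_def)
  qed
  then have "(\<lambda>n. amod (\<Psi> n (run f n)) (cut (g n) (run f n))) \<longlonglongrightarrow> 0"
    by (intro null_famD[OF F, of _ _ "\<lambda>x. 2 * H x"] X_scale HX \<Psi> R) (auto simp: cut_nonneg)
  moreover have "e < amod (\<Psi> n (run f n)) (cut (g n) (run f n))" for n
    unfolding g_def by (rule big[OF R])
  ultimately show False using not_tendsto_zero_ge[of e] e by auto
qed

text \<open>The levels are no longer summable, so growth rates decide: \<open>n\<close>
  counterexamples push the modulus of their running maximum to at least \<open>n * e / 2\<close>,
  whereas this maximum lies in \<open>S n\<close> and has norm at most \<open>C' + d * n\<close>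
  with \<open>d\<close> as small as desired.\<close>

lemma functional_dominated:
  assumes \<psi>: "\<psi> \<in> Dual" and e: "0 < e"
  shows "\<exists>G\<in>Xp. \<forall>f\<in>S 1. amod \<psi> (cut f G) \<le> e"
proof (rule ccontr)
  assume "\<not> ?thesis"
  then have "\<forall>G. \<exists>f. G \<in> Xp \<longrightarrow> f \<in> S 1 \<and> e < amod \<psi> (cut f G)" by (meson not_le)
  then obtain f' where f': "\<And>G. G \<in> Xp \<Longrightarrow> f' G \<in> S 1" "\<And>G. G \<in> Xp \<Longrightarrow> e < amod \<psi> (cut (f' G) G)" by metis
  define f where "f n = f'" for n :: nat
  have fX: "f n G \<in> X" if "G \<in> Xp" for n G unfolding f_def by (rule level_X[OF _ f'(1)[OF that]]) simp
  have R: "run f n \<in> Xp" for n by (rule run_Xp) (rule fX)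
  define g where "g n = f n (run f n)" for n
  have gS: "g n \<in> S 1" for n unfolding g_def using f'(1)[OF R] by (simp add: f_def)
  have gX: "g n \<in> X" for n using level_X[OF _ gS] by simp
  note gm [measurable] = level_meas[OF gS]
  have rm [measurable]: "run f n \<in> borel_measurable M" for n by (rule XpD(3)[OF R])
  have runS: "run f n \<in> S (real n)" for n
  proof -
    have "emeasure M (lev M (run f n) k) \<le> ennreal (real n) * D k" for k
    proof (induction n)
      case 0
      then show ?case by (simp add: lev_def)
    next
      case (Suc n)
      have "lev M (run f (Suc n)) k \<subseteq> lev M (run f n) k \<union> lev M (g n) k"
        using XpD(2)[OF R] by (auto simp: lev_def g_def max_def split: if_splits)
      then have "emeasure M (lev M (run f (Suc n)) k) \<le> emeasure M (lev M (run f n) k \<union> lev M (g n) k)"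
        by (rule emeasure_mono) measurable
      also have "\<dots> \<le> emeasure M (lev M (run f n) k) + emeasure M (lev M (g n) k)"
        by (rule emeasure_subadditive) measurable
      also have "\<dots> \<le> ennreal (real n) * D k + ennreal 1 * D k"
        using Suc gS[of n] by (intro add_mono) (auto simp: level_ball_def)
      also have "\<dots> = ennreal (real (Suc n)) * D k"
      proof -
        have "ennreal (real n) + ennreal 1 = ennreal (real (Suc n))"
          by (subst ennreal_plus[symmetric]) (auto simp: add.commute)
        then show ?thesis by (simp only: distrib_right[symmetric])
      qed
      finally show ?case .
    qed
    then show ?thesis by (simp add: level_ball_def)
  qed
  obtain C where C: "0 \<le> C" "\<And>h. h \<in> Xp \<Longrightarrow> amod \<psi> h \<le> C * N h" using amod_bound[OF \<psi>] by blast
  \<comment> \<open>This gives \<open>2 * C * d \<le> e / 2\<close>; the summand 4 covers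
    \<open>C = 0\<close>.\<close>
  define d where "d = e / (4 * C + 4)"
  have d: "0 < d" "2 * C * d \<le> e / 2" using C(1) e by (auto simp: d_def field_simps)
  obtain C' where C': "\<And>J f. 0 \<le> J \<Longrightarrow> f \<in> S J \<Longrightarrow> N f \<le> C' + d * J" using level_norm[OF d(1)] by blast
  have le: "real n * e \<le> 2 * C * C' + real n * (e / 2)" for n
  proof -
    have "real n * e \<le> (\<Sum>j<n. amod \<psi> (cut (g j) (run f j)))"
      using sum_bounded_below[of "{..<n}" e "\<lambda>j. amod \<psi> (cut (g j) (run f j))"] f'(2)[OF R]
      by (auto simp: g_def f_def less_imp_le)
    also have "\<dots> = amod \<psi> (\<lambda>x. \<Sum>j<n. cut (g j) (run f j) x)"
      by (rule amod_sum[symmetric, OF \<psi>]) (rule cut_Xp[OF gX R])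
    also have "\<dots> \<le> amod \<psi> (\<lambda>x. 2 * run f n x)"
      by (rule amod_mono[OF \<psi> Xp_sum Xp_scale[OF R]]) (auto simp: g_def sum_cut_le intro!: R cut_Xp gX[unfolded g_def])
    also have "\<dots> = 2 * amod \<psi> (run f n)" by (rule amod_scale[OF \<psi> R]) simp
    also have "\<dots> \<le> 2 * (C * (C' + d * real n))"
      using C(2)[OF R, of n] C'[OF _ runS, of n] mult_left_mono[OF _ C(1)] by force
    also have "\<dots> \<le> 2 * C * C' + real n * (e / 2)"
      using mult_left_mono[OF d(2), of "real n"] by (simp add: algebra_simps)
    finally show ?thesis .
  qed
  obtain n :: nat where "2 * C * C' < real n * (e / 2)" using reals_Archimedean3[of "e/2"] e half_gt_zero by blast
  then show False using le[of n] by (simp add: algebra_simps)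
qed

end

subsection \<open>Convex combinations on order intervals\<close>

context level_space begin

lemma mult_Xp:
  assumes G: "G \<in> Xp" and f: "f \<in> borel_measurable M" "\<And>x. 0 \<le> f x" "\<And>x. f x \<le> c"
  shows "(\<lambda>x. f x * G x) \<in> Xp"
proof (rule Xp_solid[OF X_scale[of G c]])
  show "G \<in> X" using G by (simp add: Xp_def)
  show "(\<lambda>x. f x * G x) \<in> borel_measurable M" using f(1) XpD(3)[OF G] by measurable
  show "0 \<le> f x * G x" for x using f(2) XpD(2)[OF G] by simp
  show "AE x in M. f x * G x \<le> c * G x" using f(3) XpD(2)[OF G] by (intro AE_I2 mult_right_mono)
qed

lemma mult_sub:
  assumes "G \<in> Xp" "f \<in> borel_measurable M" "\<And>x. \<bar>f x\<bar> \<le> 1"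
  shows "(\<lambda>x. f x * G x) \<in> sub G"
proof -
  note [measurable] = assms(2) XpD(3)[OF assms(1)]
  have "\<bar>f x * G x\<bar> \<le> G x" for x
    using mult_right_mono[OF assms(3) XpD(2)[OF assms(1)], of x x] XpD(2)[OF assms(1), of x]
    by (simp add: abs_mult)
  then show ?thesis by (simp add: sub_def)
qed

text \<open>An order interval consists, up to null sets, of the multiples of \<open>G\<close> by
  functions bounded by 1. This moves the argument to bounded measurable functions, where squares are
  available.\<close>

lemma amod_approx_mult:
  assumes "\<psi> \<in> Dual" "G \<in> Xp"
    and "\<And>f. f \<in> borel_measurable M \<Longrightarrow> (\<And>x. \<bar>f x\<bar> \<le> 1) \<Longrightarrow> \<psi> (\<lambda>x. f x * G x) \<le> c"
  shows "amod \<psi> G \<le> c"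
proof (rule amod_least[OF assms(2)])
  fix g assume g: "g \<in> sub G"
  then have [measurable]: "g \<in> borel_measurable M" by (simp add: sub_def)
  note [measurable] = XpD(3)[OF assms(2)]
  define f where "f x = (if \<bar>g x\<bar> \<le> G x \<and> G x \<noteq> 0 then g x / G x else 0)" for x
  have [measurable]: "f \<in> borel_measurable M" unfolding f_def by measurable
  have "\<bar>f x\<bar> \<le> 1" for x using XpD(2)[OF assms(2), of x] by (auto simp: f_def)
  then have "\<psi> (\<lambda>x. f x * G x) \<le> c" by (intro assms(3)) auto
  also have "\<psi> (\<lambda>x. f x * G x) = \<psi> g"
  proof (rule dual_AE_cong[OF assms(1), symmetric])
    show "g \<in> X" by (rule sub_X[OF g assms(2)])
    have "AE x in M. \<bar>g x\<bar> \<le> G x" using g by (simp add: sub_def)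
    then show "AE x in M. g x = f x * G x" by eventually_elim (auto simp: f_def)
  qed measurable
  finally show "\<psi> g \<le> c" .
qed

text \<open>The pieces of \<open>G\<close> over disjoint sets have sums below \<open>G\<close>, so
  \<open>null_fam\<close> yields exhaustivity. The finite sum over \<open>I\<close> acts as a
  finitely additive control measure.\<close>

lemma null_fam_uniformly_continuous:
  assumes F: "null_fam F" and G: "G \<in> Xp" and e: "0 < e"
  shows "\<exists>I \<kappa>. finite I \<and> I \<subseteq> F \<and> 0 < \<kappa> \<and>
    (\<forall>B\<in>sets M. (\<Sum>l\<in>I. amod l (\<lambda>x. indicator B x * G x)) \<le> \<kappa> \<longrightarrow>
       (\<forall>\<psi>\<in>F. amod \<psi> (\<lambda>x. indicator B x * G x) \<le> e))"
proof (rule uniformly_exhaustive_imp_uniformly_continuous[OF sets.ring_of_sets_axioms _ _ _ _ e])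
  note [measurable] = XpD(3)[OF G]
  have iX: "(\<lambda>x. indicator B x * G x) \<in> Xp" if "B \<in> sets M" for B
    by (rule mult_Xp[OF G, of _ 1]) (use that in \<open>auto simp: indicator_def\<close>)
  fix \<psi> A B assume \<psi>: "\<psi> \<in> F" and A: "A \<in> sets M" and B: "B \<in> sets M"
  show "amod \<psi> (\<lambda>x. indicator A x * G x) \<le> amod \<psi> (\<lambda>x. indicator B x * G x)" if "A \<subseteq> B"
    by (rule amod_mono[OF null_fam_Dual[OF F \<psi>] iX[OF A] iX[OF B]])
      (use that XpD(2)[OF G] in \<open>auto simp: indicator_def\<close>)
  have "amod \<psi> (\<lambda>x. indicator (A \<union> B) x * G x) \<le> amod \<psi> (\<lambda>x. indicator A x * G x + indicator B x * G x)"
    by (rule amod_mono[OF null_fam_Dual[OF F \<psi>] iX Xp_add[OF iX[OF A] iX[OF B]]])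
      (use A B XpD(2)[OF G] in \<open>auto simp: indicator_def\<close>)
  also have "\<dots> = amod \<psi> (\<lambda>x. indicator A x * G x) + amod \<psi> (\<lambda>x. indicator B x * G x)"
    by (rule amod_add[OF null_fam_Dual[OF F \<psi>] iX[OF A] iX[OF B]])
  finally show "amod \<psi> (\<lambda>x. indicator (A \<union> B) x * G x)
    \<le> amod \<psi> (\<lambda>x. indicator A x * G x) + amod \<psi> (\<lambda>x. indicator B x * G x)" .
next
  fix \<psi> assume "\<psi> \<in> F"
  then show "amod \<psi> (\<lambda>x. indicator {} x * G x) = 0" using amod_zero[OF null_fam_Dual[OF F]] by simp
next
  fix \<psi> :: "nat \<Rightarrow> ('a \<Rightarrow> real) \<Rightarrow> real" and E :: "nat \<Rightarrow> 'a set"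
  assume \<psi>: "\<And>n. \<psi> n \<in> F" and E: "range E \<subseteq> sets M" "disjoint_family E"
  note [measurable] = XpD(3)[OF G]
  have Em [measurable]: "E n \<in> sets M" for n using E(1) by auto
  show "(\<lambda>n. amod (\<psi> n) (\<lambda>x. indicator (E n) x * G x)) \<longlonglongrightarrow> 0"
  proof (rule null_famD[OF F \<psi>])
    show "G \<in> X" using G by (simp add: Xp_def)
    show "AE x in M. (\<Sum>j<n. indicator (E j) x * G x) \<le> G x" for n
    proof (rule AE_I2)
      fix x
      have "(\<Sum>j<n. indicator (E j) x * G x) = (\<Sum>j<n. indicator (E j) x) * G x"
        by (simp add: sum_distrib_right)
      also have "(\<Sum>j<n. indicator (E j) x) = (indicator (\<Union>j<n. E j) x :: real)"
        using E(2) by (subst indicator_UN_disjoint) (auto simp: disjoint_family_on_def)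
      also have "\<dots> * G x \<le> G x" using XpD(2)[OF G, of x] by (auto simp: indicator_def)
      finally show "(\<Sum>j<n. indicator (E j) x * G x) \<le> G x" .
    qed
    show "(\<lambda>x. indicator (E n) x * G x) \<in> borel_measurable M" for n by measurable
  qed (use XpD(2)[OF G] in \<open>auto simp: indicator_def\<close>)
qed

text \<open>On the order interval \<open>[-G, G]\<close> the functionals behave like bounded finitely additive
  measures with a control functional \<open>\<theta>\<close>.  Nearly minimising
  \<open>q \<psi> = sup {2 \<psi> (f G) - K \<theta> (f\<^sup>2) | \<bar>f\<bar> \<le> 1}\<close> over convex
  combinations replaces weak compactness: uniform continuity with respect to \<open>\<theta>\<close> makes
  \<open>q\<close> almost uniformly convex.\<close>

lemma chull_small_on_interval:
  assumes \<phi>: "\<And>i. \<phi> i \<in> Dual" "\<And>f. f \<in> X \<Longrightarrow> (\<lambda>i::nat. \<phi> i f) \<longlonglongrightarrow> 0"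
    and G: "G \<in> Xp" and e: "0 < e"
  shows "\<exists>\<psi>\<in>chull \<phi> 0. amod \<psi> G \<le> e"
proof -
  let ?F = "chull \<phi> 0"
  note [measurable] = XpD(3)[OF G]
  have F: "null_fam ?F" by (rule null_fam_chull[OF \<phi>])
  have FD: "\<psi> \<in> Dual" if "\<psi> \<in> ?F" for \<psi> by (rule null_fam_Dual[OF F that])
  obtain C where C: "0 \<le> C" "\<And>\<psi>. \<psi> \<in> ?F \<Longrightarrow> amod \<psi> G \<le> C" using null_fam_bounded_at[OF F G] by blast
  \<comment> \<open>The final estimate is \<open>5 * \<tau> + 6 * (s * e1)\<close>. With
    \<open>e1 = e / 8\<close> and \<open>\<tau> \<le> s * e / 20\<close> the two terms are at most
    one quarter and three quarters of \<open>s * e\<close>.\<close>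
  define e1 where "e1 = e / 8"
  have e1: "0 < e1" using e by (simp add: e1_def)
  obtain I \<kappa> where I: "finite I" "I \<subseteq> ?F" and \<kappa>: "0 < \<kappa>" and unif:
    "\<And>B \<psi>. B \<in> sets M \<Longrightarrow> (\<Sum>l\<in>I. amod l (\<lambda>x. indicator B x * G x)) \<le> \<kappa> \<Longrightarrow> \<psi> \<in> ?F \<Longrightarrow>
      amod \<psi> (\<lambda>x. indicator B x * G x) \<le> e1"
    using null_fam_uniformly_continuous[OF F G e1] by blast
  define Bp :: "('a \<Rightarrow> real) set" where "Bp = {f \<in> borel_measurable M. (\<forall>x. 0 \<le> f x) \<and> (\<exists>c. \<forall>x. f x \<le> c)}"
  have BpX: "(\<lambda>x. f x * G x) \<in> Xp" if "f \<in> Bp" for f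
    using that unfolding Bp_def by (auto intro: mult_Xp[OF G])
  define \<theta> where "\<theta> f = (\<Sum>l\<in>I. amod l (\<lambda>x. f x * G x))" for f :: "'a \<Rightarrow> real"
  have ID: "l \<in> Dual" if "l \<in> I" for l using FD that I by blast
  have \<theta>_add: "\<theta> (\<lambda>x. f x + g x) = \<theta> f + \<theta> g" if "f \<in> Bp" "g \<in> Bp" for f g
    using amod_add[OF ID BpX[OF that(1)] BpX[OF that(2)]]
    by (simp add: \<theta>_def distrib_right sum.distrib[symmetric])
  have \<theta>_scale: "\<theta> (\<lambda>x. c * f x) = c * \<theta> f" if "f \<in> Bp" "0 \<le> c" for f c
    using amod_scale[OF ID BpX[OF that(1)] that(2)]
    by (simp add: \<theta>_def mult.assoc sum_distrib_left)
  have \<theta>_mono: "\<theta> f \<le> \<theta> g" if "f \<in> Bp" "g \<in> Bp" "\<And>x. f x \<le> g x" for f g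
    unfolding \<theta>_def
    by (intro sum_mono amod_mono[OF ID BpX[OF that(1)] BpX[OF that(2)]] AE_I2 mult_right_mono that(3) XpD(2)[OF G])
  have \<theta>_nn: "0 \<le> \<theta> f" if "f \<in> Bp" for f
    unfolding \<theta>_def by (intro sum_nonneg amod_nonneg[OF ID BpX[OF that]])
  define B1 :: "('a \<Rightarrow> real) set" where "B1 = {f \<in> borel_measurable M. \<forall>x. \<bar>f x\<bar> \<le> (1::real)}"
  have B1m: "f \<in> borel_measurable M" and B1le: "\<bar>f x\<bar> \<le> 1" if "f \<in> B1" for f x
    using that by (auto simp: B1_def)
  have sq: "(\<lambda>x. (f x)\<^sup>2) \<in> Bp" if "f \<in> B1" for f
  proof -
    have "(f x)\<^sup>2 \<le> 1" for x using B1le[OF that, of x] by (simp add: abs_square_le_1)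
    then show ?thesis using B1m[OF that] by (auto simp: Bp_def)
  qed
  have sub1: "(\<lambda>x. f x * G x) \<in> sub G" if "f \<in> B1" for f
    by (rule mult_sub[OF G]) (use that in \<open>auto simp: B1_def\<close>)
  have inX: "(\<lambda>x. f x * G x) \<in> X" if "f \<in> B1" for f by (rule sub_X[OF sub1[OF that] G])
  have le_C: "\<bar>\<psi> (\<lambda>x. f x * G x)\<bar> \<le> C" if "\<psi> \<in> ?F" "f \<in> B1" for \<psi> f
    using abs_le_amod[OF FD[OF that(1)] G sub1[OF that(2)]] C(2)[OF that(1)] by simp
  define T where "T = \<theta> (\<lambda>x. 1)"
  have one: "(\<lambda>x. 1) \<in> Bp" by (auto simp: Bp_def)
  have T: "0 \<le> T" unfolding T_def by (rule \<theta>_nn[OF one])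
  \<comment> \<open>A near maximiser \<open>f\<close> of \<open>val\<close> for a near minimal
    functional has \<open>\<theta>\<close> of its square at most \<open>(2 * C + 1) / K\<close>. As
    \<open>\<bar>f x\<bar>\<close> exceeds 1/2 on the set \<open>B\<close> below,
    \<open>\<theta>\<close> of its indicator is at most four times that, hence at most
    \<open>\<kappa>\<close>, and \<open>unif\<close> applies to \<open>B\<close>.\<close>
  define K where "K = 4 * (2 * C + 1) / \<kappa>"
  have K: "0 < K" "4 * (2 * C + 1) / K \<le> \<kappa>" using C(1) \<kappa> by (auto simp: K_def)
  \<comment> \<open>The size of the perturbation: the bound \<open>K * s * T \<le> e1\<close> keeps
    the quadratic term of a step \<open>s * g\<close> at most \<open>s * e1\<close>, the same order
    as the error of truncation.\<close>
  define s where "s = min (1/2) (e1 / (K * T + 1))"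
  have KT: "0 \<le> K * T" using K T by simp
  have s: "0 < s" "s \<le> 1/2"
    using KT e1 by (simp add: s_def) (unfold s_def, rule min.cobounded1)
  have sKT: "K * s * T \<le> e1"
  proof -
    have "s * (K * T) \<le> e1 / (K * T + 1) * (K * T)" by (rule mult_right_mono[OF _ KT]) (simp add: s_def)
    also have "\<dots> \<le> e1" using KT e1 by (simp add: field_simps)
    finally show ?thesis by (simp add: mult_ac)
  qed
  define \<tau> where "\<tau> = min 1 (s * e / 20)"
  have \<tau>: "0 < \<tau>" "\<tau> \<le> 1" "\<tau> \<le> s * e / 20" using s e by (auto simp: \<tau>_def)
  define val where "val \<psi> f = 2 * \<psi> (\<lambda>x. f x * G x) - K * \<theta> (\<lambda>x. (f x)\<^sup>2)"
    for \<psi> :: "('a \<Rightarrow> real) \<Rightarrow> real" and f :: "'a \<Rightarrow> real"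
  define q where "q \<psi> = (SUP f\<in>B1. val \<psi> f)" for \<psi>
  have zero1: "(\<lambda>x. 0) \<in> B1" by (simp add: B1_def)
  have val_le: "val \<psi> f \<le> 2 * C" if "\<psi> \<in> ?F" "f \<in> B1" for \<psi> f
    using le_C[OF that] mult_nonneg_nonneg[OF less_imp_le[OF K(1)] \<theta>_nn[OF sq[OF that(2)]]] by (simp add: val_def)
  have val_q: "val \<psi> f \<le> q \<psi>" if "\<psi> \<in> ?F" "f \<in> B1" for \<psi> f
    unfolding q_def by (rule cSUP_upper[OF that(2)]) (rule bdd_aboveI2, rule val_le[OF that(1)])
  have q_le: "q \<psi> \<le> 2 * C" if "\<psi> \<in> ?F" for \<psi>
    unfolding q_def by (rule cSUP_least) (use zero1 val_le[OF that] in auto)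
  have val0: "val \<psi> (\<lambda>x. 0) = 0" if "\<psi> \<in> ?F" for \<psi>
    using dual_zero[OF FD[OF that]] amod_zero[OF ID] by (simp add: val_def \<theta>_def)
  have q_nn: "0 \<le> q \<psi>" if "\<psi> \<in> ?F" for \<psi>
    using val_q[OF that zero1] val0[OF that] by simp
  have near: "\<exists>f\<in>B1. q \<psi> - \<tau> < val \<psi> f" for \<psi>
  proof (rule ccontr)
    assume "\<not> ?thesis"
    then have "q \<psi> \<le> q \<psi> - \<tau>" unfolding q_def[of \<psi>] by (intro cSUP_least) (use zero1 in auto)
    then show False using \<tau> by simp
  qed
  \<comment> \<open>The infima over shrinking tails increase and stay below \<open>2 * C\<close>, so
    they are constant up to \<open>\<tau>\<close> from some \<open>n\<close> on.\<close>
  define r where "r n = (INF u\<in>chull \<phi> n. q u)" for n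
  have sub0: "u \<in> ?F" if "u \<in> chull \<phi> n" for u n using chull_mono[OF that] by simp
  have ne: "\<phi> n \<in> chull \<phi> n" for n by (rule chull.base) simp
  have bb: "bdd_below (q ` chull \<phi> n)" for n by (rule bdd_belowI2[of _ 0]) (use q_nn sub0 in auto)
  have r_le: "r n \<le> q u" if "u \<in> chull \<phi> n" for n u
    unfolding r_def by (rule cINF_lower[OF bb that])
  have r_bd: "r n \<le> 2 * C" for n using r_le[OF ne] q_le[OF sub0[OF ne]] by (rule order.trans)
  have r_ex: "\<exists>u\<in>chull \<phi> n. q u < r n + \<tau>" for n
  proof (rule ccontr)
    assume "\<not> ?thesis"
    then have "r n + \<tau> \<le> r n" unfolding r_def[of n]
      using ne[of n] by (intro cINF_greatest) auto
    then show False using \<tau> by simp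
  qed
  have bdr: "bdd_above (range r)" by (rule bdd_aboveI2[OF r_bd])
  have r_nn: "0 \<le> r n" for n unfolding r_def
  proof (rule cINF_greatest)
    show "chull \<phi> n \<noteq> {}" using ne[of n] by blast
  qed (rule q_nn[OF sub0])
  obtain n where n: "(SUP n. r n) - \<tau> < r n"
    using less_cSUP_iff[OF _ bdr, of "(SUP n. r n) - \<tau>"] \<tau> by auto
  have r_stab: "r m \<le> r n + \<tau>" for m using cSUP_upper[OF _ bdr, of m] n by simp
  obtain u where u: "u \<in> chull \<phi> n" "q u < r n + \<tau>" using r_ex by blast
  have uF: "u \<in> ?F" by (rule sub0[OF u(1)])
  \<comment> \<open>The midpoint \<open>w\<close> of the near minimisers \<open>u\<close> and
    \<open>v\<close> satisfies \<open>r n \<le> q w\<close>. If \<open>u\<close> exceeded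
    \<open>v\<close> considerably at \<open>g\<close>, adding \<open>s * g\<close> to a truncated
    near maximiser for \<open>w\<close> when testing \<open>u\<close>, and subtracting it when
    testing \<open>v\<close>, would push \<open>q u + q v\<close> above
    \<open>2 * r n + 3 * \<tau>\<close>.\<close>
  have main: "\<exists>v\<in>chull \<phi> m. \<forall>g\<in>B1. u (\<lambda>x. g x * G x) \<le> v (\<lambda>x. g x * G x) + e / 2" if "n \<le> m" for m
  proof -
    obtain v where v: "v \<in> chull \<phi> m" "q v < r m + \<tau>" using r_ex by blast
    have vF: "v \<in> ?F" by (rule sub0[OF v(1)])
    define w where "w f = 1/2 * u f + (1 - 1/2) * v f" for f
    have wC: "w \<in> chull \<phi> n" unfolding w_def
      by (rule chull.mix[OF u(1) chull_mono[OF v(1) that]]) auto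
    have wF: "w \<in> ?F" by (rule sub0[OF wC])
    obtain f where f: "f \<in> B1" "q w - \<tau> < val w f" using near by blast
    have fq: "r n - \<tau> < val w f" using f(2) r_le[OF wC] by simp
    note [measurable] = B1m[OF f(1)]
    define B where "B = {x \<in> space M. 1 - s < \<bar>f x\<bar>}"
    have Bs [measurable]: "B \<in> sets M" unfolding B_def by measurable
    have "K * \<theta> (\<lambda>x. (f x)\<^sup>2) \<le> 2 * C + 1"
      using fq r_nn[of n] \<tau>(2) le_C[OF wF f(1)] by (simp add: val_def)
    then have \<theta>f: "\<theta> (\<lambda>x. (f x)\<^sup>2) \<le> (2 * C + 1) / K" using K(1) by (simp add: field_simps)
    have "(\<Sum>l\<in>I. amod l (\<lambda>x. indicator B x * G x)) = \<theta> (indicator B)" by (simp add: \<theta>_def)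
    also have "\<dots> \<le> \<theta> (\<lambda>x. 4 * (f x)\<^sup>2)"
    proof (rule \<theta>_mono)
      show "indicator B \<in> Bp" by (auto simp: Bp_def indicator_def intro!: exI[of _ 1])
      have "4 * (f x)\<^sup>2 \<le> 4" for x using B1le[OF f(1), of x] by (simp add: abs_square_le_1)
      then have "\<exists>c. \<forall>x. 4 * (f x)\<^sup>2 \<le> c" by blast
      then show "(\<lambda>x. 4 * (f x)\<^sup>2) \<in> Bp" by (simp add: Bp_def)
      fix x
      show "indicator B x \<le> 4 * (f x)\<^sup>2"
      proof (cases "x \<in> B")
        case True
        then have "1/2 \<le> \<bar>f x\<bar>" using s(2) by (simp add: B_def)
        then have "(1/2)\<^sup>2 \<le> \<bar>f x\<bar>\<^sup>2" by (intro power_mono) auto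
        then show ?thesis using True by (simp add: power2_eq_square)
      qed simp
    qed
    also have "\<dots> = 4 * \<theta> (\<lambda>x. (f x)\<^sup>2)" by (rule \<theta>_scale[OF sq[OF f(1)]]) simp
    also have "\<dots> \<le> 4 * ((2 * C + 1) / K)" by (rule mult_left_mono[OF \<theta>f]) simp
    also have "\<dots> \<le> \<kappa>" using K(2) by (simp only: times_divide_eq_right)
    finally have wB: "amod w (\<lambda>x. indicator B x * G x) \<le> e1" by (rule unif[OF Bs _ wF])
    \<comment> \<open>Truncation makes room for \<open>s * g\<close> of either sign inside
      \<open>B1\<close>. It alters \<open>f\<close> only on \<open>B\<close> and by at most
      \<open>s\<close>, and there the modulus of \<open>w\<close> is at most
      \<open>e1\<close>.\<close>
    define f1 where "f1 x = max (- (1 - s)) (min (1 - s) (f x))" for x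
    have f1m [measurable]: "f1 \<in> borel_measurable M" unfolding f1_def by measurable
    have f1b: "\<bar>f1 x\<bar> \<le> 1 - s" for x using s by (auto simp: f1_def)
    have f11: "f1 \<in> B1" using f1b s(1) by (auto simp: B1_def intro: order.trans[OF f1b])
    have val1: "val w f - 2 * s * e1 \<le> val w f1"
    proof -
      have BX: "(\<lambda>x. indicator B x * G x) \<in> Xp"
        by (rule mult_Xp[OF G, of _ 1]) (auto simp: indicator_def)
      have d: "\<bar>f x - f1 x\<bar> \<le> s * indicator B x" if "x \<in> space M" for x
        using B1le[OF f(1), of x] s that by (auto simp: f1_def B_def indicator_def min_def max_def split: if_splits)
      have eq: "(\<lambda>x. f x * G x - f1 x * G x) = (\<lambda>x. (f x - f1 x) * G x)" by (simp add: left_diff_distrib)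
      have "(\<lambda>x. (f x - f1 x) * G x) \<in> sub (\<lambda>x. s * (indicator B x * G x))"
        unfolding sub_def
      proof (clarsimp simp: abs_mult, intro conjI AE_I2)
        fix x assume "x \<in> space M"
        then have "\<bar>f x - f1 x\<bar> * \<bar>G x\<bar> \<le> (s * indicator B x) * \<bar>G x\<bar>" by (intro mult_right_mono d) auto
        then show "\<bar>f x - f1 x\<bar> * \<bar>G x\<bar> \<le> s * (indicator B x * G x)"
          using XpD(2)[OF G, of x] by (simp add: mult_ac)
      qed
      then have "w (\<lambda>x. (f x - f1 x) * G x) \<le> amod w (\<lambda>x. s * (indicator B x * G x))"
        using s by (intro amod_upper[OF FD[OF wF]] Xp_scale[OF BX]) auto
      also have "\<dots> = s * amod w (\<lambda>x. indicator B x * G x)"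
        by (rule amod_scale[OF FD[OF wF] BX]) (use s in simp)
      also have "\<dots> \<le> s * e1" using wB s by (intro mult_left_mono) auto
      finally have "w (\<lambda>x. f x * G x) - w (\<lambda>x. f1 x * G x) \<le> s * e1"
        using dual_diff[OF FD[OF wF] inX[OF f(1)] inX[OF f11]] eq by simp
      moreover have "\<theta> (\<lambda>x. (f1 x)\<^sup>2) \<le> \<theta> (\<lambda>x. (f x)\<^sup>2)"
      proof (rule \<theta>_mono[OF sq[OF f11] sq[OF f(1)]])
        fix x
        have "\<bar>f1 x\<bar> \<le> \<bar>f x\<bar>" using s by (auto simp: f1_def)
        then show "(f1 x)\<^sup>2 \<le> (f x)\<^sup>2" by (simp add: abs_le_square_iff)
      qed
      then have "K * \<theta> (\<lambda>x. (f1 x)\<^sup>2) \<le> K * \<theta> (\<lambda>x. (f x)\<^sup>2)" using K by simp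
      ultimately show ?thesis by (simp add: val_def)
    qed
    have "u (\<lambda>x. g x * G x) \<le> v (\<lambda>x. g x * G x) + e / 2" if g: "g \<in> B1" for g
    proof -
      note [measurable] = B1m[OF g]
      let ?g = "\<lambda>x. s * g x"
      have gb: "\<bar>s * g x\<bar> \<le> s" for x
        using B1le[OF g, of x] s(1) by (simp add: abs_mult)
      have pb: "\<bar>f1 x + s * g x\<bar> \<le> 1" "\<bar>f1 x - s * g x\<bar> \<le> 1" for x
        using f1b[of x] gb[of x] by linarith+
      have p1: "(\<lambda>x. f1 x + s * g x) \<in> B1" "(\<lambda>x. f1 x - s * g x) \<in> B1" using pb by (auto simp: B1_def)
      have sgb: "\<bar>s * g x\<bar> \<le> 1" for x using gb[of x] s by linarith
      have sg1: "?g \<in> B1" using sgb by (auto simp: B1_def)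
      have par: "\<theta> (\<lambda>x. (f1 x + s * g x)\<^sup>2) + \<theta> (\<lambda>x. (f1 x - s * g x)\<^sup>2)
          = 2 * \<theta> (\<lambda>x. (f1 x)\<^sup>2) + 2 * \<theta> (\<lambda>x. (s * g x)\<^sup>2)"
      proof -
        have "\<theta> (\<lambda>x. (f1 x + s * g x)\<^sup>2) + \<theta> (\<lambda>x. (f1 x - s * g x)\<^sup>2)
            = \<theta> (\<lambda>x. (f1 x + s * g x)\<^sup>2 + (f1 x - s * g x)\<^sup>2)"
          by (rule \<theta>_add[symmetric, OF sq[OF p1(1)] sq[OF p1(2)]])
        also have "(\<lambda>x. (f1 x + s * g x)\<^sup>2 + (f1 x - s * g x)\<^sup>2)
            = (\<lambda>x. ((f1 x)\<^sup>2 + (s * g x)\<^sup>2) + ((f1 x)\<^sup>2 + (s * g x)\<^sup>2))"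
          by (simp add: fun_eq_iff power2_eq_square algebra_simps)
        also have "\<theta> \<dots> = \<theta> (\<lambda>x. (f1 x)\<^sup>2 + (s * g x)\<^sup>2) + \<theta> (\<lambda>x. (f1 x)\<^sup>2 + (s * g x)\<^sup>2)"
        proof (rule \<theta>_add)
          have "(f1 x)\<^sup>2 + (s * g x)\<^sup>2 \<le> 2" for x
            using B1le[OF f11, of x] B1le[OF sg1, of x] abs_square_le_1[of "f1 x"] abs_square_le_1[of "s * g x"] by simp
          then have "\<exists>c. \<forall>x. (f1 x)\<^sup>2 + (s * g x)\<^sup>2 \<le> c" by blast
          then show "(\<lambda>x. (f1 x)\<^sup>2 + (s * g x)\<^sup>2) \<in> Bp" by (simp add: Bp_def)
          then show "(\<lambda>x. (f1 x)\<^sup>2 + (s * g x)\<^sup>2) \<in> Bp" .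
        qed
        also have "\<theta> (\<lambda>x. (f1 x)\<^sup>2 + (s * g x)\<^sup>2) = \<theta> (\<lambda>x. (f1 x)\<^sup>2) + \<theta> (\<lambda>x. (s * g x)\<^sup>2)"
          by (rule \<theta>_add[OF sq[OF f11] sq[OF sg1]])
        finally show ?thesis by simp
      qed
      have \<theta>g: "\<theta> (\<lambda>x. (s * g x)\<^sup>2) \<le> s\<^sup>2 * T"
      proof -
        have "\<theta> (\<lambda>x. (s * g x)\<^sup>2) = s\<^sup>2 * \<theta> (\<lambda>x. (g x)\<^sup>2)"
          unfolding power_mult_distrib by (rule \<theta>_scale[OF sq[OF g]]) simp
        also have "\<theta> (\<lambda>x. (g x)\<^sup>2) \<le> T" unfolding T_def
          by (rule \<theta>_mono[OF sq[OF g] one]) (use B1le[OF g] in \<open>simp add: abs_square_le_1\<close>)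
        finally show ?thesis by (simp add: mult_left_mono)
      qed
      have lin: "z (\<lambda>x. (f1 x + s * g x) * G x) = z (\<lambda>x. f1 x * G x) + s * z (\<lambda>x. g x * G x)"
        "z (\<lambda>x. (f1 x - s * g x) * G x) = z (\<lambda>x. f1 x * G x) - s * z (\<lambda>x. g x * G x)" if "z \<in> ?F" for z
        using dual_add[OF FD[OF that] inX[OF f11] X_scale[OF inX[OF g], of s]]
          dual_diff[OF FD[OF that] inX[OF f11] X_scale[OF inX[OF g], of s]]
          dual_scale[OF FD[OF that] inX[OF g], of s]
        by (simp_all add: distrib_right left_diff_distrib mult.assoc)
      have "val u (\<lambda>x. f1 x + s * g x) + val v (\<lambda>x. f1 x - s * g x) \<le> q u + q v"
        by (intro add_mono val_q uF vF p1)
      moreover have "val u (\<lambda>x. f1 x + s * g x) + val v (\<lambda>x. f1 x - s * g x)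
         = 2 * val w f1 + 2 * s * (u (\<lambda>x. g x * G x) - v (\<lambda>x. g x * G x)) - 2 * (K * \<theta> (\<lambda>x. (s * g x)\<^sup>2))"
      proof -
        have "val u (\<lambda>x. f1 x + s * g x) + val v (\<lambda>x. f1 x - s * g x) =
           2 * (u (\<lambda>x. f1 x * G x) + s * u (\<lambda>x. g x * G x)) + 2 * (v (\<lambda>x. f1 x * G x) - s * v (\<lambda>x. g x * G x))
            - K * (\<theta> (\<lambda>x. (f1 x + s * g x)\<^sup>2) + \<theta> (\<lambda>x. (f1 x - s * g x)\<^sup>2))"
          unfolding val_def lin[OF uF] lin[OF vF] by (simp add: algebra_simps)
        then show ?thesis unfolding par by (simp add: val_def w_def algebra_simps)
      qed
      moreover have "q u + q v < 2 * r n + 3 * \<tau>" using u(2) v(2) r_stab[of m] by simp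
      moreover have "K * \<theta> (\<lambda>x. (s * g x)\<^sup>2) \<le> K * (s\<^sup>2 * T)" using \<theta>g K by simp
      moreover have "K * (s\<^sup>2 * T) \<le> s * e1"
        using mult_left_mono[OF sKT, of s] s by (simp add: power2_eq_square mult_ac)
      ultimately have "2 * (s * (u (\<lambda>x. g x * G x) - v (\<lambda>x. g x * G x))) \<le> 5 * \<tau> + 6 * (s * e1)"
        using val1 fq by (simp add: algebra_simps)
      also have "\<dots> \<le> 2 * (s * (e / 2))" using \<tau>(3) by (simp add: e1_def field_simps)
      finally have "s * (u (\<lambda>x. g x * G x) - v (\<lambda>x. g x * G x)) \<le> s * (e / 2)" by simp
      then show ?thesis using s(1) by (simp add: mult_le_cancel_left)
    qed
    then show ?thesis using v(1) by blast
  qed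
  have "amod u G \<le> e"
  proof (rule amod_approx_mult[OF FD[OF uF] G])
    fix g :: "'a \<Rightarrow> real" assume "g \<in> borel_measurable M" "\<And>x. \<bar>g x\<bar> \<le> 1"
    then have g: "g \<in> B1" by (simp add: B1_def)
    have "(\<lambda>i. \<bar>\<phi> i (\<lambda>x. g x * G x)\<bar>) \<longlonglongrightarrow> \<bar>0\<bar>" by (intro tendsto_rabs \<phi>(2) inX[OF g])
    then have "\<forall>\<^sub>F i in sequentially. \<bar>\<phi> i (\<lambda>x. g x * G x)\<bar> < e / 2"
      by (rule order_tendstoD) (use e in simp)
    then obtain m where m: "\<And>i. m \<le> i \<Longrightarrow> \<bar>\<phi> i (\<lambda>x. g x * G x)\<bar> < e / 2"
      by (auto simp: eventually_sequentially)
    \<comment> \<open>\<open>u\<close> was fixed before \<open>g\<close>; only the tail from which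
      \<open>v\<close> is taken depends on \<open>g\<close>.\<close>
    obtain v where v: "v \<in> chull \<phi> (max n m)" "u (\<lambda>x. g x * G x) \<le> v (\<lambda>x. g x * G x) + e / 2"
      using main[of "max n m"] g by auto
    have "\<bar>v (\<lambda>x. g x * G x)\<bar> \<le> e / 2"
      by (rule chull_abs_le[OF v(1)]) (use m in \<open>auto intro: less_imp_le\<close>)
    then show "u (\<lambda>x. g x * G x) \<le> e" using v(2) by linarith
  qed
  then show ?thesis using uF by blast
qed

end

subsection \<open>Convex combinations on the unit ball\<close>

context level_space begin

section \<open>Restriction to sets of dyadic levels\<close>

definition lres :: "('a \<Rightarrow> real) \<Rightarrow> int set \<Rightarrow> 'a \<Rightarrow> real" where
  "lres f K x = (if f x \<noteq> 0 \<and> lvl (f x) \<in> K then \<bar>f x\<bar> else 0)"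

lemma lres_meas [measurable (raw)]: "f \<in> borel_measurable M \<Longrightarrow> lres f K \<in> borel_measurable M"
proof -
  assume [measurable]: "f \<in> borel_measurable M"
  have "(\<lambda>x. if lvl (f x) \<in> K then \<bar>f x\<bar> else 0) \<in> borel_measurable M"
    by measurable
  also have "(\<lambda>x. if lvl (f x) \<in> K then \<bar>f x\<bar> else 0) = lres f K"
    by (auto simp: lres_def)
  finally show ?thesis .
qed

lemma lres_nonneg: "0 \<le> lres f K x" and lres_le: "lres f K x \<le> \<bar>f x\<bar>"
  by (auto simp: lres_def)

lemma lev_lres: "lev M (lres f K) k = (if k \<in> K then lev M f k else {})"
  by (auto simp: lev_def lres_def)

lemma lres_level: "f \<in> S J \<Longrightarrow> lres f K \<in> S J"
  by (rule level_subset) (auto simp: lev_lres level_meas lres_meas)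

lemma lres_Xp: "f \<in> X \<Longrightarrow> lres f K \<in> Xp"
  by (rule Xp_solid[of "\<lambda>x. \<bar>f x\<bar>"]) (auto simp: X_abs X_meas lres_meas lres_nonneg lres_le)

lemma zero_level: "(\<lambda>x. 0) \<in> S J"
  by (simp add: level_ball_def lev_def)

text \<open>Bounded overlap takes the place of summability: for each level at most \<open>q\<close>
  of the functions contribute to the supremum, and at each point at most \<open>q\<close> terms of
  the sum have that level, so \<open>sum_le_by_levels\<close> compares sum and supremum.\<close>

lemma lres_sup:
  assumes f: "\<And>j::nat. f j \<in> S 1" and K: "\<And>k. finite {j. k \<in> K j}" "\<And>k. card {j. k \<in> K j} \<le> q"
  shows "\<exists>H\<in>S (real q). (\<forall>x. 0 \<le> H x) \<and> (\<forall>n. AE x in M. (\<Sum>j<n. lres (f j) (K j) x) \<le> 4 * real q * H x)"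
proof -
  define g where "g j = lres (f j) (K j)" for j
  have gm: "g j \<in> borel_measurable M" for j
    unfolding g_def by (rule lres_meas[OF level_meas[OF f]])
  have "(\<Sum>j. emeasure M (lev M (g j) k)) \<le> ennreal (real q) * D k" for k
  proof -
    have "(\<Sum>j. emeasure M (lev M (g j) k)) = (\<Sum>j\<in>{j. k \<in> K j}. emeasure M (lev M (g j) k))"
      by (rule suminf_finite[OF K(1)]) (simp add: g_def lev_lres)
    also have "\<dots> \<le> (\<Sum>j\<in>{j. k \<in> K j}. D k)"
      using f by (intro sum_mono) (auto simp: g_def lev_lres level_ball_def)
    also have "\<dots> = of_nat (card {j. k \<in> K j}) * D k" by simp
    also have "\<dots> \<le> of_nat q * D k" using K(2)[of k] by (intro mult_right_mono) auto
    finally show ?thesis by (simp add: ennreal_of_nat_eq_real_of_nat)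
  qed
  then obtain H where H: "H \<in> S (real q)" "\<And>x. 0 \<le> H x" "AE x in M. \<forall>j. \<bar>g j x\<bar> \<le> H x"
    using sup_level[of g, OF gm, of "real q"] by auto
  from H(3) have "AE x in M. \<forall>n. (\<Sum>j<n. g j x) \<le> 4 * real q * H x"
  proof eventually_elim
    case (elim x)
    show ?case
    proof
      fix n
      show "(\<Sum>j<n. g j x) \<le> 4 * real q * H x"
      proof (rule sum_le_by_levels)
        fix k
        have "{j \<in> {..<n}. g j x \<noteq> 0 \<and> lvl (g j x) = k} \<subseteq> {j. k \<in> K j}"
          by (auto simp: g_def lres_def split: if_splits)
        from card_mono[OF K(1) this] K(2)[of k]
        show "card {j \<in> {..<n}. g j x \<noteq> 0 \<and> lvl (g j x) = k} \<le> q" by simp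
      next
        fix j
        show "0 \<le> g j x" by (simp add: g_def lres_nonneg)
        show "g j x \<le> H x" using elim[rule_format, of j] by simp
      qed (use H(2) in auto)
    qed
  qed
  then show ?thesis using H(1,2) by (auto simp: g_def AE_all_countable)
qed

text \<open>In \<open>K\<close> this is a submeasure, in general not additive because different sets
  may call for different \<open>f\<close>. This is why the Vitali-Hahn-Saks argument is set up for
  subadditive functions.\<close>

definition lnorm :: "(('a \<Rightarrow> real) \<Rightarrow> real) \<Rightarrow> int set \<Rightarrow> real" where
  "lnorm \<psi> K = (SUP f\<in>S 1. amod \<psi> (lres f K))"

lemma level_X1: "f \<in> S 1 \<Longrightarrow> f \<in> X"
  by (rule level_X) auto

lemma lnorm_bdd: "\<psi> \<in> Dual \<Longrightarrow> bdd_above ((\<lambda>f. amod \<psi> (lres f K)) ` S 1)"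
proof -
  assume \<psi>: "\<psi> \<in> Dual"
  obtain C where C: "0 \<le> C" "\<And>h. h \<in> Xp \<Longrightarrow> amod \<psi> h \<le> C * N h" using amod_bound[OF \<psi>] by blast
  obtain C' where C': "\<And>J f. 0 \<le> J \<Longrightarrow> f \<in> S J \<Longrightarrow> N f \<le> C' + J"
    using level_bound by blast
  show ?thesis
  proof (rule bdd_aboveI2)
    fix f assume f: "f \<in> S 1"
    have "amod \<psi> (lres f K) \<le> C * N (lres f K)" by (rule C(2)[OF lres_Xp[OF level_X1[OF f]]])
    also have "\<dots> \<le> C * (C' + 1)" by (intro mult_left_mono C' lres_level f C(1)) auto
    finally show "amod \<psi> (lres f K) \<le> C * (C' + 1)" .
  qed
qed

lemma lnorm_upper: "\<psi> \<in> Dual \<Longrightarrow> f \<in> S 1 \<Longrightarrow> amod \<psi> (lres f K) \<le> lnorm \<psi> K"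
  unfolding lnorm_def by (rule cSUP_upper[OF _ lnorm_bdd])

lemma lnorm_least: "(\<And>f. f \<in> S 1 \<Longrightarrow> amod \<psi> (lres f K) \<le> c) \<Longrightarrow> lnorm \<psi> K \<le> c"
  unfolding lnorm_def by (rule cSUP_least) (use zero_level in auto)

lemma lnorm_nonneg: "\<psi> \<in> Dual \<Longrightarrow> 0 \<le> lnorm \<psi> K"
  using lnorm_upper[OF _ zero_level] amod_nonneg[OF _ lres_Xp[OF X_zero]] by (meson order.trans)

lemma lnorm_approx:
  assumes \<psi>: "\<psi> \<in> Dual" shows "\<exists>f\<in>S 1. lnorm \<psi> K \<le> 2 * amod \<psi> (lres f K)"
proof (cases "lnorm \<psi> K = 0")
  case True
  then show ?thesis using zero_level amod_nonneg[OF \<psi> lres_Xp[OF X_zero], of K] by (intro bexI[of _ "\<lambda>x. 0"]) auto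
next
  case False
  then have pos: "0 < lnorm \<psi> K" using lnorm_nonneg[OF \<psi>, of K] by simp
  show ?thesis
  proof (rule ccontr)
    assume no: "\<not> ?thesis"
    have "lnorm \<psi> K \<le> lnorm \<psi> K / 2"
    proof (rule lnorm_least)
      fix f assume "f \<in> S 1"
      then show "amod \<psi> (lres f K) \<le> lnorm \<psi> K / 2" using no by fastforce
    qed
    then show False using pos by simp
  qed
qed

text \<open>Disjoint sets of levels have overlap 1, so near maximisers restricted to them have
  partial sums bounded in the space, and exhaustivity comes from \<open>null_fam\<close>.\<close>

lemma lnorm_uniformly_continuous:
  assumes F: "null_fam F" and e: "0 < e"
  shows "\<exists>I \<kappa>. finite I \<and> I \<subseteq> F \<and> 0 < \<kappa> \<and>
    (\<forall>K\<in>UNIV. (\<Sum>l\<in>I. lnorm l K) \<le> \<kappa> \<longrightarrow> (\<forall>\<psi>\<in>F. lnorm \<psi> K \<le> e))"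
proof (rule uniformly_exhaustive_imp_uniformly_continuous[OF _ _ _ _ _ e])
  show "ring_of_sets (UNIV :: int set) UNIV"
    using algebra.axioms(1) sigma_algebra.axioms(1) sigma_algebra_Pow[of "UNIV :: int set"] by (metis Pow_UNIV)
next
  fix \<psi> and A B :: "int set" assume "\<psi> \<in> F"
  then have \<psi>: "\<psi> \<in> Dual" by (rule null_fam_Dual[OF F])
  show "lnorm \<psi> A \<le> lnorm \<psi> B" if "A \<subseteq> B"
  proof (rule lnorm_least)
    fix f assume f: "f \<in> S 1"
    have "amod \<psi> (lres f A) \<le> amod \<psi> (lres f B)"
      by (rule amod_mono[OF \<psi> lres_Xp lres_Xp]) (use level_X1[OF f] that in \<open>auto simp: lres_def\<close>)
    also have "\<dots> \<le> lnorm \<psi> B" by (rule lnorm_upper[OF \<psi> f])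
    finally show "amod \<psi> (lres f A) \<le> lnorm \<psi> B" .
  qed
  show "lnorm \<psi> (A \<union> B) \<le> lnorm \<psi> A + lnorm \<psi> B"
  proof (rule lnorm_least)
    fix f assume f: "f \<in> S 1"
    note fX = level_X1[OF f]
    have "amod \<psi> (lres f (A \<union> B)) \<le> amod \<psi> (\<lambda>x. lres f A x + lres f B x)"
      by (rule amod_mono[OF \<psi> lres_Xp Xp_add[OF lres_Xp lres_Xp]]) (use fX in \<open>auto simp: lres_def\<close>)
    also have "\<dots> = amod \<psi> (lres f A) + amod \<psi> (lres f B)"
      by (rule amod_add[OF \<psi> lres_Xp[OF fX] lres_Xp[OF fX]])
    also have "\<dots> \<le> lnorm \<psi> A + lnorm \<psi> B" by (intro add_mono lnorm_upper[OF \<psi> f])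
    finally show "amod \<psi> (lres f (A \<union> B)) \<le> lnorm \<psi> A + lnorm \<psi> B" .
  qed
next
  fix \<psi> assume "\<psi> \<in> F"
  then have \<psi>: "\<psi> \<in> Dual" by (rule null_fam_Dual[OF F])
  have "lnorm \<psi> {} \<le> 0" by (rule lnorm_least) (simp add: lres_def[abs_def] amod_zero[OF \<psi>])
  then show "lnorm \<psi> {} = 0" using lnorm_nonneg[OF \<psi>, of "{}"] by simp
next
  fix \<psi> :: "nat \<Rightarrow> ('a \<Rightarrow> real) \<Rightarrow> real" and E :: "nat \<Rightarrow> int set"
  assume \<psi>: "\<And>n. \<psi> n \<in> F" and E: "disjoint_family E"
  note \<psi>D = null_fam_Dual[OF F \<psi>]
  have "\<forall>n. \<exists>f\<in>S 1. lnorm (\<psi> n) (E n) \<le> 2 * amod (\<psi> n) (lres f (E n))"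
    using lnorm_approx[OF \<psi>D] by blast
  then obtain f where f: "\<And>n. f n \<in> S 1" "\<And>n. lnorm (\<psi> n) (E n) \<le> 2 * amod (\<psi> n) (lres (f n) (E n))"
    by metis
  have sub: "\<exists>i. {j. k \<in> E j} \<subseteq> {i}" for k
    using E unfolding disjoint_family_on_def by (cases "\<exists>i. k \<in> E i") blast+
  have fin: "finite {j. k \<in> E j}" and cd: "card {j. k \<in> E j} \<le> 1" for k
    using sub[of k] by (blast intro: finite_subset, metis card.empty card_insert_disjoint card_mono empty_iff finite.emptyI finite.insertI One_nat_def)
  obtain H where H: "H \<in> S (real 1)" "\<And>n. AE x in M. (\<Sum>j<n. lres (f j) (E j) x) \<le> 4 * real 1 * H x"
    using lres_sup[of f, OF f(1) fin cd] by blast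
  have "(\<lambda>n. amod (\<psi> n) (lres (f n) (E n))) \<longlonglongrightarrow> 0"
  proof (rule null_famD[OF F \<psi> _ _ _ H(2)])
    show "(\<lambda>x. 4 * real 1 * H x) \<in> X" by (rule X_scale) (use level_X1 H(1) in simp)
  qed (auto intro!: lres_meas level_meas[OF f(1)] lres_nonneg)
  then have "(\<lambda>n. 2 * amod (\<psi> n) (lres (f n) (E n))) \<longlonglongrightarrow> 2 * 0" by (intro tendsto_mult tendsto_const)
  then have l: "(\<lambda>n. 2 * amod (\<psi> n) (lres (f n) (E n))) \<longlonglongrightarrow> 0" by simp
  show "(\<lambda>n. lnorm (\<psi> n) (E n)) \<longlonglongrightarrow> 0"
  proof (rule tendsto_sandwich[OF _ _ tendsto_const l])
    show "\<forall>\<^sub>F n in sequentially. 0 \<le> lnorm (\<psi> n) (E n)"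
      by (rule always_eventually, rule allI, rule lnorm_nonneg[OF \<psi>D])
    show "\<forall>\<^sub>F n in sequentially. lnorm (\<psi> n) (E n) \<le> 2 * amod (\<psi> n) (lres (f n) (E n))"
      by (rule always_eventually, rule allI, rule f(2))
  qed
qed

text \<open>Near maximisers restricted to their \<open>K b\<close> add up to at most
  \<open>4 * q * H\<close> with \<open>H\<close> in \<open>S q\<close>. The modulus of a single
  functional is additive and bounded, so the resulting bound depends neither on \<open>R\<close> nor
  on the sets.\<close>

lemma lnorm_sum_le:
  assumes \<psi>: "\<psi> \<in> Dual"
  shows "\<exists>C. \<forall>(R::nat) K. (\<forall>k. card {b. b < R \<and> k \<in> K b} \<le> q) \<longrightarrow> (\<Sum>b<R. lnorm \<psi> (K b)) \<le> C"
proof -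
  obtain C where C: "0 \<le> C" "\<And>h. h \<in> Xp \<Longrightarrow> amod \<psi> h \<le> C * N h" using amod_bound[OF \<psi>] by blast
  obtain C' where C': "\<And>J f. 0 \<le> J \<Longrightarrow> f \<in> S J \<Longrightarrow> N f \<le> C' + J"
    using level_bound by blast
  have "(\<Sum>b<R. lnorm \<psi> (K b)) \<le> 2 * (4 * real q * (C * (C' + real q)))"
    if K: "\<forall>k. card {b. b < R \<and> k \<in> K b} \<le> q" for R :: nat and K :: "nat \<Rightarrow> int set"
  proof -
    have "\<forall>b. \<exists>f\<in>S 1. lnorm \<psi> (K b) \<le> 2 * amod \<psi> (lres f (K b))"
      using lnorm_approx[OF \<psi>] by blast
    then obtain f where f: "\<And>b. f b \<in> S 1" "\<And>b. lnorm \<psi> (K b) \<le> 2 * amod \<psi> (lres (f b) (K b))"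
      by metis
    define K' where "K' b = (if b < R then K b else {})" for b
    have eq: "{b. k \<in> K' b} = {b. b < R \<and> k \<in> K b}" for k by (auto simp: K'_def)
    obtain H where H: "H \<in> S (real q)" "\<And>x. 0 \<le> H x"
      "\<And>n. AE x in M. (\<Sum>j<n. lres (f j) (K' j) x) \<le> 4 * real q * H x"
      using lres_sup[of f K' q] f(1) K unfolding eq by auto
    have HX: "H \<in> Xp" using H level_X[OF _ H(1)] by (simp add: Xp_def)
    have "(\<Sum>b<R. lnorm \<psi> (K b)) \<le> (\<Sum>b<R. 2 * amod \<psi> (lres (f b) (K' b)))"
      using f(2) by (intro sum_mono) (simp add: K'_def)
    also have "\<dots> = 2 * amod \<psi> (\<lambda>x. \<Sum>b<R. lres (f b) (K' b) x)"
      by (subst amod_sum[OF \<psi>]) (auto simp: sum_distrib_left intro: lres_Xp level_X1 f)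
    also have "amod \<psi> (\<lambda>x. \<Sum>b<R. lres (f b) (K' b) x) \<le> amod \<psi> (\<lambda>x. 4 * real q * H x)"
      by (rule amod_mono[OF \<psi> Xp_sum Xp_scale[OF HX] H(3)]) (auto intro: lres_Xp level_X1 f)
    also have "\<dots> = 4 * real q * amod \<psi> H" by (rule amod_scale[OF \<psi> HX]) simp
    also have "amod \<psi> H \<le> C * N H" by (rule C(2)[OF HX])
    also have "\<dots> \<le> C * (C' + real q)" by (intro mult_left_mono C' H C(1)) simp
    finally show ?thesis by (simp add: mult_left_mono)
  qed
  then show ?thesis by blast
qed

text \<open>A heavy \<open>b\<close> makes the control sum over \<open>I\<close> exceed
  \<open>\<kappa>\<close> at \<open>K b\<close>, and by \<open>lnorm_sum_le\<close> these control
  sums have a bounded total. What matters is that \<open>Q\<close> is fixed before \<open>R\<close>,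
  the functionals and the sets of levels.\<close>

lemma few_heavy:
  assumes F: "null_fam F" and e: "0 < e"
  shows "\<exists>Q\<ge>0. \<forall>(R::nat) \<psi> K. (\<forall>b. \<psi> b \<in> F) \<longrightarrow> (\<forall>k. card {b. b < R \<and> k \<in> K b} \<le> q) \<longrightarrow>
    real (card {b. b < R \<and> e < lnorm (\<psi> b) (K b)}) \<le> Q"
proof -
  obtain I \<kappa> where I: "finite I" "I \<subseteq> F" and \<kappa>: "0 < \<kappa>" and unif:
    "\<And>K \<psi>. (\<Sum>l\<in>I. lnorm l K) \<le> \<kappa> \<Longrightarrow> \<psi> \<in> F \<Longrightarrow> lnorm \<psi> K \<le> e"
    using lnorm_uniformly_continuous[OF F e] by blast
  have ID: "l \<in> Dual" if "l \<in> I" for l using null_fam_Dual[OF F] I that by blast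
  define P where "P l c \<longleftrightarrow> (\<forall>(R::nat) K. (\<forall>k. card {b. b < R \<and> k \<in> K b} \<le> q) \<longrightarrow>
      (\<Sum>b<R. lnorm l (K b)) \<le> c)" for l c
  have "\<forall>l\<in>I. \<exists>c. P l c" unfolding P_def using lnorm_sum_le[OF ID] by blast
  then obtain C where "\<forall>l\<in>I. P l (C l)" by metis
  then have C: "(\<Sum>b<R. lnorm l (K b)) \<le> C l"
    if "l \<in> I" "\<forall>k. card {b. b < R \<and> k \<in> K b} \<le> q" for l and R :: nat and K
    using that unfolding P_def by blast
  have "real (card {b. b < R \<and> e < lnorm (\<psi> b) (K b)}) \<le> (\<Sum>l\<in>I. C l) / \<kappa>"
    if \<psi>: "\<And>b. \<psi> b \<in> F" and K: "\<forall>k. card {b. b < R \<and> k \<in> K b} \<le> q"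
    for R :: nat and \<psi> :: "nat \<Rightarrow> ('a \<Rightarrow> real) \<Rightarrow> real" and K :: "nat \<Rightarrow> int set"
  proof -
    let ?B = "{b. b < R \<and> e < lnorm (\<psi> b) (K b)}"
    have "real (card ?B) * \<kappa> \<le> (\<Sum>b\<in>?B. \<Sum>l\<in>I. lnorm l (K b))"
    proof (rule sum_bounded_below)
      fix b assume "b \<in> ?B"
      then show "\<kappa> \<le> (\<Sum>l\<in>I. lnorm l (K b))" using unif[OF _ \<psi>, of "K b" b] by force
    qed
    also have "\<dots> \<le> (\<Sum>b<R. \<Sum>l\<in>I. lnorm l (K b))"
      by (rule sum_mono2) (auto intro!: sum_nonneg lnorm_nonneg ID)
    also have "\<dots> = (\<Sum>l\<in>I. \<Sum>b<R. lnorm l (K b))" by (rule sum.swap)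
    also have "\<dots> \<le> (\<Sum>l\<in>I. C l)" by (rule sum_mono, rule C[OF _ K])
    finally show ?thesis using \<kappa> by (simp add: field_simps)
  qed
  then have "real (card {b. b < R \<and> e < lnorm (\<psi> b) (K b)}) \<le> max 0 ((\<Sum>l\<in>I. C l) / \<kappa>)"
    if "\<And>b. \<psi> b \<in> F" "\<forall>k. card {b. b < R \<and> k \<in> K b} \<le> q"
    for R :: nat and \<psi> :: "nat \<Rightarrow> ('a \<Rightarrow> real) \<Rightarrow> real" and K :: "nat \<Rightarrow> int set"
    using that by (simp add: le_max_iff_disj)
  then show ?thesis by (intro exI[of _ "max 0 ((\<Sum>l\<in>I. C l) / \<kappa>)"]) auto
qed

lemma few_large_pieces:
  fixes R :: nat
  assumes f: "f \<in> S 1" and t: "\<And>b. t b \<in> borel_measurable M"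
    and sub: "\<And>b k. lev M (t b) k \<subseteq> lev M f k" and disj: "\<And>k. disjoint_family (\<lambda>b. lev M (t b) k)"
  shows "card {b. b < R \<and> ennreal ((1/2)^n) * D k < emeasure M (lev M (t b) k)} \<le> 2^n"
proof -
  let ?B = "{b. b < R \<and> ennreal ((1/2)^n) * D k < emeasure M (lev M (t b) k)}"
  have fin: "finite ?B" by simp
  have tm: "lev M (t b) k \<in> sets M" for b by (rule lev_sets[OF t])
  have fm: "lev M f k \<in> sets M" by (rule lev_sets[OF level_meas[OF f]])
  have "(\<Sum>b\<in>?B. emeasure M (lev M (t b) k)) = emeasure M (\<Union>b\<in>?B. lev M (t b) k)"
    by (rule sum_emeasure) (use tm disj in \<open>auto simp: disjoint_family_on_def\<close>)
  also have "\<dots> \<le> emeasure M (lev M f k)" by (rule emeasure_mono[OF _ fm]) (use sub in blast)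
  also have "\<dots> \<le> D k" using f by (simp add: level_ball_def)
  finally have le: "(\<Sum>b\<in>?B. emeasure M (lev M (t b) k)) \<le> D k" .
  show ?thesis
  proof (cases "?B = {}")
    case False
    then obtain b where b: "b \<in> ?B" by blast
    have "emeasure M (lev M (t b) k) \<le> (\<Sum>b\<in>?B. emeasure M (lev M (t b) k))"
      by (rule member_le_sum[OF b]) auto
    then have "emeasure M (lev M (t b) k) \<le> D k" using le by simp
    then have "ennreal ((1/2)^n) * D k < D k" using b by auto
    \<comment> \<open>The strict inequality excludes both extremes, so it is legitimate to divide by
      \<open>D k\<close>.\<close>
    then have "D k \<noteq> 0" "D k \<noteq> \<infinity>" by (auto simp: ennreal_mult_top power_divide)
    then obtain d where d: "D k = ennreal d" "0 < d"
      by (cases "D k") (auto simp: less_le)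
    have "(\<Sum>b\<in>?B. ennreal ((1/2)^n) * D k) \<le> (\<Sum>b\<in>?B. emeasure M (lev M (t b) k))"
      by (rule sum_mono) (auto intro: less_imp_le)
    then have "(\<Sum>b\<in>?B. ennreal ((1/2)^n) * D k) \<le> D k" using le by simp
    then have "ennreal (real (card ?B) * ((1/2)^n * d)) \<le> ennreal d"
      using d by (simp add: ennreal_mult''[symmetric] ennreal_of_nat_eq_real_of_nat mult.assoc)
    then have "real (card ?B) * ((1/2)^n * d) \<le> 1 * d" using d by (simp add: ennreal_le_iff)
    then have "real (card ?B) * (1/2)^n \<le> 1" using d by (simp add: mult.assoc[symmetric])
    then have "real (card ?B) \<le> real (2^n)" by (simp add: power_divide field_simps)
    then show ?thesis by (simp only: of_nat_le_iff)
  next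
    case True
    show ?thesis unfolding True by simp
  qed
qed

theorem chull_small:
  assumes \<phi>: "\<And>i. \<phi> i \<in> Dual" "\<And>f. f \<in> X \<Longrightarrow> (\<lambda>i::nat. \<phi> i f) \<longlonglongrightarrow> 0" and e: "0 < e"
  shows "\<exists>\<psi>\<in>chull \<phi> 0. \<forall>f\<in>S 1. \<bar>\<psi> f\<bar> \<le> e"
proof -
  let ?F = "chull \<phi> 0"
  have F: "null_fam ?F" by (rule null_fam_chull[OF \<phi>])
  \<comment> \<open>Each of the four parts of the decomposition along a band costs \<open>d\<close>;
    the heavy bands together cost another \<open>d\<close> after averaging.\<close>
  define d where "d = e / 5"
  have d: "0 < d" using e by (simp add: d_def)
  obtain C where C: "0 \<le> C" "\<And>\<psi> f. \<psi> \<in> ?F \<Longrightarrow> f \<in> S 1 \<Longrightarrow> amod \<psi> (\<lambda>x. \<bar>f x\<bar>) \<le> C"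
    using null_fam_bounded[OF F] by blast
  obtain n G0 where G0: "G0 \<in> Xp"
    "\<And>\<psi> f. \<psi> \<in> ?F \<Longrightarrow> f \<in> S ((1/2)^n) \<Longrightarrow> amod \<psi> (cut f G0) \<le> d"
    using small_level_dominated[OF F d] by blast
  obtain Q where Q0: "0 \<le> Q" and Q: "\<forall>(R::nat) \<psi> K. (\<forall>b. \<psi> b \<in> ?F) \<longrightarrow>
      (\<forall>k. card {b. b < R \<and> k \<in> K b} \<le> 2^n) \<longrightarrow> real (card {b. b < R \<and> d < lnorm (\<psi> b) (K b)}) \<le> Q"
    using few_heavy[OF F d, of "2^n"] by blast
  have "\<forall>G. \<exists>\<psi>. G \<in> Xp \<longrightarrow> \<psi> \<in> ?F \<and> amod \<psi> (\<lambda>x. 2 * G x) \<le> d"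
  proof
    fix G
    show "\<exists>\<psi>. G \<in> Xp \<longrightarrow> \<psi> \<in> ?F \<and> amod \<psi> (\<lambda>x. 2 * G x) \<le> d"
    proof (cases "G \<in> Xp")
      case True
      then have "(\<lambda>x. 2 * G x) \<in> Xp" by (intro Xp_scale) auto
      from chull_small_on_interval[OF \<phi> this d] show ?thesis by blast
    qed simp
  qed
  then obtain \<Psi> where \<Psi>: "\<And>G. G \<in> Xp \<Longrightarrow> \<Psi> G \<in> ?F" "\<And>G. G \<in> Xp \<Longrightarrow> amod (\<Psi> G) (\<lambda>x. 2 * G x) \<le> d"
    by metis
  have "\<exists>G'. G' \<in> Xp \<and> (\<forall>x. G x \<le> G' x) \<and> (\<forall>f\<in>S 1. amod (\<Psi> G) (cut f G') \<le> d)" if G: "G \<in> Xp" for G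
  proof -
    have \<Psi>D: "\<Psi> G \<in> Dual" by (rule null_fam_Dual[OF F \<Psi>(1)[OF G]])
    obtain G1 where G1: "G1 \<in> Xp" "\<And>f. f \<in> S 1 \<Longrightarrow> amod (\<Psi> G) (cut f G1) \<le> d"
      using functional_dominated[OF \<Psi>D d] by blast
    have G1X: "G1 \<in> X" using G1(1) by (simp add: Xp_def)
    let ?G' = "\<lambda>x. max (G x) \<bar>G1 x\<bar>"
    have G': "?G' \<in> Xp" by (rule Xp_max[OF G G1X])
    have "amod (\<Psi> G) (cut f ?G') \<le> d" if f: "f \<in> S 1" for f
    proof -
      have "amod (\<Psi> G) (cut f ?G') \<le> amod (\<Psi> G) (cut f G1)"
        by (rule amod_mono[OF \<Psi>D cut_Xp[OF level_X1[OF f] G'] cut_Xp[OF level_X1[OF f] G1(1)]])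
          (auto simp: cut_def)
      then show ?thesis using G1(2)[OF f] by simp
    qed
    then show ?thesis using G' by (intro exI[of _ ?G']) auto
  qed
  then have "\<forall>G. \<exists>G'. G \<in> Xp \<longrightarrow> G' \<in> Xp \<and> (\<forall>x. G x \<le> G' x) \<and> (\<forall>f\<in>S 1. amod (\<Psi> G) (cut f G') \<le> d)"
    by blast
  then obtain nx where nx: "\<And>G. G \<in> Xp \<Longrightarrow> nx G \<in> Xp" "\<And>G x. G \<in> Xp \<Longrightarrow> G x \<le> nx G x"
    "\<And>G f. G \<in> Xp \<Longrightarrow> f \<in> S 1 \<Longrightarrow> amod (\<Psi> G) (cut f (nx G)) \<le> d" by metis
  \<comment> \<open>\<open>\<Psi> (G b)\<close> is small on the interval of \<open>2 * G b\<close>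
    and on what exceeds \<open>2 * G (Suc b)\<close>, so the band between them almost carries it.
    Starting from \<open>G0\<close> keeps all bands above \<open>2 * G0\<close>.\<close>
  define G where "G b = (nx ^^ b) G0" for b
  have GX: "G b \<in> Xp" for b by (induction b) (auto simp: G_def G0 nx)
  have GS: "G (Suc b) = nx (G b)" for b by (simp add: G_def)
  have Gmono: "G b x \<le> G c x" if "b \<le> c" for b c x
    using that by (induction c rule: dec_induct) (auto simp: GS intro: order.trans nx(2)[OF GX])
  have G0le: "G0 x \<le> G b x" for b x using Gmono[of 0 b x] by (simp add: G_def)
  define \<psi> where "\<psi> b = \<Psi> (G b)" for b
  have \<psi>F: "\<psi> b \<in> ?F" for b unfolding \<psi>_def by (rule \<Psi>(1)[OF GX])
  have \<psi>D: "\<psi> b \<in> Dual" for b by (rule null_fam_Dual[OF F \<psi>F])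
  \<comment> \<open>The heavy bands contribute at most \<open>Q * C\<close> however many bands there
    are; \<open>R\<close> is large enough to make this at most \<open>R * d\<close>.\<close>
  obtain R0 :: nat where R0: "Q * C < real R0 * d" using reals_Archimedean3[OF d] by blast
  define R where "R = Suc R0"
  have R: "0 < R" "Q * C \<le> real R * d" using R0 d by (auto simp: R_def algebra_simps)
  have "\<bar>(\<Sum>b<R. \<psi> b f) / real R\<bar> \<le> e" if f: "f \<in> S 1" for f
  proof -
    note fX = level_X1[OF f]
    have fm [measurable]: "f \<in> borel_measurable M" by (rule level_meas[OF f])
    have Gm [measurable]: "G b \<in> borel_measurable M" for b by (rule XpD(3)[OF GX])
    define t where "t b x = (if 2 * G b x < \<bar>f x\<bar> \<and> \<bar>f x\<bar> \<le> 2 * G (Suc b) x then \<bar>f x\<bar> else 0)" for b x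
    have tm [measurable]: "t b \<in> borel_measurable M" for b unfolding t_def by measurable
    have tlev: "lev M (t b) k \<subseteq> lev M f k" for b k by (auto simp: lev_def t_def)
    have tS: "t b \<in> S 1" for b by (rule level_subset[OF f tm tlev])
    have disj: "disjoint_family (\<lambda>b. lev M (t b) k)" for k
    proof -
      have *: "b = c" if "t b x \<noteq> 0" "t c x \<noteq> 0" "b \<le> c" for b c x
      proof (rule ccontr)
        assume "b \<noteq> c"
        then have "G (Suc b) x \<le> G c x" using that by (intro Gmono) auto
        then show False using that by (auto simp: t_def split: if_splits)
      qed
      then have "b = c" if "t b x \<noteq> 0" "t c x \<noteq> 0" for b c x
        using that by (metis nat_le_linear)
      then show ?thesis by (auto simp: disjoint_family_on_def lev_def)
    qed
    \<comment> \<open>The levels at which the band holds more than the share \<open>(1/2)^n\<close>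
      of \<open>D k\<close>. A level belongs to at most \<open>2^n\<close> of these sets, and
      removing them from \<open>t b\<close> leaves an element of \<open>S ((1/2)^n)\<close>.\<close>
    define K where "K b = {k. ennreal ((1/2)^n) * D k < emeasure M (lev M (t b) k)}" for b
    have Kcard: "card {b. b < R \<and> k \<in> K b} \<le> 2^n" for k
      using few_large_pieces[OF f tm tlev disj, of R n k] by (simp add: K_def)
    let ?B = "{b. b < R \<and> d < lnorm (\<psi> b) (K b)}"
    have B: "real (card ?B) \<le> Q" using Q[THEN spec, of R, THEN spec, of \<psi>, THEN spec, of K] \<psi>F Kcard by blast
    have small: "amod (\<psi> b) (\<lambda>x. \<bar>f x\<bar>) \<le> 4 * d" if "\<not> d < lnorm (\<psi> b) (K b)" for b
    proof -
      have light: "amod (\<psi> b) (lres (t b) (- K b)) \<le> d"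
      proof -
        have "lres (t b) (- K b) \<in> S ((1/2)^n)"
          unfolding level_ball_def using lres_meas[OF tm] by (auto simp: lev_lres K_def not_less)
        then have "amod (\<psi> b) (cut (lres (t b) (- K b)) G0) \<le> d" by (rule G0(2)[OF \<psi>F])
        \<comment> \<open>On its support \<open>t b\<close> exceeds \<open>2 * G b\<close>, hence
          \<open>2 * G0\<close>, so the cut removes nothing.\<close>
        also have "cut (lres (t b) (- K b)) G0 = lres (t b) (- K b)"
        proof
          fix x
          have "2 * G0 x < \<bar>t b x\<bar>" if "t b x \<noteq> 0"
            using that G0le[of x b] by (simp add: t_def split: if_splits)
          then show "cut (lres (t b) (- K b)) G0 x = lres (t b) (- K b) x"
            by (simp add: cut_def lres_def)
        qed
        finally show ?thesis .
      qed
      have heavy: "amod (\<psi> b) (lres (t b) (K b)) \<le> d"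
        using lnorm_upper[OF \<psi>D[of b] tS[of b], of "K b"] that by simp
      have p1: "(\<lambda>x. 2 * G b x) \<in> Xp" by (rule Xp_scale[OF GX]) simp
      have p2: "cut f (G (Suc b)) \<in> Xp" by (rule cut_Xp[OF fX GX])
      have p3: "lres (t b) A \<in> Xp" for A by (rule lres_Xp[OF level_X1[OF tS]])
      have "amod (\<psi> b) (\<lambda>x. \<bar>f x\<bar>) \<le> amod (\<psi> b) (\<lambda>x. (2 * G b x + cut f (G (Suc b)) x) +
          (lres (t b) (K b) x + lres (t b) (- K b) x))"
      proof (rule amod_mono[OF \<psi>D Xp_abs[OF fX] Xp_add[OF Xp_add[OF p1 p2] Xp_add[OF p3 p3]]], rule AE_I2)
        fix x
        have "\<bar>f x\<bar> \<le> 2 * G b x + cut f (G (Suc b)) x + t b x"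
          using XpD(2)[OF GX, of b x] by (auto simp: cut_def t_def)
        also have "t b x = lres (t b) (K b) x + lres (t b) (- K b) x"
          by (auto simp: lres_def t_def)
        finally show "\<bar>f x\<bar> \<le> (2 * G b x + cut f (G (Suc b)) x) + (lres (t b) (K b) x + lres (t b) (- K b) x)"
          by simp
      qed
      also have "\<dots> = (amod (\<psi> b) (\<lambda>x. 2 * G b x) + amod (\<psi> b) (cut f (G (Suc b)))) +
          (amod (\<psi> b) (lres (t b) (K b)) + amod (\<psi> b) (lres (t b) (- K b)))"
        by (simp only: amod_add[OF \<psi>D Xp_add[OF p1 p2] Xp_add[OF p3 p3]] amod_add[OF \<psi>D p1 p2] amod_add[OF \<psi>D p3 p3])
      also have "\<dots> \<le> (d + d) + (d + d)"
        by (intro add_mono light heavy) (simp_all add: \<psi>_def GS \<Psi>(2)[OF GX] nx(3)[OF GX f])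
      finally show ?thesis by simp
    qed
    have "\<bar>\<Sum>b<R. \<psi> b f\<bar> \<le> (\<Sum>b<R. \<bar>\<psi> b f\<bar>)" by (rule sum_abs)
    also have "\<dots> \<le> (\<Sum>b<R. 4 * d + (if b \<in> ?B then C else 0))"
    proof (rule sum_mono)
      fix b assume b: "b \<in> {..<R}"
      have "\<bar>\<psi> b f\<bar> \<le> amod (\<psi> b) (\<lambda>x. \<bar>f x\<bar>)" by (rule abs_le_amod_abs[OF \<psi>D fX])
      then show "\<bar>\<psi> b f\<bar> \<le> 4 * d + (if b \<in> ?B then C else 0)"
        using small[of b] C(2)[OF \<psi>F f, of b] b d by (auto split: if_splits)
    qed
    also have "\<dots> = real R * (4 * d) + real (card ?B) * C"
    proof -
      have "(\<Sum>b<R. if b \<in> ?B then C else 0) = (\<Sum>b\<in>{..<R} \<inter> ?B. C)"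
        by (rule sum.inter_restrict[symmetric]) simp
      also have "{..<R} \<inter> ?B = ?B" by auto
      finally have "(\<Sum>b<R. if b \<in> ?B then C else 0) = real (card ?B) * C" by simp
      then show ?thesis by (simp only: sum.distrib) simp
    qed
    also have "\<dots> \<le> real R * (4 * d) + Q * C" using B C(1) by (intro add_left_mono mult_right_mono)
    also have "\<dots> \<le> real R * e" using R(2) by (simp add: d_def algebra_simps)
    finally show ?thesis using R(1) by (simp add: field_simps)
  qed
  then show ?thesis by (intro bexI[OF _ chull_average[OF \<psi>F R(1)]] ballI)
qed

section \<open>From small convex combinations to weak convergence\<close>

lemma bidual_add:
  "\<Phi> \<in> bidual_space X N \<Longrightarrow> u \<in> Dual \<Longrightarrow> v \<in> Dual \<Longrightarrow> \<Phi> (\<lambda>f. u f + v f) = \<Phi> u + \<Phi> v"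
  by (simp add: bidual_space_def)

lemma bidual_scale: "\<Phi> \<in> bidual_space X N \<Longrightarrow> u \<in> Dual \<Longrightarrow> \<Phi> (\<lambda>f. c * u f) = c * \<Phi> u"
  by (simp add: bidual_space_def)

text \<open>A common lower bound \<open>c\<close> for all \<open>\<Phi> (\<phi> i)\<close> passes to
  convex combinations by linearity. \<open>chull_small\<close> yields a combination too small in
  dual norm for this, since the unit ball is contained in \<open>S 1\<close>.\<close>

lemma bidual_null:
  assumes \<phi>: "\<And>i. \<phi> i \<in> Dual" "\<And>f. f \<in> X \<Longrightarrow> (\<lambda>i::nat. \<phi> i f) \<longlonglongrightarrow> 0"
    and \<Phi>: "\<Phi> \<in> bidual_space X N" and c: "0 < c"
  shows "\<exists>i. \<Phi> (\<phi> i) < c"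
proof (rule ccontr)
  assume "\<not> ?thesis"
  then have ge: "c \<le> \<Phi> (\<phi> i)" for i by (simp add: not_less)
  have hull: "c \<le> \<Phi> u" if "u \<in> chull \<phi> 0" for u
    using that
  proof induction
    case (mix u v a)
    have uv: "u \<in> Dual" "v \<in> Dual" using mix chull_Dual[OF _ \<phi>(1)] by auto
    have s: "(\<lambda>f. a * u f) \<in> Dual" "(\<lambda>f. (1 - a) * v f) \<in> Dual"
      using dual_mix[OF uv, of a 0] dual_mix[OF uv, of 0 "1 - a"] by simp_all
    have "\<Phi> (\<lambda>f. a * u f + (1 - a) * v f) = \<Phi> (\<lambda>f. a * u f) + \<Phi> (\<lambda>f. (1 - a) * v f)"
      by (rule bidual_add[OF \<Phi> s])
    also have "\<dots> = a * \<Phi> u + (1 - a) * \<Phi> v"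
      by (simp only: bidual_scale[OF \<Phi> uv(1)] bidual_scale[OF \<Phi> uv(2)])
    also have "\<dots> \<ge> a * c + (1 - a) * c"
      using mix by (intro add_mono mult_left_mono) auto
    finally show ?case by (simp add: algebra_simps)
  qed (rule ge)
  obtain C where C: "\<And>u. u \<in> Dual \<Longrightarrow> \<bar>\<Phi> u\<bar> \<le> C * dual_norm X N u"
    using \<Phi> unfolding bidual_space_def by blast
  define d where "d = c / (2 * (\<bar>C\<bar> + 1))"
  have d: "0 < d" using c by (simp add: d_def)
  obtain u where u: "u \<in> chull \<phi> 0" "\<And>f. f \<in> S 1 \<Longrightarrow> \<bar>u f\<bar> \<le> d"
    using chull_small[OF \<phi> d] by blast
  have uD: "u \<in> Dual" by (rule chull_Dual[OF u(1) \<phi>(1)])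
  have z: "(\<lambda>x. 0) \<in> {f \<in> X. N f \<le> 1}" using X_zero N_zero by simp
  have ud: "\<bar>u f\<bar> \<le> d" if "f \<in> {f \<in> X. N f \<le> 1}" for f
    by (rule u(2)) (use that ball_level in auto)
  have n1: "dual_norm X N u \<le> d" unfolding dual_norm_def by (rule cSUP_least) (use z ud in auto)
  have "bdd_above ((\<lambda>f. \<bar>u f\<bar>) ` {f \<in> X. N f \<le> 1})" by (rule bdd_aboveI2[OF ud])
  then have "\<bar>u (\<lambda>x. 0)\<bar> \<le> dual_norm X N u" unfolding dual_norm_def by (rule cSUP_upper[OF z])
  then have n0: "0 \<le> dual_norm X N u" by simp
  have "c \<le> \<bar>\<Phi> u\<bar>" using hull[OF u(1)] by simp
  also have "\<dots> \<le> C * dual_norm X N u" by (rule C[OF uD])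
  also have "\<dots> \<le> \<bar>C\<bar> * d" using n0 n1 by (intro mult_mono) auto
  also have "\<dots> < c" using c by (simp add: d_def field_simps add_nonneg_pos)
  finally show False by simp
qed

theorem weak_convergence:
  assumes \<phi>s: "\<And>n::nat. \<phi>s n \<in> Dual" and \<phi>: "\<phi> \<in> Dual"
    and lim: "\<And>f. f \<in> X \<Longrightarrow> (\<lambda>n. \<phi>s n f) \<longlonglongrightarrow> \<phi> f" and \<Phi>: "\<Phi> \<in> bidual_space X N"
  shows "(\<lambda>n. \<Phi> (\<phi>s n)) \<longlonglongrightarrow> \<Phi> \<phi>"
proof (rule ccontr)
  assume "\<not> ?thesis"
  then obtain c where c: "0 < c" "\<exists>\<^sub>F n in sequentially. \<not> \<bar>\<Phi> (\<phi>s n) - \<Phi> \<phi>\<bar> < c"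
    unfolding tendsto_iff frequently_def by (auto simp: dist_real_def)
  then have "infinite {n. \<not> \<bar>\<Phi> (\<phi>s n) - \<Phi> \<phi>\<bar> < c}"
    by (simp add: frequently_cofinite flip: cofinite_eq_sequentially)
  then obtain r :: "nat \<Rightarrow> nat" where r: "strict_mono r" "\<And>n. \<not> \<bar>\<Phi> (\<phi>s (r n)) - \<Phi> \<phi>\<bar> < c"
    using infinite_enumerate by blast
  \<comment> \<open>The signs turn a distance of at least \<open>c\<close> into the one-sided bound
    that \<open>bidual_null\<close> refutes, and multiplying by them preserves convergence to
    0.\<close>
  define s where "s n = sgn (\<Phi> (\<phi>s (r n)) - \<Phi> \<phi>)" for n
  define \<eta> where "\<eta> n f = s n * \<phi>s (r n) f + (- s n) * \<phi> f" for n f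
  have \<eta>D: "\<eta> n \<in> Dual" for n unfolding \<eta>_def by (rule dual_mix[OF \<phi>s \<phi>])
  have "(\<lambda>n. \<eta> n f) \<longlonglongrightarrow> 0" if f: "f \<in> X" for f
  proof (rule tendsto_0_le[where K = 1])
    have "(\<lambda>n. \<phi>s (r n) f - \<phi> f) \<longlonglongrightarrow> \<phi> f - \<phi> f"
      using LIMSEQ_subseq_LIMSEQ[OF lim[OF f] r(1)] by (intro tendsto_diff tendsto_const) (simp add: o_def)
    then show "(\<lambda>n. \<phi>s (r n) f - \<phi> f) \<longlonglongrightarrow> 0" by simp
    have "\<bar>s n\<bar> \<le> 1" for n by (simp add: s_def sgn_real_def)
    then have "\<bar>s n * (\<phi>s (r n) f - \<phi> f)\<bar> \<le> 1 * \<bar>\<phi>s (r n) f - \<phi> f\<bar>" for n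
      unfolding abs_mult by (intro mult_right_mono) auto
    then show "\<forall>\<^sub>F n in sequentially. norm (\<eta> n f) \<le> norm (\<phi>s (r n) f - \<phi> f) * 1"
      by (simp add: \<eta>_def algebra_simps)
  qed
  then obtain i where i: "\<Phi> (\<eta> i) < c" using bidual_null[of \<eta>, OF \<eta>D _ \<Phi> c(1)] by blast
  have D: "(\<lambda>f. s i * \<phi>s (r i) f) \<in> Dual" "(\<lambda>f. (- s i) * \<phi> f) \<in> Dual"
    using dual_mix[OF \<phi>s \<phi>, of "s i" "r i" 0] dual_mix[OF \<phi>s \<phi>, of 0 "r i" "- s i"] by simp_all
  have "\<Phi> (\<eta> i) = \<Phi> (\<lambda>f. s i * \<phi>s (r i) f) + \<Phi> (\<lambda>f. (- s i) * \<phi> f)"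
    unfolding \<eta>_def by (rule bidual_add[OF \<Phi> D])
  also have "\<dots> = s i * \<Phi> (\<phi>s (r i)) + (- s i) * \<Phi> \<phi>"
    by (simp only: bidual_scale[OF \<Phi> \<phi>s] bidual_scale[OF \<Phi> \<phi>])
  also have "\<dots> = \<bar>\<Phi> (\<phi>s (r i)) - \<Phi> \<phi>\<bar>"
    by (auto simp: s_def sgn_real_def)
  finally show False using i r(2)[of i] by simp
qed

end

subsection \<open>The integral of the decreasing rearrangement\<close>

lemma ennreal_diff_le:
  fixes a b c :: ennreal
  assumes "a \<le> b + c" "b \<noteq> \<top>" shows "a - b \<le> c"
  using assms by (simp add: ennreal_minus_le_iff)

text \<open>The Peetre K-functional of the couple \<open>(L\<^sub>1, L\<^sub>\<infinity>)\<close>.\<close>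

definition Kf :: "'a measure \<Rightarrow> real \<Rightarrow> ('a \<Rightarrow> ennreal) \<Rightarrow> ennreal" where
  "Kf M t F = (INF c. (\<integral>\<^sup>+x. F x - c \<partial>M) + ennreal t * c)"

lemma Kf_le: "Kf M t F \<le> (\<integral>\<^sup>+x. F x - c \<partial>M) + ennreal t * c"
  unfolding Kf_def by (rule INF_lower) simp

lemma Kf_mono_AE: "(AE x in M. F x \<le> G x) \<Longrightarrow> Kf M t F \<le> Kf M t G"
  unfolding Kf_def
  by (intro INF_mono) (auto intro!: add_right_mono nn_integral_mono_AE ennreal_minus_mono elim!: eventually_mono)

lemma Kf_zero: "Kf M t (\<lambda>x. 0) = 0"
  using Kf_le[of M t "\<lambda>x. 0" 0] by simp

text \<open>Near optimal \<open>c j\<close> with errors \<open>e * (1/2)^Suc j\<close> are added up,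
  using that the positive part of a sum is at most the sum of the positive parts. The countable form
  serves both the triangle inequality and completeness.\<close>

lemma Kf_suminf:
  assumes F [measurable]: "\<And>j::nat. F j \<in> borel_measurable M" and t: "0 < t"
  shows "Kf M t (\<lambda>x. \<Sum>j. F j x) \<le> (\<Sum>j. Kf M t (F j))"
proof (rule ennreal_le_epsilon)
  fix e :: real assume fin: "(\<Sum>j. Kf M t (F j)) < \<top>" and e: "0 < e"
  have Kfin: "Kf M t (F j) < \<top>" for j
  proof -
    have "(\<Sum>i\<in>{j}. Kf M t (F i)) \<le> (\<Sum>j. Kf M t (F j))" by (rule sum_le_suminf) auto
    then show ?thesis using fin by (simp add: le_less_trans)
  qed
  have "\<exists>c. (\<integral>\<^sup>+x. F j x - c \<partial>M) + ennreal t * c < Kf M t (F j) + ennreal (e * (1/2)^Suc j)" for j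
  proof -
    have "Kf M t (F j) < Kf M t (F j) + ennreal (e * (1/2)^Suc j)"
      using ennreal_add_left_cancel_less[of "Kf M t (F j)" 0 "ennreal (e * (1/2)^Suc j)"] Kfin[of j] e by simp
    then show ?thesis by (subst (asm) (1) Kf_def) (simp only: INF_less_iff, blast)
  qed
  then obtain c where c: "\<And>j. (\<integral>\<^sup>+x. F j x - c j \<partial>M) + ennreal t * c j < Kf M t (F j) + ennreal (e * (1/2)^Suc j)"
    by metis
  have geo: "(\<Sum>j. ennreal (e * (1/2)^Suc j)) = ennreal e"
  proof (rule suminf_ennreal_eq)
    show "(\<lambda>j. e * (1/2)^Suc j) sums e" using sums_mult[OF power_half_series, of e] by simp
  qed (use e in simp)
  have total: "(\<Sum>j. (\<integral>\<^sup>+x. F j x - c j \<partial>M) + ennreal t * c j) \<le> (\<Sum>j. Kf M t (F j)) + ennreal e"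
  proof -
    have "(\<Sum>j. (\<integral>\<^sup>+x. F j x - c j \<partial>M) + ennreal t * c j) \<le> (\<Sum>j. Kf M t (F j) + ennreal (e * (1/2)^Suc j))"
      by (intro suminf_le summableI less_imp_le c)
    also have "\<dots> = (\<Sum>j. Kf M t (F j)) + ennreal e"
      by (subst suminf_add[symmetric]) (simp_all only: summableI geo)
    finally show ?thesis .
  qed
  have split: "(\<Sum>j. (\<integral>\<^sup>+x. F j x - c j \<partial>M) + ennreal t * c j)
      = (\<Sum>j. \<integral>\<^sup>+x. F j x - c j \<partial>M) + ennreal t * (\<Sum>j. c j)"
    by (subst suminf_add[symmetric]) (simp_all only: summableI ennreal_suminf_cmult)
  have "ennreal t * (\<Sum>j. c j) < \<top>"
  proof (rule le_less_trans)
    show "ennreal t * (\<Sum>j. c j) \<le> (\<Sum>j. Kf M t (F j)) + ennreal e"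
      using total unfolding split by (rule order.trans[rotated]) simp
    show "(\<Sum>j. Kf M t (F j)) + ennreal e < \<top>" using fin by simp
  qed
  \<comment> \<open>Finiteness matters because \<open>\<top> - \<top> = \<top>\<close> in
    \<open>ennreal\<close>, which would spoil the subadditivity of truncated differences.\<close>
  then have cfin: "(\<Sum>j. c j) \<noteq> \<top>" using t by (auto simp: ennreal_mult_top)
  have "Kf M t (\<lambda>x. \<Sum>j. F j x) \<le> (\<integral>\<^sup>+x. (\<Sum>j. F j x) - (\<Sum>j. c j) \<partial>M) + ennreal t * (\<Sum>j. c j)"
    by (rule Kf_le)
  also have "(\<integral>\<^sup>+x. (\<Sum>j. F j x) - (\<Sum>j. c j) \<partial>M) \<le> (\<integral>\<^sup>+x. (\<Sum>j. F j x - c j) \<partial>M)"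
  proof (rule nn_integral_mono, rule ennreal_diff_le[OF _ cfin])
    fix x
    have "F j x \<le> c j + (F j x - c j)" for j
      by (metis ennreal_minus_le_iff order_refl)
    then have "(\<Sum>j. F j x) \<le> (\<Sum>j. c j + (F j x - c j))" by (intro suminf_le summableI)
    also have "\<dots> = (\<Sum>j. c j) + (\<Sum>j. F j x - c j)"
      by (subst suminf_add[symmetric]) (simp_all only: summableI)
    finally show "(\<Sum>j. F j x) \<le> (\<Sum>j. c j) + (\<Sum>j. F j x - c j)" .
  qed
  also have "(\<integral>\<^sup>+x. (\<Sum>j. F j x - c j) \<partial>M) = (\<Sum>j. \<integral>\<^sup>+x. F j x - c j \<partial>M)"
    by (rule nn_integral_suminf) measurable
  also have "(\<Sum>j. \<integral>\<^sup>+x. F j x - c j \<partial>M) + ennreal t * (\<Sum>j. c j) \<le> (\<Sum>j. Kf M t (F j)) + ennreal e"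
    using total unfolding split .
  finally show "Kf M t (\<lambda>x. \<Sum>j. F j x) \<le> (\<Sum>j. Kf M t (F j)) + ennreal e" by (simp add: add_right_mono)
qed

lemma Kf_scale_le:
  assumes [measurable]: "F \<in> borel_measurable M" and c: "0 < c" and t: "0 < t"
  shows "Kf M t (\<lambda>x. ennreal c * F x) \<le> ennreal c * Kf M t F"
proof -
  have cc: "ennreal c * ennreal (1 / c) = 1" "ennreal (1 / c) * ennreal c = 1"
    using c by (simp_all add: ennreal_mult''[symmetric] del: ennreal_1 flip: ennreal_1)
  have "ennreal (1 / c) * Kf M t (\<lambda>x. ennreal c * F x) \<le> (\<integral>\<^sup>+x. F x - d \<partial>M) + ennreal t * d" for d
  proof (cases "d = \<top>")
    case False
    have "Kf M t (\<lambda>x. ennreal c * F x) \<le> (\<integral>\<^sup>+x. ennreal c * F x - ennreal c * d \<partial>M) + ennreal t * (ennreal c * d)"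
      by (rule Kf_le)
    also have "(\<integral>\<^sup>+x. ennreal c * F x - ennreal c * d \<partial>M) \<le> (\<integral>\<^sup>+x. ennreal c * (F x - d) \<partial>M)"
    proof (rule nn_integral_mono, rule ennreal_diff_le)
      fix x
      have "F x \<le> d + (F x - d)" by (metis ennreal_minus_le_iff order_refl)
      then show "ennreal c * F x \<le> ennreal c * d + ennreal c * (F x - d)"
        by (metis distrib_left mult_left_mono zero_le)
      show "ennreal c * d \<noteq> \<top>" using False by (simp add: ennreal_mult_eq_top_iff)
    qed
    also have "\<dots> = ennreal c * (\<integral>\<^sup>+x. F x - d \<partial>M)" by (rule nn_integral_cmult) measurable
    finally have "Kf M t (\<lambda>x. ennreal c * F x) \<le> ennreal c * ((\<integral>\<^sup>+x. F x - d \<partial>M) + ennreal t * d)"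
      by (simp add: distrib_left mult_ac add_right_mono)
    from mult_left_mono[OF this, of "ennreal (1 / c)"] show ?thesis
      by (simp only: mult.assoc[symmetric] cc) simp
  next
    case True
    then show ?thesis using t by (simp add: ennreal_mult_top)
  qed
  then have "ennreal (1 / c) * Kf M t (\<lambda>x. ennreal c * F x) \<le> Kf M t F"
    unfolding Kf_def[of M t F] by (intro INF_greatest)
  from mult_left_mono[OF this, of "ennreal c"] show ?thesis
    by (simp only: mult.assoc[symmetric] cc) simp
qed

section \<open>Layer-cake formulas and the distribution function\<close>

lemma nn_integral_layer:
  "(\<integral>\<^sup>+s. indicator {s. 0 \<le> s \<and> ennreal s < y} s \<partial>lborel) = y"
proof (cases y)
  case (real r)
  then have "{s. 0 \<le> s \<and> ennreal s < y} = {0..<r}" by (auto simp: ennreal_less_iff)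
  then show ?thesis using real by simp
next
  case top
  then have "{s. 0 \<le> s \<and> ennreal s < y} = {0..}" by auto
  moreover have "emeasure lborel {0::real..} = \<top>"
  proof (cases "emeasure lborel {0::real..}")
    case (real r)
    have "emeasure lborel {0..<r+1} \<le> emeasure lborel {0::real..}" by (rule emeasure_mono) auto
    then show ?thesis using real by (simp add: ennreal_le_iff del: ennreal_plus)
  qed
  ultimately show ?thesis using top by simp
qed

definition distf :: "'a measure \<Rightarrow> ('a \<Rightarrow> real) \<Rightarrow> real \<Rightarrow> ennreal" where
  "distf M f s = emeasure M {x \<in> space M. s < \<bar>f x\<bar>}"

text \<open>The distribution function is right continuous, because the sets \<open>A n\<close> below
  increase to the set where \<open>\<bar>f x\<bar>\<close> exceeds \<open>s\<close>. Hence strict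
  inequalities correspond exactly, and Fubini can exchange the rearrangement for the distribution
  function.\<close>

lemma drearr_less_iff:
  assumes f [measurable]: "f \<in> borel_measurable M" and s: "0 \<le> s"
  shows "ennreal s < drearr M f u \<longleftrightarrow> ennreal u < distf M f s"
proof -
  have eq: "{x \<in> space M. ennreal r < ennreal \<bar>f x\<bar>} = {x \<in> space M. r < \<bar>f x\<bar>}" if "0 \<le> r" for r
    using that by (auto simp: ennreal_less_iff)
  show ?thesis
  proof
    assume "ennreal s < drearr M f u"
    then have "ennreal s \<notin> {s. emeasure M {x \<in> space M. s < ennreal \<bar>f x\<bar>} \<le> ennreal u}"
      unfolding drearr_def by (meson Inf_lower not_le)
    then show "ennreal u < distf M f s" by (simp add: distf_def eq[OF s] not_le)
  next
    assume u: "ennreal u < distf M f s"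
    show "ennreal s < drearr M f u"
    proof (rule ccontr)
      assume "\<not> ?thesis"
      then have le: "drearr M f u \<le> ennreal s" by simp
      define A where "A n = {x \<in> space M. s + 1 / Suc n < \<bar>f x\<bar>}" for n
      have "emeasure M (A n) \<le> ennreal u" for n
      proof -
        have "drearr M f u < ennreal (s + 1 / Suc n)"
          using le s by (intro le_less_trans[OF le]) (simp add: ennreal_less_iff)
        then obtain c where c: "emeasure M {x \<in> space M. c < ennreal \<bar>f x\<bar>} \<le> ennreal u"
          "c < ennreal (s + 1 / Suc n)" unfolding drearr_def by (auto simp: Inf_less_iff)
        have "A n \<subseteq> {x \<in> space M. c < ennreal \<bar>f x\<bar>}"
        proof
          fix x assume x: "x \<in> A n"
          have "0 \<le> s + 1 / real (Suc n)" using s by simp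
          then have "ennreal (s + 1 / Suc n) < ennreal \<bar>f x\<bar>"
            using x by (subst ennreal_less_iff) (auto simp: A_def)
          with c(2) have "c < ennreal \<bar>f x\<bar>" by (rule order.strict_trans)
          then show "x \<in> {x \<in> space M. c < ennreal \<bar>f x\<bar>}" using x by (simp add: A_def)
        qed
        then have "emeasure M (A n) \<le> emeasure M {x \<in> space M. c < ennreal \<bar>f x\<bar>}"
          by (rule emeasure_mono) measurable
        then show ?thesis using c(1) by simp
      qed
      then have "(SUP n. emeasure M (A n)) \<le> ennreal u" by (intro SUP_least)
      also have "(SUP n. emeasure M (A n)) = emeasure M (\<Union>n. A n)"
      proof (rule SUP_emeasure_incseq)
        show "range A \<subseteq> sets M" by (auto simp: A_def)
        show "incseq A"
        proof (rule incseq_SucI)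
          fix n
          have "1 / real (Suc (Suc n)) \<le> 1 / real (Suc n)" by (simp add: field_simps)
          then show "A n \<subseteq> A (Suc n)" by (auto simp: A_def)
        qed
      qed
      also have "(\<Union>n. A n) = {x \<in> space M. s < \<bar>f x\<bar>}"
      proof safe
        fix x n assume "x \<in> A n"
        moreover have "0 < 1 / real (Suc n)" by simp
        ultimately show "s < \<bar>f x\<bar>" unfolding A_def by (smt (verit) mem_Collect_eq)
      next
        fix x assume x: "x \<in> space M" "s < \<bar>f x\<bar>"
        then obtain n where "1 / real (Suc n) < \<bar>f x\<bar> - s" using nat_approx_posE[of "\<bar>f x\<bar> - s"] by auto
        then have "s + 1 / real (Suc n) < \<bar>f x\<bar>" by linarith
        then have "x \<in> A n" using x(1) by (simp add: A_def)
        then show "x \<in> (\<Union>n. A n)" by blast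
      qed (auto simp: A_def)
      finally show False using u by (simp add: distf_def)
    qed
  qed
qed

lemma (in sigma_finite_measure) distf_measurable [measurable]:
  assumes [measurable]: "f \<in> borel_measurable M"
  shows "distf M f \<in> borel_measurable borel"
proof -
  have "(\<lambda>s. \<integral>\<^sup>+x. indicator {p. fst p < \<bar>f (snd p)\<bar>} (s, x) \<partial>M) \<in> borel_measurable borel"
    by measurable
  also have "(\<lambda>s. \<integral>\<^sup>+x. indicator {p. fst p < \<bar>f (snd p)\<bar>} (s, x) \<partial>M) = distf M f"
  proof
    fix s
    have "(\<integral>\<^sup>+x. indicator {p. fst p < \<bar>f (snd p)\<bar>} (s, x) \<partial>M) = (\<integral>\<^sup>+x. indicator {x \<in> space M. s < \<bar>f x\<bar>} x \<partial>M)"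
      by (rule nn_integral_cong) (auto simp: indicator_def)
    also have "\<dots> = distf M f s" by (simp add: distf_def)
    finally show "(\<integral>\<^sup>+x. indicator {p. fst p < \<bar>f (snd p)\<bar>} (s, x) \<partial>M) = distf M f s" .
  qed
  finally show ?thesis .
qed

lemma (in sigma_finite_measure) nn_integral_distf:
  assumes [measurable]: "f \<in> borel_measurable M" and r: "0 \<le> r"
  shows "(\<integral>\<^sup>+s. indicator {r..} s * distf M f s \<partial>lborel) = (\<integral>\<^sup>+x. ennreal \<bar>f x\<bar> - ennreal r \<partial>M)"
proof -
  interpret P: pair_sigma_finite M "lborel :: real measure" ..
  define h :: "'a \<Rightarrow> real \<Rightarrow> ennreal" where "h x s = indicator {p. r \<le> snd p \<and> snd p < \<bar>f (fst p)\<bar>} (x, s)" for x s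
  have hm: "(\<lambda>(x, s). h x s) \<in> borel_measurable (M \<Otimes>\<^sub>M lborel)"
    unfolding h_def split_def by measurable
  have "(\<integral>\<^sup>+s. indicator {r..} s * distf M f s \<partial>lborel) = (\<integral>\<^sup>+s. \<integral>\<^sup>+x. h x s \<partial>M \<partial>lborel)"
  proof (rule nn_integral_cong)
    fix s
    have "(\<integral>\<^sup>+x. h x s \<partial>M) = (\<integral>\<^sup>+x. indicator {r..} s * indicator {x \<in> space M. s < \<bar>f x\<bar>} x \<partial>M)"
      by (rule nn_integral_cong) (auto simp: h_def indicator_def)
    also have "\<dots> = indicator {r..} s * distf M f s"
      by (subst nn_integral_cmult) (auto simp: distf_def)
    finally show "indicator {r..} s * distf M f s = (\<integral>\<^sup>+x. h x s \<partial>M)" by simp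
  qed
  also have "\<dots> = (\<integral>\<^sup>+x. \<integral>\<^sup>+s. h x s \<partial>lborel \<partial>M)" by (rule P.Fubini'[OF hm])
  also have "\<dots> = (\<integral>\<^sup>+x. ennreal \<bar>f x\<bar> - ennreal r \<partial>M)"
  proof (rule nn_integral_cong)
    fix x
    have "(\<integral>\<^sup>+s. h x s \<partial>lborel) = (\<integral>\<^sup>+s. indicator {r..<\<bar>f x\<bar>} s \<partial>lborel)"
      by (rule nn_integral_cong) (auto simp: h_def indicator_def)
    also have "\<dots> = ennreal (\<bar>f x\<bar> - r)"
      by (cases "r \<le> \<bar>f x\<bar>") (auto simp: ennreal_neg)
    finally show "(\<integral>\<^sup>+s. h x s \<partial>lborel) = ennreal \<bar>f x\<bar> - ennreal r" using r by (simp add: ennreal_minus)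
  qed
  finally show ?thesis .
qed

lemma drearr_measurable [measurable]: "drearr M f \<in> borel_measurable borel"
proof -
  have anti: "drearr M f u' \<le> drearr M f u" if "u \<le> u'" for u u'
    unfolding drearr_def using that by (intro Inf_superset_mono) (auto intro: order.trans ennreal_leI)
  show ?thesis
  proof (rule borel_measurableI_greater)
    fix y
    have "is_interval {u. y < drearr M f u}"
      unfolding is_interval_1 using anti by (blast intro: less_le_trans)
    then show "{u \<in> space borel. y < drearr M f u} \<in> sets borel"
      by (simp add: real_interval_borel_measurable)
  qed
qed

text \<open>By Fubini the left side is the integral of \<open>min (ennreal t) (distf M f s)\<close>
  over nonnegative \<open>s\<close>. Bounding the minimum by \<open>t\<close> below \<open>c\<close>
  and by \<open>distf\<close> above \<open>c\<close> gives the expression in the K-functional, with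
  equality at \<open>c = drearr M f t\<close>. Subadditivity, hidden in the rearrangement, is easy
  to read off from the K-functional.\<close>

lemma (in sigma_finite_measure) nn_integral_drearr:
  assumes f [measurable]: "f \<in> borel_measurable M" and t: "0 < t"
  shows "(\<integral>\<^sup>+ u. indicator {0..t} u * drearr M f u \<partial>lborel) = Kf M t (\<lambda>x. ennreal \<bar>f x\<bar>)"
proof -
  let ?E = "{p. 0 \<le> fst p \<and> fst p \<le> t \<and> 0 \<le> snd p \<and> ennreal (fst p) < distf M f (snd p)}"
  define mm where "mm s = indicator {0..} s * min (ennreal t) (distf M f s)" for s
  have "(\<integral>\<^sup>+ u. indicator {0..t} u * drearr M f u \<partial>lborel)
      = (\<integral>\<^sup>+ u. \<integral>\<^sup>+ s. indicator {0..t} u * indicator {s. 0 \<le> s \<and> ennreal s < drearr M f u} s \<partial>lborel \<partial>lborel)"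
    by (rule nn_integral_cong) (simp add: nn_integral_cmult nn_integral_layer)
  also have "\<dots> = (\<integral>\<^sup>+ u. \<integral>\<^sup>+ s. indicator ?E (u, s) \<partial>lborel \<partial>lborel)"
    by (intro nn_integral_cong) (auto simp: indicator_def drearr_less_iff)
  also have "\<dots> = (\<integral>\<^sup>+ s. \<integral>\<^sup>+ u. indicator ?E (u, s) \<partial>lborel \<partial>lborel)"
    by (rule lborel_pair.Fubini'[symmetric]) measurable
  also have "\<dots> = (\<integral>\<^sup>+ s. mm s \<partial>lborel)"
  proof (rule nn_integral_cong)
    fix s :: real
    have "(\<integral>\<^sup>+ u. indicator ?E (u, s) \<partial>lborel)
       = (\<integral>\<^sup>+ u. indicator {0..} s * indicator {u. 0 \<le> u \<and> ennreal u < min (ennreal t) (distf M f s)} u \<partial>lborel)"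
    \<comment> \<open>The closed interval and the strict inequality with \<open>t\<close> differ
      only at \<open>u = t\<close>.\<close>
    proof (rule nn_integral_cong_AE)
      have "AE u in lborel. u \<noteq> t" by (rule AE_lborel_singleton)
      then show "AE u in lborel. indicator ?E (u, s)
        = (indicator {0..} s * indicator {u. 0 \<le> u \<and> ennreal u < min (ennreal t) (distf M f s)} u :: ennreal)"
        by eventually_elim (auto simp: indicator_def ennreal_less_iff)
    qed
    also have "\<dots> = mm s"
      unfolding mm_def by (subst nn_integral_cmult) (measurable, simp only: nn_integral_layer)
    finally show "(\<integral>\<^sup>+ u. indicator ?E (u, s) \<partial>lborel) = mm s" .
  qed
  finally have lhs: "(\<integral>\<^sup>+ u. indicator {0..t} u * drearr M f u \<partial>lborel) = (\<integral>\<^sup>+ s. mm s \<partial>lborel)" .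
  have val: "(\<integral>\<^sup>+ s. ennreal t * indicator {0..<r} s + indicator {r..} s * distf M f s \<partial>lborel)
      = (\<integral>\<^sup>+x. ennreal \<bar>f x\<bar> - ennreal r \<partial>M) + ennreal t * ennreal r" if "0 \<le> r" for r
    using that by (subst nn_integral_add) (simp_all add: nn_integral_cmult nn_integral_distf add.commute)
  have up: "(\<integral>\<^sup>+ s. mm s \<partial>lborel) \<le> (\<integral>\<^sup>+x. ennreal \<bar>f x\<bar> - c \<partial>M) + ennreal t * c" for c
  proof (cases c)
    case (real r)
    have "(\<integral>\<^sup>+ s. mm s \<partial>lborel) \<le> (\<integral>\<^sup>+ s. ennreal t * indicator {0..<r} s + indicator {r..} s * distf M f s \<partial>lborel)"
      by (rule nn_integral_mono) (auto simp: mm_def indicator_def)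
    then show ?thesis using val[of r] real by simp
  qed (use t in \<open>simp add: ennreal_mult_top\<close>)
  have down: "Kf M t (\<lambda>x. ennreal \<bar>f x\<bar>) \<le> (\<integral>\<^sup>+ s. mm s \<partial>lborel)"
  proof (cases "drearr M f t")
    case (real r)
    have "Kf M t (\<lambda>x. ennreal \<bar>f x\<bar>) \<le> (\<integral>\<^sup>+x. ennreal \<bar>f x\<bar> - ennreal r \<partial>M) + ennreal t * ennreal r"
      by (rule Kf_le)
    also have "\<dots> = (\<integral>\<^sup>+ s. ennreal t * indicator {0..<r} s + indicator {r..} s * distf M f s \<partial>lborel)"
      using val[of r] real by simp
    also have "\<dots> \<le> (\<integral>\<^sup>+ s. mm s \<partial>lborel)"
    proof (rule nn_integral_mono)
      fix s :: real
      consider "s < 0" | "0 \<le> s" "s < r" | "0 \<le> s" "r \<le> s" by linarith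
      then show "ennreal t * indicator {0..<r} s + indicator {r..} s * distf M f s \<le> mm s"
      proof cases
        case 1
        then show ?thesis using real by (simp add: mm_def)
      next
        case 2
        then have "ennreal s < drearr M f t" using real by (simp add: ennreal_less_iff)
        then have "ennreal t < distf M f s" using drearr_less_iff[OF f 2(1)] by simp
        then show ?thesis using 2 by (simp add: mm_def)
      next
        case 3
        then have "\<not> ennreal s < drearr M f t" using real by (simp add: ennreal_less_iff)
        then have "distf M f s \<le> ennreal t" using drearr_less_iff[OF f 3(1)] by simp
        then show ?thesis using 3 by (simp add: mm_def)
      qed
    qed
    finally show ?thesis .
  next
    case top
    have "mm s = ennreal t * indicator {s. 0 \<le> s \<and> ennreal s < \<top>} s" for s
    proof (cases "0 \<le> s")
      case True
      then have "ennreal t < distf M f s" using drearr_less_iff[OF f True, of t] top by simp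
      then show ?thesis using True by (simp add: mm_def)
    qed (simp add: mm_def)
    then have "(\<integral>\<^sup>+ s. mm s \<partial>lborel) = ennreal t * \<top>"
      by (simp add: nn_integral_cmult nn_integral_layer del: ennreal_less_top)
    then show ?thesis using t by (simp add: ennreal_mult_top)
  qed
  have "(\<integral>\<^sup>+ s. mm s \<partial>lborel) \<le> Kf M t (\<lambda>x. ennreal \<bar>f x\<bar>)"
    unfolding Kf_def by (rule INF_greatest) (rule up)
  then show ?thesis unfolding lhs using down by (rule antisym)
qed

subsection \<open>Marcinkiewicz spaces\<close>

text \<open>The norm on functions with values in \<open>ennreal\<close>, so that series of absolute
  values can be measured before they are known to converge.\<close>

definition NE :: "'a measure \<Rightarrow> (real \<Rightarrow> real) \<Rightarrow> ('a \<Rightarrow> ennreal) \<Rightarrow> ennreal" where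
  "NE M \<psi> F = (SUP t \<in> {t::real. 0 < t \<and> ennreal t < gam M}. Kf M t F / ennreal (\<psi> t))"

text \<open>\<open>decay\<close> is the form in which (A) or (B) enters. The constant
  \<open>C\<^sub>0\<close> pays for a middle range of \<open>t\<close> in which a single halving
  need not gain a factor.\<close>

locale marcinkiewicz = sigma_finite_measure M for M :: "'a measure" +
  fixes \<psi> :: "real \<Rightarrow> real" and C\<^sub>0 q :: real
  assumes gam_pos: "0 < gam M"
    and \<psi>_pos: "0 < t \<Longrightarrow> ennreal t < gam M \<Longrightarrow> 0 < \<psi> t"
    and \<psi>_mono: "0 < s \<Longrightarrow> s \<le> t \<Longrightarrow> ennreal t < gam M \<Longrightarrow> \<psi> s \<le> \<psi> t"
    and q: "0 < q" "q < 1" and C\<^sub>0: "0 \<le> C\<^sub>0"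
    and decay: "0 < t \<Longrightarrow> ennreal t < gam M \<Longrightarrow> \<psi> (t / 2^i) \<le> C\<^sub>0 * q^i * \<psi> t"
begin

abbreviation dom where "dom \<equiv> {t::real. 0 < t \<and> ennreal t < gam M}"

abbreviation X where "X \<equiv> marc_space M \<psi>"
abbreviation N where "N \<equiv> marc_norm M \<psi>"
abbreviation Nf where "Nf f \<equiv> NE M \<psi> (\<lambda>x. ennreal \<bar>f x\<bar>)"

section \<open>Norm axioms and completeness\<close>

lemma dom_smaller: "t \<in> dom \<Longrightarrow> 0 < s \<Longrightarrow> s \<le> t \<Longrightarrow> s \<in> dom"
  by (auto intro: le_less_trans ennreal_leI)

lemma dom_nonempty: "\<exists>t. t \<in> dom"
proof -
  obtain y where y: "0 < y" "y < gam M" using gam_pos dense by blast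
  then obtain r where "y = ennreal r" "0 < r"
    by (cases y) auto
  then show ?thesis using y by auto
qed

lemma marc_norm_e_eq: "f \<in> borel_measurable M \<Longrightarrow> marc_norm_e M \<psi> f = Nf f"
  unfolding marc_norm_e_def NE_def by (intro SUP_cong) (auto simp: nn_integral_drearr)

lemma Kf_le_NE: "t \<in> dom \<Longrightarrow> Kf M t F \<le> ennreal (\<psi> t) * NE M \<psi> F"
proof -
  assume t: "t \<in> dom"
  then have "0 < \<psi> t" using \<psi>_pos by simp
  then have "ennreal (\<psi> t) * (Kf M t F / ennreal (\<psi> t)) = Kf M t F"
    by (subst ennreal_times_divide, subst mult.commute, intro mult_divide_eq_ennreal) auto
  then have "Kf M t F = ennreal (\<psi> t) * (Kf M t F / ennreal (\<psi> t))" by simp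
  also have "\<dots> \<le> ennreal (\<psi> t) * NE M \<psi> F"
    unfolding NE_def by (intro mult_left_mono SUP_upper t) simp
  finally show ?thesis .
qed

lemma NE_leI: "(\<And>t. t \<in> dom \<Longrightarrow> Kf M t F \<le> ennreal (\<psi> t) * b) \<Longrightarrow> NE M \<psi> F \<le> b"
  unfolding NE_def by (intro SUP_least divide_le_posI_ennreal) (auto simp: \<psi>_pos)

lemma NE_mono_AE: "(AE x in M. F x \<le> G x) \<Longrightarrow> NE M \<psi> F \<le> NE M \<psi> G"
  by (intro NE_leI order.trans[OF Kf_mono_AE Kf_le_NE]) auto

lemma NE_suminf:
  assumes "\<And>j::nat. F j \<in> borel_measurable M"
  shows "NE M \<psi> (\<lambda>x. \<Sum>j. F j x) \<le> (\<Sum>j. NE M \<psi> (F j))"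
proof (rule NE_leI)
  fix t assume t: "t \<in> dom"
  have "Kf M t (\<lambda>x. \<Sum>j. F j x) \<le> (\<Sum>j. Kf M t (F j))" by (rule Kf_suminf[OF assms]) (use t in auto)
  also have "\<dots> \<le> (\<Sum>j. ennreal (\<psi> t) * NE M \<psi> (F j))"
    by (intro suminf_le summableI Kf_le_NE t)
  also have "\<dots> = ennreal (\<psi> t) * (\<Sum>j. NE M \<psi> (F j))" by simp
  finally show "Kf M t (\<lambda>x. \<Sum>j. F j x) \<le> ennreal (\<psi> t) * (\<Sum>j. NE M \<psi> (F j))" .
qed

lemma NE_zero: "NE M \<psi> (\<lambda>x. 0) = 0"
proof -
  have "NE M \<psi> (\<lambda>x. 0) \<le> 0" by (rule NE_leI) (simp add: Kf_zero)
  then show ?thesis by simp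
qed

lemma NE_add:
  assumes [measurable]: "F \<in> borel_measurable M" "G \<in> borel_measurable M"
  shows "NE M \<psi> (\<lambda>x. F x + G x) \<le> NE M \<psi> F + NE M \<psi> G"
proof -
  define H where "H j = (if j = (0::nat) then F else if j = 1 then G else (\<lambda>x. 0))" for j
  have [measurable]: "H j \<in> borel_measurable M" for j by (auto simp: H_def)
  have s: "(\<Sum>j. h (H j)) = h F + h G" if "h (\<lambda>x. 0) = 0" for h :: "('a \<Rightarrow> ennreal) \<Rightarrow> ennreal"
    using suminf_finite[of "{0,1::nat}" "\<lambda>j. h (H j)"] that by (simp add: H_def)
  have "NE M \<psi> (\<lambda>x. \<Sum>j. H j x) \<le> (\<Sum>j. NE M \<psi> (H j))" by (rule NE_suminf) measurable
  then show ?thesis using s[of "NE M \<psi>"] s[of "\<lambda>f. f x" for x] NE_zero by simp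
qed

lemma NE_scale_le:
  assumes "F \<in> borel_measurable M" "0 \<le> c"
  shows "NE M \<psi> (\<lambda>x. ennreal c * F x) \<le> ennreal c * NE M \<psi> F"
proof (cases "c = 0")
  case False
  show ?thesis
  proof (rule NE_leI)
    fix t assume t: "t \<in> dom"
    have "Kf M t (\<lambda>x. ennreal c * F x) \<le> ennreal c * Kf M t F"
      by (rule Kf_scale_le) (use assms False t in auto)
    also have "\<dots> \<le> ennreal c * (ennreal (\<psi> t) * NE M \<psi> F)" by (intro mult_left_mono Kf_le_NE t) simp
    finally show "Kf M t (\<lambda>x. ennreal c * F x) \<le> ennreal (\<psi> t) * (ennreal c * NE M \<psi> F)" by (simp add: mult_ac)
  qed
qed (simp add: NE_zero)

lemma NE_finite_AE:
  assumes [measurable]: "G \<in> borel_measurable M" and fin: "NE M \<psi> G < \<top>"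
  shows "AE x in M. G x \<noteq> \<top>"
proof -
  obtain t where t: "t \<in> dom" using dom_nonempty by blast
  have "Kf M t G \<le> ennreal (\<psi> t) * NE M \<psi> G" by (rule Kf_le_NE[OF t])
  also have "\<dots> < \<top>" using fin by (simp add: ennreal_mult_less_top)
  finally obtain c where c: "(\<integral>\<^sup>+x. G x - c \<partial>M) + ennreal t * c < \<top>"
    unfolding Kf_def INF_less_iff by blast
  then have "(\<integral>\<^sup>+x. G x - c \<partial>M) \<noteq> \<infinity>" by auto
  then have "AE x in M. G x - c \<noteq> \<infinity>" by (intro nn_integral_PInf_AE) measurable
  then show ?thesis by eventually_elim auto
qed

lemma X_iff: "f \<in> X \<longleftrightarrow> f \<in> borel_measurable M \<and> Nf f < \<top>"
  using marc_norm_e_eq[of f] by (auto simp: marc_space_def)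

lemma N_eq: "f \<in> X \<Longrightarrow> N f = enn2real (Nf f)"
  by (simp add: X_iff marc_norm_def marc_norm_e_eq)

lemma ennreal_N: "f \<in> X \<Longrightarrow> ennreal (N f) = Nf f"
  by (simp add: N_eq X_iff)

lemma X_NI: "f \<in> borel_measurable M \<Longrightarrow> Nf f \<le> ennreal c \<Longrightarrow> 0 \<le> c \<Longrightarrow> f \<in> X \<and> N f \<le> c"
  by (simp add: X_iff N_eq le_less_trans enn2real_leI)

lemma X_zero: "(\<lambda>x. 0) \<in> X"
  by (simp add: X_iff NE_zero)

lemma N_nonneg: "0 \<le> N f"
  by (simp add: marc_norm_def)

lemma X_add:
  assumes f: "f \<in> X" and g: "g \<in> X"
  shows "(\<lambda>x. f x + g x) \<in> X \<and> N (\<lambda>x. f x + g x) \<le> N f + N g"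
proof (rule X_NI)
  have [measurable]: "f \<in> borel_measurable M" "g \<in> borel_measurable M" using f g by (auto simp: X_iff)
  show "(\<lambda>x. f x + g x) \<in> borel_measurable M" by measurable
  have "Nf (\<lambda>x. f x + g x) \<le> NE M \<psi> (\<lambda>x. ennreal \<bar>f x\<bar> + ennreal \<bar>g x\<bar>)"
    by (rule NE_mono_AE) (auto simp: ennreal_plus[symmetric] intro!: AE_I2 ennreal_leI simp del: ennreal_plus)
  also have "\<dots> \<le> Nf f + Nf g" by (rule NE_add) measurable
  also have "\<dots> = ennreal (N f + N g)" by (simp add: ennreal_N[OF f, symmetric] ennreal_N[OF g, symmetric] N_nonneg)
  finally show "Nf (\<lambda>x. f x + g x) \<le> ennreal (N f + N g)" .
qed (simp add: N_nonneg)

lemma X_scale_le: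
  assumes f: "f \<in> X"
  shows "(\<lambda>x. c * f x) \<in> X \<and> N (\<lambda>x. c * f x) \<le> \<bar>c\<bar> * N f"
proof (rule X_NI)
  have [measurable]: "f \<in> borel_measurable M" using f by (auto simp: X_iff)
  show "(\<lambda>x. c * f x) \<in> borel_measurable M" by measurable
  have "(\<lambda>x. ennreal \<bar>c * f x\<bar>) = (\<lambda>x. ennreal \<bar>c\<bar> * ennreal \<bar>f x\<bar>)"
    by (simp add: abs_mult ennreal_mult)
  then have "Nf (\<lambda>x. c * f x) \<le> ennreal \<bar>c\<bar> * Nf f"
    using NE_scale_le[of "\<lambda>x. ennreal \<bar>f x\<bar>" "\<bar>c\<bar>"] by simp
  also have "\<dots> = ennreal (\<bar>c\<bar> * N f)" by (simp add: ennreal_N[OF f, symmetric] ennreal_mult N_nonneg)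
  finally show "Nf (\<lambda>x. c * f x) \<le> ennreal (\<bar>c\<bar> * N f)" .
qed (simp add: N_nonneg)

lemma N_scale:
  assumes f: "f \<in> X" shows "N (\<lambda>x. c * f x) = \<bar>c\<bar> * N f"
proof (cases "c = 0")
  case True
  then show ?thesis using X_scale_le[OF f, of 0] N_nonneg[of "\<lambda>x. 0 * f x"] by simp
next
  case False
  have cf: "(\<lambda>x. c * f x) \<in> X" and le: "N (\<lambda>x. c * f x) \<le> \<bar>c\<bar> * N f" using X_scale_le[OF f, of c] by auto
  have "N (\<lambda>x. 1 / c * (c * f x)) \<le> \<bar>1 / c\<bar> * N (\<lambda>x. c * f x)" using X_scale_le[OF cf, of "1/c"] by simp
  then have "\<bar>c\<bar> * N f \<le> N (\<lambda>x. c * f x)" using False by (simp add: field_simps)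
  then show ?thesis using le by simp
qed

lemma X_solid:
  assumes f: "f \<in> X" and g: "g \<in> borel_measurable M" and le: "AE x in M. \<bar>g x\<bar> \<le> \<bar>f x\<bar>"
  shows "g \<in> X \<and> N g \<le> N f"
proof (rule X_NI[OF g _ N_nonneg])
  show "Nf g \<le> ennreal (N f)" unfolding ennreal_N[OF f]
    by (rule NE_mono_AE) (use le in \<open>auto elim!: eventually_mono intro: ennreal_leI\<close>)
qed

text \<open>Riesz-Fischer: by \<open>NE_suminf\<close> the series of absolute differences along a
  subsequence has finite norm, so it converges almost everywhere, and its tails bound the distance
  to the limit.\<close>

lemma complete:
  assumes u: "\<And>n. u n \<in> X" and cauchy: "\<And>e. 0 < e \<Longrightarrow> \<exists>K. \<forall>m\<ge>K. \<forall>n\<ge>K. N (\<lambda>x. u m x - u n x) < e"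
  shows "\<exists>f\<in>X. (\<lambda>n. N (\<lambda>x. u n x - f x)) \<longlonglongrightarrow> 0"
proof -
  have um [measurable]: "u n \<in> borel_measurable M" for n using u[of n] by (simp add: X_iff)
  have sub: "(\<lambda>x. f x - g x) \<in> X" if "f \<in> X" "g \<in> X" for f g
    using X_add[OF that(1) conjunct1[OF X_scale_le[OF that(2), of "-1"]]] by simp
  have "\<forall>j. \<exists>K. \<forall>m\<ge>K. \<forall>n\<ge>K. N (\<lambda>x. u m x - u n x) < (1/2)^j" using cauchy by simp
  then obtain K where K: "\<And>j m n. m \<ge> K j \<Longrightarrow> n \<ge> K j \<Longrightarrow> N (\<lambda>x. u m x - u n x) < (1/2)^j" by metis
  \<comment> \<open>Partial sums make the indices nondecreasing and still at least
    \<open>K j\<close>.\<close>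
  define r where "r j = (\<Sum>i\<le>j. K i)" for j
  have rK: "K j \<le> r j" for j unfolding r_def by (rule member_le_sum) auto
  have rm: "r j \<le> r (Suc j)" for j by (simp add: r_def)
  define d where "d j x = u (r (Suc j)) x - u (r j) x" for j x
  have dm [measurable]: "d j \<in> borel_measurable M" for j unfolding d_def by measurable
  have dX: "d j \<in> X" for j unfolding d_def by (rule sub[OF u u])
  have dN: "Nf (d j) \<le> ennreal ((1/2)^j)" for j
    unfolding ennreal_N[OF dX, symmetric] unfolding d_def
    by (rule ennreal_leI, rule less_imp_le, rule K) (use rK[of j] rm[of j] in auto)
  have tailN: "NE M \<psi> (\<lambda>x. \<Sum>j. ennreal \<bar>d (k + j) x\<bar>) \<le> ennreal (2 * (1/2)^k)" for k
  proof -
    have "NE M \<psi> (\<lambda>x. \<Sum>j. ennreal \<bar>d (k + j) x\<bar>) \<le> (\<Sum>j. Nf (d (k + j)))" by (rule NE_suminf) measurable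
    also have "\<dots> \<le> (\<Sum>j. ennreal ((1/2)^(k + j)))" by (intro suminf_le summableI dN)
    also have "\<dots> = ennreal (2 * (1/2)^k)"
    proof (rule suminf_ennreal_eq)
      show "(\<lambda>j. (1/2)^(k + j)) sums (2 * (1/2)^k :: real)"
        using sums_mult[OF geometric_sums[of "1/2::real"], of "(1/2)^k"] by (simp add: power_add mult.commute)
    qed simp
    finally show ?thesis .
  qed
  define f where "f x = u (r 0) x + (\<Sum>j. d j x)" for x
  have fm [measurable]: "f \<in> borel_measurable M" unfolding f_def by measurable
  have "NE M \<psi> (\<lambda>x. \<Sum>j. ennreal \<bar>d j x\<bar>) < \<top>" using tailN[of 0] by (simp add: le_less_trans)
  then have "AE x in M. (\<Sum>j. ennreal \<bar>d j x\<bar>) \<noteq> \<top>" by (intro NE_finite_AE) measurable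
  then have tail: "AE x in M. \<forall>k. ennreal \<bar>u (r k) x - f x\<bar> \<le> (\<Sum>j. ennreal \<bar>d (k + j) x\<bar>)"
  proof eventually_elim
    case (elim x)
    have sa: "summable (\<lambda>j. \<bar>d j x\<bar>)" by (rule summable_suminf_not_top[OF _ elim]) simp
    then have s: "summable (\<lambda>j. d j x)" by (rule summable_rabs_cancel)
    show ?case
    proof
      fix k
      have "(\<Sum>j<k. d j x) = u (r k) x - u (r 0) x" unfolding d_def by (rule sum_lessThan_telescope)
      moreover have "(\<Sum>j. d j x) = (\<Sum>j. d (j + k) x) + (\<Sum>j<k. d j x)" by (rule suminf_split_initial_segment[OF s])
      ultimately have "u (r k) x - f x = - (\<Sum>j. d (j + k) x)" by (simp add: f_def)
      then have "\<bar>u (r k) x - f x\<bar> = \<bar>\<Sum>j. d (k + j) x\<bar>" by (simp add: add.commute)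
      also have sk: "summable (\<lambda>j. \<bar>d (k + j) x\<bar>)" using sa by (subst add.commute) (simp add: summable_iff_shift[of "\<lambda>j. \<bar>d j x\<bar>"])
      then have "\<bar>\<Sum>j. d (k + j) x\<bar> \<le> (\<Sum>j. \<bar>d (k + j) x\<bar>)" by (rule summable_rabs)
      finally have "ennreal \<bar>u (r k) x - f x\<bar> \<le> ennreal (\<Sum>j. \<bar>d (k + j) x\<bar>)" by (rule ennreal_leI)
      also have "\<dots> = (\<Sum>j. ennreal \<bar>d (k + j) x\<bar>)" by (rule suminf_ennreal2[symmetric, OF _ sk]) simp
      finally show "ennreal \<bar>u (r k) x - f x\<bar> \<le> (\<Sum>j. ennreal \<bar>d (k + j) x\<bar>)" .
    qed
  qed
  have close: "(\<lambda>x. u (r k) x - f x) \<in> X \<and> N (\<lambda>x. u (r k) x - f x) \<le> 2 * (1/2)^k" for k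
  proof (rule X_NI)
    have "Nf (\<lambda>x. u (r k) x - f x) \<le> NE M \<psi> (\<lambda>x. \<Sum>j. ennreal \<bar>d (k + j) x\<bar>)"
      by (rule NE_mono_AE) (use tail in \<open>auto elim!: eventually_mono\<close>)
    also note tailN
    finally show "Nf (\<lambda>x. u (r k) x - f x) \<le> ennreal (2 * (1/2)^k)" .
  qed simp_all
  have fX: "f \<in> X" using sub[OF u[of "r 0"] conjunct1[OF close[of 0]]] by simp
  have "(\<lambda>n. N (\<lambda>x. u n x - f x)) \<longlonglongrightarrow> 0"
  proof (rule LIMSEQ_I)
    fix e :: real assume e: "0 < e"
    obtain k where k: "(1/2::real)^k < e / 3" using real_arch_pow_inv[of "e/3" "1/2"] e by auto
    have "norm (N (\<lambda>x. u n x - f x) - 0) < e" if n: "n \<ge> r k" for n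
    proof -
      have "N (\<lambda>x. (u n x - u (r k) x) + (u (r k) x - f x)) \<le> N (\<lambda>x. u n x - u (r k) x) + N (\<lambda>x. u (r k) x - f x)"
        using X_add[OF sub[OF u u] conjunct1[OF close]] by blast
      also have "\<dots> < (1/2)^k + 2 * (1/2)^k"
        by (intro add_less_le_mono K conjunct2[OF close]) (use n rK[of k] in auto)
      also have "\<dots> < e" using k by simp
      finally show ?thesis using N_nonneg by simp
    qed
    then show "\<exists>no. \<forall>n\<ge>no. norm (N (\<lambda>x. u n x - f x) - 0) < e" by blast
  qed
  then show ?thesis using fX by blast
qed

lemma banach: "banach_fun_space X N"
  unfolding banach_fun_space_def
  using X_zero X_add X_scale_le N_nonneg N_scale complete by blast

text \<open>\<open>D k\<close> bounds the measure of \<open>{|f| > 2\<^sup>k}\<close> for \<open>f\<close> in the unit ball.  It is infinite when no \<open>t\<close> qualifies,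
  even if the whole space has finite measure; capping it there would violate \<open>2 D (k + 1) \<le> D k\<close>.\<close>

definition D :: "int \<Rightarrow> ennreal" where
  "D k = Inf {ennreal t |t. t \<in> dom \<and> \<psi> t \<le> 2 powi k * t}"

lemma D_le: "t \<in> dom \<Longrightarrow> \<psi> t \<le> 2 powi k * t \<Longrightarrow> D k \<le> ennreal t"
  unfolding D_def by (rule Inf_lower) auto

lemma D_half: "2 * D (k + 1) \<le> D k"
  unfolding D_def[of k]
proof (rule Inf_greatest, clarify)
  fix t assume t: "0 < t" "ennreal t < gam M" "\<psi> t \<le> 2 powi k * t"
  have h: "t / 2 \<in> dom" by (rule dom_smaller[of t]) (use t in auto)
  have "\<psi> (t / 2) \<le> \<psi> t" by (rule \<psi>_mono) (use t in auto)
  then have "\<psi> (t / 2) \<le> 2 powi (k + 1) * (t / 2)" using t by (simp add: powi_step)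
  then have "D (k + 1) \<le> ennreal (t / 2)" by (rule D_le[OF h])
  then have "2 * D (k + 1) \<le> 2 * ennreal (t / 2)" by (rule mult_left_mono) simp
  also have "\<dots> = ennreal t" using t by (simp add: ennreal_mult''[symmetric] flip: ennreal_numeral)
  finally show "2 * D (k + 1) \<le> ennreal t" .
qed

lemma ex_level:
  assumes t: "t \<in> dom"
  shows "\<exists>k. \<psi> t \<le> 2 powi k * t \<and> 2 powi k * t \<le> 2 * \<psi> t"
proof -
  define y where "y = \<psi> t / t"
  have p: "0 < y" using t \<psi>_pos by (auto simp: y_def)
  define k where "k = lvl y + 1"
  have "2 powi (k - 1) < y" "y \<le> 2 powi k"
    using lvl_bounds[of y] p powi_step[of "lvl y"] by (auto simp: k_def)
  moreover have "(2::real) powi k = 2 * 2 powi (k - 1)" using powi_step[of "k - 1"] by simp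
  ultimately show ?thesis using t by (intro exI[of _ k]) (auto simp: field_simps y_def)
qed

text \<open>Were \<open>D k\<close> larger than \<open>\<psi> t / 2 powi k\<close>, a point
  \<open>s\<close> between the two would satisfy
  \<open>\<psi> s \<le> \<psi> t \<le> 2 powi k * s\<close> and so compete in the infimum defining
  \<open>D k\<close>.\<close>

lemma D_mult_le:
  assumes t: "t \<in> dom" and le: "\<psi> t \<le> 2 powi k * t"
  shows "ennreal (2 powi k) * D k \<le> ennreal (\<psi> t)"
proof -
  have Dt: "D k \<le> ennreal t" by (rule D_le[OF t le])
  then obtain d where d: "D k = ennreal d" "0 \<le> d" by (cases "D k") (auto simp: top_unique)
  have dt: "d \<le> t" using Dt d t by (simp add: ennreal_le_iff)
  have pt: "0 < \<psi> t" using t \<psi>_pos by simp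
  have p2: "(0::real) < 2 powi k" by simp
  have "2 powi k * d \<le> \<psi> t"
  proof (rule ccontr)
    assume "\<not> ?thesis"
    then have lt: "\<psi> t / 2 powi k < d" using p2 by (simp add: field_simps)
    obtain s where s: "\<psi> t / 2 powi k < s" "s < d" using dense[OF lt] by blast
    moreover have "0 < \<psi> t / 2 powi k" using pt p2 by simp
    ultimately have s0: "0 < s" by linarith
    have sd: "s \<in> dom" by (rule dom_smaller[OF t s0]) (use s dt in simp)
    have "\<psi> s \<le> \<psi> t" by (rule \<psi>_mono) (use s0 s dt t in auto)
    also have "\<dots> \<le> 2 powi k * s" using s(1) p2 by (simp add: field_simps)
    finally have "D k \<le> ennreal s" by (rule D_le[OF sd])
    then show False using d s s0 by (simp add: ennreal_le_iff)
  qed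
  then show ?thesis using d by (simp add: ennreal_mult''[symmetric] ennreal_leI)
qed

lemma ball_level:
  assumes f: "f \<in> X" and N1: "N f \<le> 1"
  shows "f \<in> level_ball M D 1"
proof -
  have [measurable]: "f \<in> borel_measurable M" using f by (simp add: X_iff)
  have N1': "Nf f \<le> 1" using N1 ennreal_N[OF f] by (metis ennreal_1 ennreal_leI)
  have "emeasure M (lev M f k) \<le> D k" for k
    unfolding D_def
  proof (rule Inf_greatest, clarify)
    fix t assume t: "0 < t" "ennreal t < gam M" "\<psi> t \<le> 2 powi k * t"
    have "lev M f k \<subseteq> {x \<in> space M. 2 powi k < \<bar>f x\<bar>}"
      using lvl_bounds(1) by (auto simp: lev_def)
    then have "emeasure M (lev M f k) \<le> distf M f (2 powi k)"
      unfolding distf_def by (rule emeasure_mono) measurable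
    also have "\<dots> \<le> ennreal t"
    proof (rule ccontr)
      assume "\<not> ?thesis"
      then have "ennreal (2 powi k) < drearr M f t" by (subst drearr_less_iff) auto
      then have "ennreal t * ennreal (2 powi k) < ennreal t * drearr M f t"
        by (rule ennreal_mult_strict_left_mono) (use t in auto)
      also have "\<dots> = (\<integral>\<^sup>+ u. indicator {0..t} u * drearr M f t \<partial>lborel)"
        using t by (simp add: nn_integral_multc)
      also have "\<dots> \<le> (\<integral>\<^sup>+ u. indicator {0..t} u * drearr M f u \<partial>lborel)"
      proof (rule nn_integral_mono)
        fix u :: real
        have "drearr M f t \<le> drearr M f u" if "u \<le> t"
          unfolding drearr_def using that by (intro Inf_superset_mono) (auto intro: order.trans ennreal_leI)
        then show "indicator {0..t} u * drearr M f t \<le> indicator {0..t} u * drearr M f u"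
          by (auto simp: indicator_def)
      qed
      also have "\<dots> = Kf M t (\<lambda>x. ennreal \<bar>f x\<bar>)" by (rule nn_integral_drearr) (use t in auto)
      also have "\<dots> \<le> ennreal (\<psi> t) * Nf f" by (rule Kf_le_NE) (use t in auto)
      also have "\<dots> \<le> ennreal (\<psi> t) * 1" by (intro mult_left_mono N1') simp
      also have "\<dots> \<le> ennreal t * ennreal (2 powi k)"
        using t by (simp add: ennreal_mult''[symmetric] ennreal_leI mult.commute)
      finally show False by simp
    qed
    finally show "emeasure M (lev M f k) \<le> ennreal t" .
  qed
  then show ?thesis by (simp add: level_ball_def)
qed

lemma Kf_level_le:
  assumes f [measurable]: "f \<in> borel_measurable M"
  shows "Kf M t (\<lambda>x. ennreal \<bar>f x\<bar>) \<le>
    (\<Sum>i. ennreal (2 * 2 powi (k + int i)) * emeasure M (lev M f (k + int i))) + ennreal t * ennreal (2 powi k)"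
proof -
  have "(\<integral>\<^sup>+x. ennreal \<bar>f x\<bar> - ennreal (2 powi k) \<partial>M)
    \<le> (\<integral>\<^sup>+x. (\<Sum>i. ennreal (2 * 2 powi (k + int i)) * indicator (lev M f (k + int i)) x) \<partial>M)"
  proof (rule nn_integral_mono)
    fix x assume x: "x \<in> space M"
    show "ennreal \<bar>f x\<bar> - ennreal (2 powi k) \<le> (\<Sum>i. ennreal (2 * 2 powi (k + int i)) * indicator (lev M f (k + int i)) x)"
    proof (cases "\<bar>f x\<bar> \<le> 2 powi k")
      case True
      then show ?thesis by (simp add: ennreal_minus ennreal_neg)
    next
      case False
      then have nz: "f x \<noteq> 0" by (smt (verit) zero_less_power_int)
      have "(2::real) powi k < 2 powi (lvl (f x) + 1)"
        using False lvl_bounds(2)[OF nz] by (simp add: powi_step)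
      then have "k < lvl (f x) + 1"
        using power_int_increasing[of "lvl (f x) + 1" k "2::real"] by (metis not_le one_le_numeral)
      then have i: "k + int (nat (lvl (f x) - k)) = lvl (f x)" by simp
      let ?i = "nat (lvl (f x) - k)"
      have "ennreal \<bar>f x\<bar> - ennreal (2 powi k) \<le> ennreal \<bar>f x\<bar>" by (rule diff_le_self_ennreal)
      also have "\<dots> \<le> ennreal (2 * 2 powi (k + int ?i)) * indicator (lev M f (k + int ?i)) x"
        unfolding i using x nz lvl_bounds(2)[OF nz] by (simp add: lev_def ennreal_leI)
      also have "\<dots> = (\<Sum>i\<in>{?i}. ennreal (2 * 2 powi (k + int i)) * indicator (lev M f (k + int i)) x)" by simp
      also have "\<dots> \<le> (\<Sum>i. ennreal (2 * 2 powi (k + int i)) * indicator (lev M f (k + int i)) x)"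
        by (rule sum_le_suminf) auto
      finally show ?thesis .
    qed
  qed
  also have "\<dots> = (\<Sum>i. \<integral>\<^sup>+x. ennreal (2 * 2 powi (k + int i)) * indicator (lev M f (k + int i)) x \<partial>M)"
    by (rule nn_integral_suminf) measurable
  also have "\<dots> = (\<Sum>i. ennreal (2 * 2 powi (k + int i)) * emeasure M (lev M f (k + int i)))"
    by (intro suminf_cong nn_integral_cmult_indicator lev_sets f)
  finally show ?thesis using Kf_le[of M t "\<lambda>x. ennreal \<bar>f x\<bar>" "ennreal (2 powi k)"] 
    by (meson add_right_mono order.trans)
qed

text \<open>With \<open>2 powi k * t\<close> comparable to \<open>\<psi> t\<close>, the cut is made
  \<open>a\<close> levels higher. The part below costs at most \<open>2 * 2^a * \<psi> t\<close>,
  whatever \<open>J\<close> is; the level \<open>a + i\<close> steps up costs at most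
  \<open>2 * J * \<psi> (t / 2^(a + i))\<close>. By \<open>decay\<close> these sum to
  \<open>2 * C\<^sub>0 * q^a / (1 - q)\<close> times \<open>J * \<psi> t\<close>, and a large
  \<open>a\<close> makes that factor at most \<open>e\<close>.\<close>

lemma level_norm:
  assumes e: "0 < e"
  shows "\<exists>C. \<forall>J\<ge>0. \<forall>f\<in>level_ball M D J. f \<in> X \<and> N f \<le> C + e * J"
proof -
  have "(\<lambda>a. 2 * C\<^sub>0 * q^a / (1 - q)) \<longlonglongrightarrow> 2 * C\<^sub>0 * 0 / (1 - q)"
    by (intro tendsto_intros LIMSEQ_power_zero) (use q in auto)
  then have "\<forall>\<^sub>F a in sequentially. 2 * C\<^sub>0 * q^a / (1 - q) < e"
    by (rule order_tendstoD) (use e in simp)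
  then obtain a where a: "2 * C\<^sub>0 * q^a / (1 - q) \<le> e" by (auto simp: eventually_sequentially intro: less_imp_le)
  have "f \<in> X \<and> N f \<le> 2 * 2^a + e * J" if J: "0 \<le> J" and f: "f \<in> level_ball M D J" for J f
  proof (rule X_NI)
    show fm [measurable]: "f \<in> borel_measurable M" using f by (simp add: level_ball_def)
    show "Nf f \<le> ennreal (2 * 2^a + e * J)"
    proof (rule NE_leI)
      fix t assume t: "t \<in> dom"
      have pt: "0 < \<psi> t" using t \<psi>_pos by simp
      obtain k where k: "\<psi> t \<le> 2 powi k * t" "2 powi k * t \<le> 2 * \<psi> t" using ex_level[OF t] by blast
      let ?k = "k + int a"
      have lv: "ennreal (2 * 2 powi (?k + int i)) * emeasure M (lev M f (?k + int i))
          \<le> ennreal (2 * J * C\<^sub>0 * q^a * \<psi> t * q^i)" for i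
      proof -
        let ?s = "t / 2^(a + i)"
        have sd: "?s \<in> dom" by (rule dom_smaller[OF t]) (use t in \<open>auto simp: field_simps\<close>)
        have "\<psi> ?s \<le> \<psi> t" by (rule \<psi>_mono) (use t sd in \<open>auto simp: field_simps\<close>)
        also have "\<dots> \<le> 2 powi k * t" by (rule k)
        also have "\<dots> = 2 powi (?k + int i) * ?s"
          by (simp add: power_int_add power_add)
        finally have le: "\<psi> ?s \<le> 2 powi (?k + int i) * ?s" .
        have "emeasure M (lev M f (?k + int i)) \<le> ennreal J * D (?k + int i)" using f by (simp add: level_ball_def)
        then have "ennreal (2 * 2 powi (?k + int i)) * emeasure M (lev M f (?k + int i))
            \<le> ennreal (2 * 2 powi (?k + int i)) * (ennreal J * D (?k + int i))" by (intro mult_left_mono) auto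
        also have "\<dots> = ennreal (2 * J) * (ennreal (2 powi (?k + int i)) * D (?k + int i))"
          using J by (simp add: ennreal_mult mult_ac)
        also have "\<dots> \<le> ennreal (2 * J) * ennreal (\<psi> ?s)"
          by (intro mult_left_mono D_mult_le[OF sd le]) simp
        also have "\<dots> \<le> ennreal (2 * J) * ennreal (C\<^sub>0 * q^(a + i) * \<psi> t)"
          by (intro mult_left_mono ennreal_leI decay) (use t in auto)
        also have "\<dots> = ennreal (2 * J * C\<^sub>0 * q^a * \<psi> t * q^i)"
          using J by (simp add: ennreal_mult'[symmetric] power_add mult_ac)
        finally show ?thesis .
      qed
      have "Kf M t (\<lambda>x. ennreal \<bar>f x\<bar>) \<le>
        (\<Sum>i. ennreal (2 * 2 powi (?k + int i)) * emeasure M (lev M f (?k + int i))) + ennreal t * ennreal (2 powi ?k)"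
        by (rule Kf_level_le[OF fm])
      also have "(\<Sum>i. ennreal (2 * 2 powi (?k + int i)) * emeasure M (lev M f (?k + int i)))
          \<le> (\<Sum>i. ennreal (2 * J * C\<^sub>0 * q^a * \<psi> t * q^i))"
        by (intro suminf_le summableI lv)
      also have "\<dots> = ennreal (2 * J * C\<^sub>0 * q^a * \<psi> t * (1 / (1 - q)))"
      proof (rule suminf_ennreal_eq)
        show "(\<lambda>i. 2 * J * C\<^sub>0 * q^a * \<psi> t * q^i) sums (2 * J * C\<^sub>0 * q^a * \<psi> t * (1 / (1 - q)))"
          by (intro sums_mult geometric_sums) (use q in simp)
      qed (use J C\<^sub>0 q pt in simp)
      also have "\<dots> \<le> ennreal (e * J * \<psi> t)"
      proof (rule ennreal_leI)
        have "2 * J * C\<^sub>0 * q^a * \<psi> t * (1 / (1 - q)) = (2 * C\<^sub>0 * q^a / (1 - q)) * (J * \<psi> t)" by simp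
        also have "\<dots> \<le> e * (J * \<psi> t)" using a J pt by (intro mult_right_mono) auto
        finally show "2 * J * C\<^sub>0 * q^a * \<psi> t * (1 / (1 - q)) \<le> e * J * \<psi> t" by simp
      qed
      also have "ennreal t * ennreal (2 powi ?k) = ennreal (2^a * (2 powi k * t))"
        using t by (simp add: ennreal_mult''[symmetric] power_int_add mult_ac)
      also have "\<dots> \<le> ennreal (2^a * (2 * \<psi> t))" by (intro ennreal_leI mult_left_mono k) simp
      also have "ennreal (e * J * \<psi> t) + ennreal (2^a * (2 * \<psi> t)) = ennreal (\<psi> t) * ennreal (2 * 2^a + e * J)"
        using e J pt by (simp add: ennreal_plus[symmetric] ennreal_mult''[symmetric] algebra_simps del: ennreal_plus)
      finally show "Kf M t (\<lambda>x. ennreal \<bar>f x\<bar>) \<le> ennreal (\<psi> t) * ennreal (2 * 2^a + e * J)"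
        by (simp add: add_mono)
    qed
  qed (use e J in simp)
  then show ?thesis by blast
qed

sublocale level_space M X N D
proof
  show "\<exists>k. D k < \<infinity>"
  proof -
    obtain t where t: "t \<in> dom" using dom_nonempty by blast
    obtain k where "\<psi> t \<le> 2 powi k * t" using ex_level[OF t] by blast
    then have "D k \<le> ennreal t" by (rule D_le[OF t])
    then show ?thesis using le_less_trans[OF _ ennreal_less_top] by auto
  qed
  show "f \<in> X \<Longrightarrow> f \<in> borel_measurable M" for f by (simp add: X_iff)
qed (use X_zero X_add X_scale_le N_scale X_solid D_half ball_level level_norm in blast)+

theorem grothendieck: "grothendieck_space X N"
  unfolding grothendieck_space_def using banach weak_convergence by blast

end

text \<open>Above \<open>T1\<close> and below \<open>T0\<close> each halving gains a factor
  \<open>q\<close>. In between only monotonicity is available, but \<open>n\<close> halvings lead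
  from \<open>T1\<close> below \<open>T0\<close>, so \<open>C = 1 / q^n\<close> absorbs the
  loss.\<close>

lemma dyadic_decay:
  fixes \<psi> :: "real \<Rightarrow> real"
  assumes pos: "\<And>t. t \<in> A \<Longrightarrow> 0 < \<psi> t"
    and A: "\<And>s t. t \<in> A \<Longrightarrow> 0 < s \<Longrightarrow> s \<le> t \<Longrightarrow> s \<in> A" "\<And>t. t \<in> A \<Longrightarrow> 0 < t"
    and mono: "\<And>s t. t \<in> A \<Longrightarrow> 0 < s \<Longrightarrow> s \<le> t \<Longrightarrow> \<psi> s \<le> \<psi> t"
    and q: "0 < q" "q < 1" and T: "0 < T0"
    and low: "\<And>t. t \<in> A \<Longrightarrow> t < T0 \<Longrightarrow> \<psi> (t / 2) \<le> q * \<psi> t"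
    and high: "\<And>t. t \<in> A \<Longrightarrow> T1 < t \<Longrightarrow> \<psi> (t / 2) \<le> q * \<psi> t"
  shows "\<exists>C\<ge>0. \<forall>t\<in>A. \<forall>i. \<psi> (t / 2^i) \<le> C * q^i * \<psi> t"
proof -
  have dA: "t / 2^i \<in> A" if "t \<in> A" for t and i :: nat
    using A(2)[OF that] by (intro A(1)[OF that]) (auto simp: field_simps)
  have small: "\<psi> (t / 2^i) \<le> q^i * \<psi> t" if t: "t \<in> A" "t < T0" for t and i :: nat
  proof (induction i)
    case (Suc i)
    have "t / 2^i \<le> t" using A(2)[OF t(1)] by (simp add: field_simps)
    then have "\<psi> (t / 2^i / 2) \<le> q * \<psi> (t / 2^i)" using t by (intro low dA) auto
    also have "\<dots> \<le> q * (q^i * \<psi> t)" using Suc q by simp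
    finally show ?case by (simp add: mult_ac)
  qed simp
  obtain n :: nat where n: "T1 / T0 < 2^n" using real_arch_pow[of 2 "T1 / T0"] by auto
  then have n': "T1 / 2^n < T0" using T by (simp add: field_simps)
  define C where "C = 1 / q^n"
  have C: "1 \<le> C" using q by (simp add: C_def power_le_one)
  have mid: "\<psi> (t / 2^i) \<le> C * q^i * \<psi> t" if t: "t \<in> A" "t \<le> T1" for t and i :: nat
  proof (cases "i \<le> n")
    case True
    have "\<psi> (t / 2^i) \<le> \<psi> t" using A(2)[OF t(1)] by (intro mono t) (auto simp: field_simps)
    also have "\<dots> \<le> C * q^i * \<psi> t"
    proof -
      have "q^n \<le> q^i" using q True by (intro power_decreasing) auto
      then have "1 \<le> C * q^i" using q by (simp add: C_def field_simps)
      then show ?thesis using pos[OF t(1)] by simp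
    qed
    finally show ?thesis .
  next
    case False
    then obtain j where j: "i = n + j" by (metis le_Suc_ex nat_le_linear)
    have tn: "t / 2^n < T0" using t(2) n' by (meson divide_right_mono le_less_trans zero_le_numeral zero_le_power)
    have "\<psi> (t / 2^n / 2^j) \<le> q^j * \<psi> (t / 2^n)" by (rule small[OF dA[OF t(1)] tn])
    also have "\<dots> \<le> q^j * \<psi> t"
      using q A(2)[OF t(1)] by (intro mult_left_mono mono t) (auto simp: field_simps)
    also have "q^j = C * q^i" using q by (simp add: C_def j power_add)
    finally show ?thesis by (simp add: j power_add)
  qed
  have "\<psi> (t / 2^i) \<le> C * q^i * \<psi> t" if "t \<in> A" for t and i :: nat
    using that
  proof (induction i arbitrary: t)
    case 0
    then show ?case using C pos[OF 0] by simp
  next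
    case (Suc i)
    show ?case
    proof (cases "t \<le> T1")
      case False
      have h: "t / 2 \<in> A" using dA[OF Suc.prems, of 1] by simp
      have "\<psi> (t / 2 / 2^i) \<le> C * q^i * \<psi> (t / 2)" by (rule Suc.IH[OF h])
      also have "\<dots> \<le> C * q^i * (q * \<psi> t)"
        using C q False by (intro mult_left_mono high Suc.prems) auto
      finally show ?thesis by (simp add: mult_ac)
    qed (rule mid[OF Suc.prems])
  qed
  then show ?thesis using C by (intro exI[of _ C]) auto
qed

lemma Liminf_ratio:
  assumes "1 < Liminf F (\<lambda>t. ereal (h t))"
  shows "\<exists>c>1. \<forall>\<^sub>F t in F. c < h t"
proof -
  obtain c' where c': "1 < c'" "c' < Liminf F (\<lambda>t. ereal (h t))" using dense[OF assms] by blast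
  then obtain c where c: "1 < c" "ereal c < Liminf F (\<lambda>t. ereal (h t))"
    by (cases c') auto
  then show ?thesis using less_LiminfD[OF c(2)] by auto
qed

theorem theorem6p3:
  fixes M :: "'a measure" and \<psi> :: "real \<Rightarrow> real"
  assumes "sigma_finite_measure M"
    and "0 < gam M"
    and "\<And>t. 0 \<le> t \<Longrightarrow> ennreal t < gam M \<Longrightarrow> 0 \<le> \<psi> t"
    and "\<psi> 0 = 0"
    and "\<exists>t. 0 \<le> t \<and> ennreal t < gam M \<and> \<psi> t \<noteq> 0"
    and "mono_on {t. 0 \<le> t \<and> ennreal t < gam M} \<psi>"
    and "concave_on {t. 0 \<le> t \<and> ennreal t < gam M} \<psi>"
    and "continuous_on {t. 0 < t \<and> ennreal t < gam M} \<psi>"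
    and "condA M \<psi> \<or> condB M \<psi>"
  shows "grothendieck_space (marc_space M \<psi>) (marc_norm M \<psi>)"
proof -
  let ?A = "{t. 0 < t \<and> ennreal t < gam M}"
  have smaller: "s \<in> ?A" if "t \<in> ?A" "0 < s" "s \<le> t" for s t
    using that by (auto intro: le_less_trans ennreal_leI)
  have mono: "\<psi> s \<le> \<psi> t" if "t \<in> ?A" "0 < s" "s \<le> t" for s t
    using mono_onD[OF assms(6), of s t] smaller[OF that] that by auto
  have pos: "0 < \<psi> t" if t: "t \<in> ?A" for t
  proof -
    obtain t1 where t1: "0 \<le> t1" "ennreal t1 < gam M" "\<psi> t1 \<noteq> 0" using assms(5) by blast
    then have p1: "0 < \<psi> t1" "0 < t1" using assms(3)[OF t1(1,2)] assms(4) by (auto simp: less_le)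
    show ?thesis
    proof (cases "t1 \<le> t")
      case True
      then show ?thesis using mono[OF t, of t1] p1 by simp
    next
      case False
      \<comment> \<open>Concavity and \<open>\<psi> 0 = 0\<close> put \<open>\<psi>\<close> above
        the chord from the origin to \<open>t1\<close>.\<close>
      have "(1 - t / t1) * \<psi> 0 + (t / t1) * \<psi> t1 \<le> \<psi> ((1 - t / t1) *\<^sub>R 0 + (t / t1) *\<^sub>R t1)"
        using t t1 False p1 assms(2) by (intro concave_onD[OF assms(7)]) auto
      then have "(t / t1) * \<psi> t1 \<le> \<psi> t" using p1 assms(4) by simp
      moreover have "0 < (t / t1) * \<psi> t1" using p1 t by (intro mult_pos_pos divide_pos_pos) auto
      ultimately show ?thesis by simp
    qed
  qed
  have lim0: "1 < Liminf (at_right 0) (\<lambda>t. ereal (\<psi> (2*t) / \<psi> t))"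
    using assms(9) by (auto simp: condA_def condB_def)
  obtain c0 where c0: "1 < c0" "\<forall>\<^sub>F t in at_right 0. c0 < \<psi> (2*t) / \<psi> t"
    using Liminf_ratio[OF lim0] by blast
  then obtain T0 where T0: "0 < T0" "\<And>t. 0 < t \<Longrightarrow> t < T0 \<Longrightarrow> c0 < \<psi> (2*t) / \<psi> t"
    by (auto simp: eventually_at_right_field)
  have "\<exists>c1 T1. 1 < c1 \<and> (\<forall>t\<in>?A. T1 < t \<longrightarrow> c1 < \<psi> t / \<psi> (t / 2))"
  proof (cases "gam M = \<infinity>")
    case True
    then have linf: "1 < Liminf at_top (\<lambda>t. ereal (\<psi> (2*t) / \<psi> t))"
      using assms(9) by (auto simp: condA_def condB_def)
    obtain c1 where c1: "1 < c1" "\<forall>\<^sub>F t in at_top. c1 < \<psi> (2*t) / \<psi> t"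
      using Liminf_ratio[OF linf] by blast
    then obtain T where T: "\<And>t. T \<le> t \<Longrightarrow> c1 < \<psi> (2*t) / \<psi> t" by (auto simp: eventually_at_top_linorder)
    have "c1 < \<psi> t / \<psi> (t / 2)" if "2 * T < t" for t using T[of "t / 2"] that by simp
    then show ?thesis using c1(1) by blast
  next
    case False
    then obtain g where g: "gam M = ennreal g" "0 \<le> g" by (cases "gam M") auto
    have "\<not> g < t" if "t \<in> ?A" for t using that g by (auto simp: ennreal_less_iff)
    \<comment> \<open>No point of the domain lies beyond \<open>g\<close>, so the condition is
      vacuous and any constant above 1 would do.\<close>
    then show ?thesis by (intro exI[of _ 2] exI[of _ g]) auto
  qed
  then obtain c1 T1 where c1: "1 < c1" "\<And>t. t \<in> ?A \<Longrightarrow> T1 < t \<Longrightarrow> c1 < \<psi> t / \<psi> (t / 2)" by blast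
  define q where "q = max (1 / c0) (1 / c1)"
  have q: "0 < q" "q < 1" using c0(1) c1(1) by (auto simp: q_def less_max_iff_disj)
  have step: "\<psi> (t / 2) \<le> q * \<psi> t" if t: "t \<in> ?A" and c: "1 < c" "c < \<psi> t / \<psi> (t / 2)" "1 / c \<le> q" for c t
  proof -
    have h: "0 < \<psi> (t / 2)" by (rule pos[OF smaller[OF t]]) (use t in auto)
    then have "\<psi> (t / 2) \<le> 1 / c * \<psi> t" using c by (simp add: field_simps)
    also have "\<dots> \<le> q * \<psi> t" using c pos[OF t] by (intro mult_right_mono) auto
    finally show ?thesis .
  qed
  have "\<exists>C\<ge>0. \<forall>t\<in>?A. \<forall>i. \<psi> (t / 2^i) \<le> C * q^i * \<psi> t"
  \<comment> \<open>The threshold is doubled because the ratio at \<open>t / 2\<close> compares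
    \<open>\<psi> t\<close> with \<open>\<psi> (t / 2)\<close>.\<close>
  proof (rule dyadic_decay[of ?A \<psi> q "2 * T0" T1])
    show "\<psi> (t / 2) \<le> q * \<psi> t" if "t \<in> ?A" "t < 2 * T0" for t
      using T0(2)[of "t / 2"] that by (intro step[OF that(1) c0(1)]) (auto simp: q_def)
    show "\<psi> (t / 2) \<le> q * \<psi> t" if "t \<in> ?A" "T1 < t" for t
      using c1 that by (intro step[OF that(1) c1(1)]) (auto simp: q_def)
  qed (use pos smaller mono q T0 in auto)
  then obtain C where C: "0 \<le> C" "\<And>t i. t \<in> ?A \<Longrightarrow> \<psi> (t / 2^i) \<le> C * q^i * \<psi> t" by blast
  interpret sigma_finite_measure M by (rule assms(1))
  interpret marcinkiewicz M \<psi> C q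
  proof
    show "0 < t \<Longrightarrow> ennreal t < gam M \<Longrightarrow> 0 < \<psi> t" for t using pos by simp
    show "\<psi> s \<le> \<psi> t" if "0 < s" "s \<le> t" "ennreal t < gam M" for s t using mono[of t s] that by simp
    show "\<psi> (t / 2^i) \<le> C * q^i * \<psi> t" if "0 < t" "ennreal t < gam M" for t i using C(2)[of t i] that by simp
  qed (use assms(2) q C(1) in auto)
  show ?thesis by (rule grothendieck)
qed

end
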